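(* For every integer $\ell\geq 1$, every $2$-connected graph $G$ of pathwidth at least $2^{9\ell^2 - 3\ell +2}-2$ contains $\Gamma_{\ell}^{+}$ or $\nabla_\ell$ as a minor.
   Context: All graphs are finite and simple. For $\ell\ge 0$, $\Gamma_\ell$ denotes the complete binary tree of height $\ell$ (every non-leaf vertex has two children, $2^\ell$ leaves, every root-to-leaf path has $\ell$ edges). $\Gamma_\ell^+$ is obtained from $\Gamma_\ell$ by adding one new vertex adjacent to all leaves. The graphs $\nabla_\ell$ ($\ell\ge1$), each with a designated root edge, are defined recursively: $\nabla_1$ is a triangle with one edge designated as root edge; $\nabla_{\ell+1}$ is obtained by taking two disjoint copies of $\nabla_\ell$ with root edges $e_1,e_2$ and a triangle with edges $e_1',e_2',e_3$, identifying $e_i$ with $e_i'$ for $i=1,2$, and declaring $e_3$ the root edge. The pathwidth of $G$ is the minimum $k$ such that there are sets $B_1,\dots,B_n\subseteq V(G)$ with $|B_i|\le k+1$, each vertex lying in a non-empty interval of consecutive $B_i$'s, and each edge contained in some $B_i$. *)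

theory Defs
  imports "Graph_Theory.Graph_Theory"
begin

text \<open>
  A finite simple graph is a \<^locale>\<open>pair_graph\<close>: a finite, loop-free, symmetric digraph without
  parallel arcs, where the undirected edge \<open>uv\<close> is the pair of arcs \<open>(u, v)\<close>, \<open>(v, u)\<close>.
  \<^const>\<open>connected\<close> includes non-emptiness.
\<close>

definition k_connected :: "nat \<Rightarrow> 'a pair_pre_digraph \<Rightarrow> bool" where
  "k_connected k G \<longleftrightarrow> card (pverts G) > k \<and>
     (\<forall>X \<subseteq> pverts G. card X < k \<longrightarrow> connected (with_proj G \<restriction> (pverts G - X)))"

definition path_decomposition :: "'a pair_pre_digraph \<Rightarrow> 'a set list \<Rightarrow> bool" where
  "path_decomposition G Bs \<longleftrightarrow>
     (\<forall>B \<in> set Bs. B \<subseteq> pverts G) \<and>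
     (\<forall>v \<in> pverts G. \<exists>a b. a \<le> b \<and> {i. i < length Bs \<and> v \<in> Bs ! i} = {a..b}) \<and>
     (\<forall>(u, v) \<in> parcs G. \<exists>B \<in> set Bs. u \<in> B \<and> v \<in> B)"

definition pathwidth :: "'a pair_pre_digraph \<Rightarrow> nat" where
  "pathwidth G = (LEAST k. \<exists>Bs. path_decomposition G Bs \<and> (\<forall>B \<in> set Bs. card B \<le> k + 1))"

text \<open>
  Contraction of the edge \<open>uv\<close>: the merged vertex keeps the name \<open>u\<close>; the resulting loop is
  dropped and parallel edges coincide.
\<close>

definition contract_edge :: "'a \<Rightarrow> 'a \<Rightarrow> 'a pair_pre_digraph \<Rightarrow> 'a pair_pre_digraph" where
  "contract_edge u v G = (let f = id(v := u) in
     \<lparr> pverts = pverts G - {v},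
       parcs = {(f x, f y) | x y. (x, y) \<in> parcs G \<and> f x \<noteq> f y} \<rparr>)"

inductive contracts_to :: "'a pair_pre_digraph \<Rightarrow> 'a pair_pre_digraph \<Rightarrow> bool" for G where
  refl: "contracts_to G G"
| step: "contracts_to G H \<Longrightarrow> (u, v) \<in> parcs H \<Longrightarrow> contracts_to G (contract_edge u v H)"

definition is_minor :: "'b pair_pre_digraph \<Rightarrow> 'a pair_pre_digraph \<Rightarrow> bool" where
  "is_minor H G \<longleftrightarrow>
     (\<exists>S K. pair_graph S \<and> subgraph (with_proj S) (with_proj G) \<and> contracts_to S K \<and>
            digraph_iso (with_proj H) (with_proj K))"

text \<open>
  Vertices of the complete binary tree are words over \<^typ>\<open>bool\<close> of length at most \<open>l\<close>; the root is
  the empty word, the children of \<open>w\<close> are \<open>False # w\<close> and \<open>True # w\<close>, the leaves are the words of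
  length \<open>l\<close>. In \<open>Gamma_plus\<close> the added vertex is \<^const>\<open>None\<close>.
\<close>

definition Gamma :: "nat \<Rightarrow> bool list pair_pre_digraph" where
  "Gamma l = \<lparr> pverts = {w. length w \<le> l},
               parcs = symcl {(w, b # w) | w b. length w < l} \<rparr>"

definition Gamma_plus :: "nat \<Rightarrow> bool list option pair_pre_digraph" where
  "Gamma_plus l =
     \<lparr> pverts = insert None (Some ` pverts (Gamma l)),
       parcs = map_prod Some Some ` parcs (Gamma l) \<union>
               symcl {(None, Some w) | w. length w = l} \<rparr>"

text \<open>
  \<open>nabla l\<close> is realised on the vertices \<open>0, \<dots>, 2 ^ l\<close> with root edge joining \<open>0\<close> and \<open>2 ^ l\<close>.
  With \<open>n = 2 ^ l\<close>, the second copy of \<open>nabla l\<close> is its translate by \<open>n\<close>. It meets the first copy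
  only in \<open>n\<close>, and the root edges \<open>{0, n}\<close>, \<open>{n, 2 * n}\<close> of the two copies are edges of the triangle
  on \<open>0, n, 2 * n\<close>, whose third edge \<open>{0, 2 * n}\<close> is the new root edge. This is the identification
  up to isomorphism; the orientation in which root edges are identified is immaterial, as every
  \<open>nabla l\<close> has the automorphism \<open>i \<mapsto> 2 ^ l - i\<close>. \<open>nabla 0\<close> is left unspecified.
\<close>

definition triangle :: "'a \<Rightarrow> 'a \<Rightarrow> 'a \<Rightarrow> 'a pair_pre_digraph" where
  "triangle a b c = \<lparr> pverts = {a, b, c}, parcs = symcl {(a, b), (b, c), (a, c)} \<rparr>"

fun nabla :: "nat \<Rightarrow> nat pair_pre_digraph" where
  "nabla (Suc 0) = triangle 0 1 2"
| "nabla (Suc (Suc k)) =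
     (let H = nabla (Suc k); n = 2 ^ Suc k; T = triangle 0 n (2 * n) in
      \<lparr> pverts = pverts H \<union> (+) n ` pverts H \<union> pverts T,
        parcs = parcs H \<union> map_prod ((+) n) ((+) n) ` parcs H \<union> parcs T \<rparr>)"

lemma symcl_iff: "(x, y) \<in> symcl R \<longleftrightarrow> (x, y) \<in> R \<or> (y, x) \<in> R"
  by (auto simp: symcl_def)

lemma pair_graphI:
  assumes "finite (pverts G)"
    and "\<And>u v. (u, v) \<in> parcs G \<Longrightarrow> u \<in> pverts G \<and> u \<noteq> v \<and> (v, u) \<in> parcs G"
  shows "pair_graph G"
proof -
  have "parcs G \<subseteq> pverts G \<times> pverts G"
  proof (rule subrelI)
    fix u v assume "(u, v) \<in> parcs G"
    with assms(2)[of u v] assms(2)[of v u] show "(u, v) \<in> pverts G \<times> pverts G" by simp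
  qed
  moreover from this have "finite (parcs G)" using assms(1) finite_subset by blast
  ultimately show ?thesis using assms
    by unfold_locales (auto simp: symmetric_def intro!: symI)
qed

lemma finite_Gamma_verts: "finite (pverts (Gamma l))"
  using finite_lists_length_le[of "UNIV :: bool set" l] by (simp add: Gamma_def)

lemma pair_graph_Gamma_plus: "pair_graph (Gamma_plus l)"
  using finite_Gamma_verts[of l]
  by (intro pair_graphI) (auto simp: Gamma_plus_def Gamma_def symcl_iff map_prod_def)

lemma verts_nabla: "pverts (nabla (Suc k)) = {0..2 ^ Suc k}"
proof (induction k)
  case 0
  show ?case by (auto simp: triangle_def)
next
  case (Suc k)
  have "(+) n ` {0..n} = {n..2 * n}" for n :: nat by (simp add: mult_2)
  from this[of "2 ^ Suc k"] have "pverts (nabla (Suc (Suc k))) =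
      {0..2 ^ Suc k} \<union> {2 ^ Suc k..2 * 2 ^ Suc k} \<union> {0, 2 ^ Suc k, 2 * 2 ^ Suc k}"
    by (simp only: nabla.simps Let_def triangle_def pair_pre_digraph.simps Suc)
  then show ?case by (auto simp del: nabla.simps)
qed

lemma root_nabla: "(0, 2 ^ Suc k) \<in> parcs (nabla (Suc k))"
  by (cases k) (auto simp: triangle_def symcl_iff Let_def)

lemma pair_graph_nabla: "pair_graph (nabla (Suc k))"
proof (rule pair_graphI)
  show "finite (pverts (nabla (Suc k)))" by (simp only: verts_nabla finite_atLeastAtMost)
  show "u \<in> pverts (nabla (Suc k)) \<and> u \<noteq> v \<and> (v, u) \<in> parcs (nabla (Suc k))"
    if "(u, v) \<in> parcs (nabla (Suc k))" for u v
    using that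
  proof (induction k arbitrary: u v)
    case 0
    then show ?case by (auto simp: triangle_def symcl_iff)
  next
    case (Suc k)
    define n :: nat where "n = 2 ^ Suc k"
    define H where "H = nabla (Suc k)"
    have N: "nabla (Suc (Suc k)) =
      \<lparr> pverts = pverts H \<union> (+) n ` pverts H \<union> {0, n, 2 * n},
        parcs = parcs H \<union> map_prod ((+) n) ((+) n) ` parcs H \<union> symcl {(0, n), (n, 2 * n), (0, 2 * n)} \<rparr>"
      by (simp only: nabla.simps Let_def n_def H_def triangle_def pair_pre_digraph.simps)
    have "n > 0" by (simp add: n_def)
    from Suc.prems consider
        (first) "(u, v) \<in> parcs H"
      | (second) x y where "(x, y) \<in> parcs H" "u = n + x" "v = n + y"
      | (triangle) "(u, v) \<in> symcl {(0, n), (n, 2 * n), (0, 2 * n)}"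
      unfolding N by auto
    then show ?case
    proof cases
      case first
      from Suc.IH[OF this[unfolded H_def]] show ?thesis unfolding N H_def by auto
    next
      case second
      from Suc.IH[OF this(1)[unfolded H_def]] second(2,3) show ?thesis unfolding N H_def by force
    next
      case triangle
      with \<open>n > 0\<close> show ?thesis unfolding N by (auto simp: symcl_iff)
    qed
  qed
qed

lemma pair_graph_contract_edge:
  assumes "pair_graph G" "(u, v) \<in> parcs G"
  shows "pair_graph (contract_edge u v G)"
proof -
  interpret pair_graph G by fact
  have sym: "(y, x) \<in> parcs G" if "(x, y) \<in> parcs G" for x y
    using that pair_sym_arcs by (auto simp: symmetric_def dest: symD)
  have uv: "u \<noteq> v" "u \<in> pverts G" using assms(2) by (auto dest: no_loops' in_arcsD1)
  define f where "f = id(v := u)"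
  have C: "contract_edge u v G = \<lparr> pverts = pverts G - {v},
       parcs = {(f x, f y) | x y. (x, y) \<in> parcs G \<and> f x \<noteq> f y} \<rparr>"
    by (simp add: contract_edge_def f_def Let_def)
  have f: "f x \<in> pverts G - {v}" if "x \<in> pverts G" for x
    using that uv by (auto simp: f_def)
  show ?thesis
  proof (rule pair_graphI)
    show "finite (pverts (contract_edge u v G))" by (simp add: C pair_finite_verts)
    fix a b assume "(a, b) \<in> parcs (contract_edge u v G)"
    then obtain x y where "(x, y) \<in> parcs G" "a = f x" "b = f y" "f x \<noteq> f y"
      by (auto simp: C)
    then show "a \<in> pverts (contract_edge u v G) \<and> a \<noteq> b \<and>
        (b, a) \<in> parcs (contract_edge u v G)"
      using sym[of x y] in_arcsD1[of x y] f[of x] unfolding C by simp metis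
  qed
qed

lemma pathwidth_witness:
  assumes "finite (pverts G)" "parcs G \<subseteq> pverts G \<times> pverts G"
  shows "\<exists>Bs. path_decomposition G Bs \<and> (\<forall>B \<in> set Bs. card B \<le> pathwidth G + 1)"
  unfolding pathwidth_def
proof (rule LeastI)
  have "{i. i < length [pverts G] \<and> v \<in> [pverts G] ! i} = {0..0}" if "v \<in> pverts G" for v
    using that by auto
  then show "\<exists>Bs. path_decomposition G Bs \<and> (\<forall>B \<in> set Bs. card B \<le> card (pverts G) + 1)"
    using assms(2) by (intro exI[of _ "[pverts G]"]) (fastforce simp: path_decomposition_def)
qed

end

theory Submission
  imports Defs
begin

text \<open>
  By the path-width theorem (the short proof of Diestel, based on Menger's theorem), \<open>G\<close> contains
  a model of the complete binary tree of height \<open>9 l\<^sup>2 - 3 l + 1\<close>. Assume that there is no \<open>\<Gamma>\<^sub>l\<^sup>+\<close>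
  minor.

  Let \<open>X\<close> consist of the top \<open>l + 3\<close> levels of a tree model in a 2-connected graph. If for some
  node \<open>v\<close> at depth 2 all components of the rest that hang below \<open>v\<close> had a neighbour in the part
  of \<open>X\<close> not below \<open>v\<close>, then contracting everything outside the \<open>l + 1\<close> levels of \<open>X\<close> below \<open>v\<close> to
  an apex would give a \<open>\<Gamma>\<^sub>l\<^sup>+\<close> minor. Hence at least four different components contain a large
  subtree, and two of them avoid two prescribed vertices \<open>a\<close>, \<open>b\<close>. At the expense of \<open>l\<close> further
  levels the subtrees lie in 2-connected subgraphs \<open>B1\<close>, \<open>B2\<close> of these components. There is a
  cycle through \<open>B1\<close> and \<open>B2\<close>, and \<open>a\<close>, \<open>b\<close> are joined to it by disjoint paths. So \<open>a\<close> and \<open>b\<close> are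
  linked either through \<open>B1\<close> and \<open>B2\<close> in series, with a direct connection besides, or through \<open>B1\<close>
  and \<open>B2\<close> in parallel.

  In the first case models of \<open>\<nabla>\<^sub>i\<close> in \<open>B1\<close> and \<open>B2\<close> with prescribed ends of the root edge combine
  to a model of \<open>\<nabla>\<^sub>i\<^sub>+\<^sub>1\<close> whose root edge has the ends \<open>a\<close>, \<open>b\<close>. In the second case models of
  \<open>\<Gamma>\<^sub>j\<^sup>+\<close> with prescribed vertices in the root and in the apex combine to such a model of
  \<open>\<Gamma>\<^sub>j\<^sub>+\<^sub>1\<^sup>+\<close>, with either \<open>a\<close> or \<open>b\<close> in the root. So one of three kinds of rooted models grows in
  each step, at the cost of \<open>2 l + 3\<close> levels, and after \<open>3 l - 2\<close> steps one of them has height \<open>l\<close>.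
\<close>

section \<open>Connected sets and paths\<close>

definition connected_in :: "('a \<times> 'a) set \<Rightarrow> 'a set \<Rightarrow> bool" where
  "connected_in E S \<longleftrightarrow> S \<noteq> {} \<and> (\<forall>x\<in>S. \<forall>y\<in>S. (x, y) \<in> (E \<inter> S \<times> S)\<^sup>*)"

definition adjacent :: "('a \<times> 'a) set \<Rightarrow> 'a set \<Rightarrow> 'a set \<Rightarrow> bool" where
  "adjacent E A B \<longleftrightarrow> (\<exists>x\<in>A. \<exists>y\<in>B. (x, y) \<in> E)"

definition component_in :: "('a \<times> 'a) set \<Rightarrow> 'a set \<Rightarrow> 'a set \<Rightarrow> bool" where
  "component_in E S K \<longleftrightarrow> connected_in E K \<and> K \<subseteq> S \<and> \<not> adjacent E K (S - K)"

definition biconnected_in :: "('a \<times> 'a) set \<Rightarrow> 'a set \<Rightarrow> bool" where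
  "biconnected_in E S \<longleftrightarrow> connected_in E S \<and> (\<forall>v. connected_in E (S - {v}))"

definition path_in :: "('a \<times> 'a) set \<Rightarrow> 'a set \<Rightarrow> 'a list \<Rightarrow> bool" where
  "path_in E S p \<longleftrightarrow> p \<noteq> [] \<and> distinct p \<and> set p \<subseteq> S \<and> successively (\<lambda>x y. (x, y) \<in> E) p"

lemma connected_in_nonempty: "connected_in E S \<Longrightarrow> S \<noteq> {}"
  by (simp add: connected_in_def)

lemma connected_in_singleton [simp]: "connected_in E {x}"
  by (simp add: connected_in_def)

lemma connected_in_mono_edges:
  assumes "connected_in E S" "E \<subseteq> E'"
  shows "connected_in E' S"
proof -
  have "(E \<inter> S \<times> S)\<^sup>* \<subseteq> (E' \<inter> S \<times> S)\<^sup>*" using assms(2) by (intro rtrancl_mono) auto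
  then show ?thesis using assms(1) unfolding connected_in_def by blast
qed

lemma connected_in_restrict_edges:
  assumes "C \<subseteq> S"
  shows "connected_in (E \<inter> S \<times> S) C \<longleftrightarrow> connected_in E C"
proof -
  have "E \<inter> S \<times> S \<inter> C \<times> C = E \<inter> C \<times> C" using assms by blast
  then show ?thesis by (simp add: connected_in_def)
qed

lemma rtrancl_mono_vertices:
  assumes "(x, y) \<in> (E \<inter> S \<times> S)\<^sup>*" "S \<subseteq> T"
  shows "(x, y) \<in> (E \<inter> T \<times> T)\<^sup>*"
  using assms(1) by (rule rev_subsetD) (rule rtrancl_mono, use assms(2) in auto)

lemma connected_in_cut:
  assumes "connected_in E S" "J \<subseteq> S" "J \<noteq> {}" "J \<noteq> S"
  shows "adjacent E J (S - J)"
proof (rule ccontr)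
  assume no_edge: "\<not> adjacent E J (S - J)"
  obtain x z where "x \<in> J" "z \<in> S" "z \<notin> J" using assms by blast
  then have "(x, z) \<in> (E \<inter> S \<times> S)\<^sup>*" using assms by (auto simp: connected_in_def)
  then have "z \<in> J"
    by (induction rule: rtrancl_induct) (use \<open>x \<in> J\<close> no_edge in \<open>auto simp: adjacent_def\<close>)
  with \<open>z \<notin> J\<close> show False ..
qed

lemma connected_in_image:
  assumes "connected_in E S"
    and "\<And>x y. x \<in> S \<Longrightarrow> y \<in> S \<Longrightarrow> (x, y) \<in> E \<Longrightarrow> g x = g y \<or> (g x, g y) \<in> E'"
  shows "connected_in E' (g ` S)"
proof -
  have "(g x, g y) \<in> (E' \<inter> g ` S \<times> g ` S)\<^sup>*" if "(x, y) \<in> (E \<inter> S \<times> S)\<^sup>*" for x y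
    using that
  proof (induction rule: rtrancl_induct)
    case (step y z)
    then have "g y = g z \<or> (g y, g z) \<in> E' \<inter> g ` S \<times> g ` S" using assms(2) by blast
    with step.IH show ?case by (auto intro: rtrancl_into_rtrancl)
  qed simp
  then show ?thesis using assms(1) by (auto simp: connected_in_def)
qed

lemma adjacent_mono: "adjacent E A B \<Longrightarrow> A \<subseteq> A' \<Longrightarrow> B \<subseteq> B' \<Longrightarrow> adjacent E A' B'"
  by (auto simp: adjacent_def)

lemma path_inD:
  assumes "path_in E S p"
  shows "p \<noteq> []" "distinct p" "set p \<subseteq> S" "successively (\<lambda>x y. (x, y) \<in> E) p"
    "hd p \<in> set p" "last p \<in> set p"
  using assms by (auto simp: path_in_def)

lemma path_in_mono: "path_in E S p \<Longrightarrow> set p \<subseteq> T \<Longrightarrow> path_in E T p"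
  by (auto simp: path_in_def)

lemma path_in_mono_edges: "path_in E S p \<Longrightarrow> E \<subseteq> E' \<Longrightarrow> path_in E' S p"
  unfolding path_in_def by (metis (mono_tags, lifting) subsetD successively_mono)

lemma path_in_appendD:
  assumes "path_in E S (p @ q)"
  shows "p \<noteq> [] \<Longrightarrow> path_in E S p" "q \<noteq> [] \<Longrightarrow> path_in E S q" "set p \<inter> set q = {}"
    "p \<noteq> [] \<Longrightarrow> q \<noteq> [] \<Longrightarrow> (last p, hd q) \<in> E"
  using assms by (auto simp: path_in_def successively_append_iff)

lemma connected_in_path:
  assumes "connected_in E S" "x \<in> S" "y \<in> S"
  obtains p where "path_in E S p" "hd p = x" "last p = y"
proof -
  have "(x, y) \<in> (E \<inter> S \<times> S)\<^sup>*" using assms by (simp add: connected_in_def)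
  then have "\<exists>p. path_in E S p \<and> hd p = x \<and> last p = y"
  proof (induction rule: rtrancl_induct)
    case base
    show ?case using assms(2) by (intro exI[of _ "[x]"]) (simp add: path_in_def)
  next
    case (step y z)
    then obtain p where p: "path_in E S p" "hd p = x" "last p = y" by blast
    show ?case
    proof (cases "z \<in> set p")
      case True
      then obtain u v where "p = u @ z # v" by (auto simp: in_set_conv_decomp)
      then have "p = (u @ [z]) @ v" "hd (u @ [z]) = hd p" by (auto simp: hd_append)
      then show ?thesis using path_in_appendD(1)[of E S "u @ [z]" v] p
        by (intro exI[of _ "u @ [z]"]) simp
    next
      case False
      then have "path_in E S (p @ [z])"
        using p step.hyps by (auto simp: path_in_def successively_append_iff)
      then show ?thesis using p by (intro exI[of _ "p @ [z]"]) (auto simp: path_in_def)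
    qed
  qed
  then show thesis using that by blast
qed

lemma connected_in_link:
  assumes "connected_in E X" "X \<inter> P \<noteq> {}" "X \<inter> Q \<noteq> {}"
  obtains p where "path_in E X p" "set p \<inter> P = {hd p}" "set p \<inter> Q = {last p}"
proof -
  obtain x y where xy: "x \<in> X" "x \<in> P" "y \<in> X" "y \<in> Q" using assms by blast
  obtain p where p: "path_in E X p" "hd p = x" "last p = y"
    using connected_in_path[OF assms(1) xy(1,3)] .
  have "\<exists>z\<in>set p. z \<in> Q" using path_inD(6)[OF p(1)] p(3) xy(4) by blast
  then obtain u z v where first: "p = u @ z # v" "z \<in> Q" "\<forall>t\<in>set u. t \<notin> Q"
    by (rule split_list_first_propE)
  have "hd (u @ [z]) = x" using p(2) first(1) by (auto simp: hd_append)
  then have "\<exists>t\<in>set (u @ [z]). t \<in> P" using xy(2) by (metis hd_in_set snoc_eq_iff_butlast)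
  then obtain r t s where last: "u @ [z] = r @ t # s" "t \<in> P" "\<forall>w\<in>set s. w \<notin> P"
    by (rule split_list_last_propE)
  have "p = r @ (t # s) @ v" using first(1) last(1) by (metis append.assoc append_Cons append_Nil)
  then have path: "path_in E X (t # s)"
    using p(1) path_in_appendD(1)[of E X "t # s" v] path_in_appendD(2)[of E X r "(t # s) @ v"]
    by simp
  have z: "last (t # s) = z" using last(1) by (metis last_appendR last_snoc list.distinct(1))
  have "set (t # s) \<subseteq> insert z (set u)" using arg_cong[OF last(1), of set] by auto
  then have "set (t # s) \<inter> Q = {last (t # s)}"
    using first(2,3) z path_inD(6)[OF path] by blast
  moreover have "set (t # s) \<inter> P = {hd (t # s)}" using last(2,3) by auto
  ultimately show thesis using path that by blast
qed

lemma component_in_absorb: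
  assumes "component_in E S K" "connected_in E C" "C \<subseteq> S" "C \<inter> K \<noteq> {}"
  shows "C \<subseteq> K"
proof (rule ccontr)
  assume "\<not> C \<subseteq> K"
  then have "adjacent E (C \<inter> K) (C - C \<inter> K)" using assms(2,4) by (intro connected_in_cut) auto
  then have "adjacent E K (S - K)" by (rule adjacent_mono) (use assms(3) in auto)
  then show False using assms(1) by (simp add: component_in_def)
qed

lemma component_in_eq:
  assumes "component_in E S K" "component_in E S K'" "K \<inter> K' \<noteq> {}"
  shows "K = K'"
  using assms component_in_absorb[of E S K K'] component_in_absorb[of E S K' K]
  unfolding component_in_def by blast

lemma biconnected_in_distinct:
  assumes "biconnected_in E B"
  obtains x y where "x \<in> B" "y \<in> B" "x \<noteq> y"
proof -
  obtain x where "x \<in> B" using assms by (auto simp: biconnected_in_def connected_in_def)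
  moreover have "B - {x} \<noteq> {}" using assms connected_in_nonempty by (metis biconnected_in_def)
  ultimately show thesis using that by blast
qed

lemma biconnected_in_card:
  assumes "biconnected_in E B" "finite B"
  shows "2 \<le> card B"
proof -
  obtain x y where "x \<in> B" "y \<in> B" "x \<noteq> y" using biconnected_in_distinct[OF assms(1)] .
  then have "card {x, y} \<le> card B" using assms(2) by (intro card_mono) auto
  then show ?thesis using \<open>x \<noteq> y\<close> by simp
qed

locale undirected =
  fixes E :: "('a \<times> 'a) set"
  assumes sym_edges: "sym E"
begin

lemma edge_sym: "(x, y) \<in> E \<Longrightarrow> (y, x) \<in> E"
  using sym_edges by (rule symD)

lemma adjacent_sym: "adjacent E A B \<Longrightarrow> adjacent E B A"
  using edge_sym by (auto simp: adjacent_def)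

lemma connectedI_root:
  assumes "x \<in> S" "\<And>y. y \<in> S \<Longrightarrow> (x, y) \<in> (E \<inter> S \<times> S)\<^sup>*"
  shows "connected_in E S"
proof -
  have "sym (E \<inter> S \<times> S)" using sym_edges by (auto simp: sym_def)
  then have "(y, x) \<in> (E \<inter> S \<times> S)\<^sup>*" if "y \<in> S" for y
    using assms(2)[OF that] by (meson sym_rtrancl symD)
  then show ?thesis
    unfolding connected_in_def using assms by (meson empty_iff rtrancl_trans)
qed

lemma connected_in_Un:
  assumes "connected_in E A" "connected_in E B" "A \<inter> B \<noteq> {}"
  shows "connected_in E (A \<union> B)"
proof -
  obtain x where x: "x \<in> A" "x \<in> B" using assms by blast
  show ?thesis
  proof (rule connectedI_root[of x])
    fix y assume "y \<in> A \<union> B"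
    then have "(x, y) \<in> (E \<inter> A \<times> A)\<^sup>* \<or> (x, y) \<in> (E \<inter> B \<times> B)\<^sup>*"
      using assms x by (auto simp: connected_in_def)
    then show "(x, y) \<in> (E \<inter> (A \<union> B) \<times> (A \<union> B))\<^sup>*"
      using rtrancl_mono_vertices by (metis Un_upper1 Un_upper2)
  qed (use x in simp)
qed

lemma connected_in_Un_adjacent:
  assumes "connected_in E A" "connected_in E B" "adjacent E A B"
  shows "connected_in E (A \<union> B)"
proof -
  obtain x y where xy: "x \<in> A" "y \<in> B" "(x, y) \<in> E" using assms(3) by (auto simp: adjacent_def)
  have "connected_in E {x, y}" using xy(3) by (intro connectedI_root[of x]) auto
  then have "connected_in E (A \<union> {x, y})" using assms(1) xy(1) by (intro connected_in_Un) auto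
  then have "connected_in E ((A \<union> {x, y}) \<union> B)"
    by (rule connected_in_Un) (use assms(2) xy(2) in auto)
  moreover have "(A \<union> {x, y}) \<union> B = A \<union> B" using xy by auto
  ultimately show ?thesis by simp
qed

lemma connected_in_UN:
  assumes A: "connected_in E A"
    and B: "\<And>i. i \<in> I \<Longrightarrow> connected_in E (B i)" "\<And>i. i \<in> I \<Longrightarrow> A \<inter> B i \<noteq> {} \<or> adjacent E A (B i)"
  shows "connected_in E (A \<union> (\<Union>i\<in>I. B i))"
proof -
  obtain x where x: "x \<in> A" using connected_in_nonempty[OF A] by blast
  show ?thesis
  proof (rule connectedI_root[of x])
    fix y assume "y \<in> A \<union> (\<Union>i\<in>I. B i)"
    then obtain C where C: "connected_in E C" "x \<in> C" "y \<in> C" "C \<subseteq> A \<union> (\<Union>i\<in>I. B i)"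
    proof (elim UnE UN_E)
      fix i assume i: "i \<in> I" "y \<in> B i"
      have "connected_in E (A \<union> B i)"
        using A B[OF i(1)] connected_in_Un connected_in_Un_adjacent by blast
      then show thesis by (rule that) (use x i in auto)
    qed (use A x that in auto)
    then show "(x, y) \<in> (E \<inter> (A \<union> (\<Union>i\<in>I. B i)) \<times> (A \<union> (\<Union>i\<in>I. B i)))\<^sup>*"
      using rtrancl_mono_vertices by (metis connected_in_def)
  qed (use x in simp)
qed

lemma connected_in_set:
  assumes "p \<noteq> []" "successively (\<lambda>x y. (x, y) \<in> E) p"
  shows "connected_in E (set p)"
  using assms
proof (induction p rule: induct_list012)
  case (3 x y zs)
  then have "adjacent E {x} (set (y # zs))" by (simp add: adjacent_def)
  then have "connected_in E ({x} \<union> set (y # zs))"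
    using 3 by (intro connected_in_Un_adjacent) simp_all
  then show ?case by (simp add: insert_commute)
qed simp_all

lemma connected_in_path_set: "path_in E S p \<Longrightarrow> connected_in E (set p)"
  using path_inD(1,4) connected_in_set by blast

lemma path_in_restrict_edges:
  assumes "path_in (E \<inter> S \<times> S) UNIV p" "set p \<inter> S \<noteq> {}"
  shows "path_in E S p"
proof -
  interpret restricted: undirected "E \<inter> S \<times> S"
    using sym_edges by unfold_locales (auto simp: sym_def)
  have "set p \<subseteq> S"
  proof (rule ccontr)
    assume "\<not> set p \<subseteq> S"
    then have "adjacent (E \<inter> S \<times> S) (set p \<inter> S) (set p - set p \<inter> S)"
      using restricted.connected_in_path_set[OF assms(1)] assms(2) by (intro connected_in_cut) auto
    then show False by (auto simp: adjacent_def)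
  qed
  then show ?thesis using assms(1) path_in_mono path_in_mono_edges by (metis Int_lower1)
qed

lemma path_in_rev:
  assumes "path_in E S p"
  shows "path_in E S (rev p)"
proof -
  have "successively (\<lambda>x y. (y, x) \<in> E) p"
    using path_inD(4)[OF assms] by (rule successively_mono) (simp add: edge_sym)
  then show ?thesis using assms by (simp add: path_in_def successively_rev)
qed

lemma component_in_exists:
  assumes "x \<in> S"
  obtains K where "component_in E S K" "x \<in> K"
proof -
  define K where "K = {y. (x, y) \<in> (E \<inter> S \<times> S)\<^sup>*}"
  have x: "x \<in> K" by (simp add: K_def)
  have KS: "K \<subseteq> S"
  proof
    fix y assume "y \<in> K"
    then have "(x, y) \<in> (E \<inter> S \<times> S)\<^sup>*" by (simp add: K_def)
    then show "y \<in> S" by (induction rule: rtrancl_induct) (use assms in auto)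
  qed
  have "connected_in E K"
  proof (rule connectedI_root[OF x])
    fix y assume "y \<in> K"
    then have "(x, y) \<in> (E \<inter> S \<times> S)\<^sup>*" by (simp add: K_def)
    then show "(x, y) \<in> (E \<inter> K \<times> K)\<^sup>*"
    proof (induction rule: rtrancl_induct)
      case (step y z)
      then have "y \<in> K" "z \<in> K" by (auto simp: K_def intro: rtrancl_into_rtrancl)
      with step show ?case by (auto intro: rtrancl_into_rtrancl)
    qed simp
  qed
  moreover have "\<not> adjacent E K (S - K)"
    using KS unfolding adjacent_def K_def by (auto intro: rtrancl_into_rtrancl)
  ultimately show thesis using x KS that by (simp add: component_in_def)
qed

end

section \<open>Menger's theorem\<close>

definition separates :: "('a \<times> 'a) set \<Rightarrow> 'a set \<Rightarrow> 'a set \<Rightarrow> 'a set \<Rightarrow> bool" where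
  "separates E A B Z \<longleftrightarrow> (\<forall>C. connected_in E C \<longrightarrow> C \<inter> A \<noteq> {} \<longrightarrow> C \<inter> B \<noteq> {} \<longrightarrow> C \<inter> Z \<noteq> {})"

definition linkage :: "('a \<times> 'a) set \<Rightarrow> 'a set \<Rightarrow> 'a set \<Rightarrow> 'a list set \<Rightarrow> bool" where
  "linkage E A B P \<longleftrightarrow> finite P \<and> disjoint_family_on set P \<and>
     (\<forall>p\<in>P. path_in E UNIV p \<and> set p \<inter> A = {hd p} \<and> set p \<inter> B = {last p})"

definition delete_edge :: "'a \<Rightarrow> 'a \<Rightarrow> ('a \<times> 'a) set \<Rightarrow> ('a \<times> 'a) set" where
  "delete_edge x y E = E - {(x, y), (y, x)}"

lemma separates_sym: "separates E A B Z \<longleftrightarrow> separates E B A Z"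
  by (auto simp: separates_def)

lemma delete_edge_subset: "delete_edge x y E \<subseteq> E"
  by (auto simp: delete_edge_def)

lemma adjacent_delete_edge:
  assumes "adjacent E A B" "\<not> adjacent (delete_edge x y E) A B"
  obtains u v where "u \<in> A" "v \<in> B" "(u, v) \<in> E" "(u, v) \<in> {(x, y), (y, x)}"
  using assms by (auto simp: adjacent_def delete_edge_def)

lemma disjoint_family_on_inj_representatives:
  assumes "disjoint_family_on F I" "\<And>i. i \<in> I \<Longrightarrow> r i \<in> F i"
  shows "inj_on r I"
  using assms unfolding inj_on_def by (metis disjoint_family_onD disjoint_iff)

lemma linkage_mono_edges: "linkage E A B P \<Longrightarrow> E \<subseteq> E' \<Longrightarrow> linkage E' A B P"
  unfolding linkage_def by (metis path_in_mono_edges)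

lemma full_linkage_target:
  assumes P: "linkage E A B P" "card P = card B" and "finite B"
  obtains p where "\<And>b. b \<in> B \<Longrightarrow> path_in E UNIV (p b) \<and> set (p b) \<inter> A = {hd (p b)} \<and>
      set (p b) \<inter> B = {b} \<and> last (p b) = b"
    "disjoint_family_on (\<lambda>b. set (p b)) B"
proof -
  have paths: "path_in E UNIV q" "set q \<inter> A = {hd q}" "set q \<inter> B = {last q}" if "q \<in> P" for q
    using P(1) that by (auto simp: linkage_def)
  have "inj_on last P"
    using P(1) path_inD(6)[OF paths(1)]
    by (intro disjoint_family_on_inj_representatives[of set]) (auto simp: linkage_def)
  moreover have "last ` P \<subseteq> B" using paths(3) by blast
  ultimately have last: "bij_betw last P B"
    using P(2) \<open>finite B\<close> by (metis bij_betw_def card_image card_subset_eq)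
  define p where "p = inv_into P last"
  have p: "p b \<in> P" "last (p b) = b" if "b \<in> B" for b
    using that last unfolding p_def by (auto simp: bij_betw_def inv_into_into f_inv_into_f)
  have "disjoint_family_on set P" using P(1) by (simp add: linkage_def)
  then have "disjoint_family_on (\<lambda>b. set (p b)) B"
    unfolding disjoint_family_on_def using p by metis
  then show thesis using paths p by (intro that) auto
qed

context undirected
begin

lemma undirected_delete_edge: "undirected (delete_edge x y E)"
  using sym_edges by unfold_locales (auto simp: delete_edge_def sym_def)

lemma linkage_rev:
  assumes "linkage E A B P"
  shows "linkage E B A (rev ` P)"
proof -
  have "path_in E UNIV (rev p)" if "p \<in> P" for p
    using assms that path_in_rev unfolding linkage_def by blast
  then show ?thesis using assms by (auto simp: linkage_def disjoint_family_on_def hd_rev last_rev)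
qed

lemma full_linkage_source:
  assumes P: "linkage E A B P" "card P = card A" and "finite A"
  obtains p where "\<And>a. a \<in> A \<Longrightarrow> path_in E UNIV (p a) \<and> set (p a) \<inter> B = {last (p a)} \<and>
      set (p a) \<inter> A = {a} \<and> hd (p a) = a"
    "disjoint_family_on (\<lambda>a. set (p a)) A"
proof -
  have "card (rev ` P) = card A" using P(2) by (simp add: card_image)
  then obtain p where p: "\<And>a. a \<in> A \<Longrightarrow> path_in E UNIV (p a) \<and> set (p a) \<inter> B = {hd (p a)} \<and>
      set (p a) \<inter> A = {a} \<and> last (p a) = a" "disjoint_family_on (\<lambda>a. set (p a)) A"
    using full_linkage_target[OF linkage_rev[OF P(1)] _ \<open>finite A\<close>] by blast
  have "path_in E UNIV (rev (p a)) \<and> set (rev (p a)) \<inter> B = {last (rev (p a))} \<and>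
      set (rev (p a)) \<inter> A = {a} \<and> hd (rev (p a)) = a" if "a \<in> A" for a
    using p(1)[OF that] path_in_rev path_inD(1) by (auto simp: hd_rev last_rev)
  moreover have "disjoint_family_on (\<lambda>a. set (rev (p a))) A" using p(2) by simp
  ultimately show thesis by (rule that)
qed

lemma linkage_of_connected:
  assumes "finite I" "disjoint_family_on C I"
    and C: "\<And>i. i \<in> I \<Longrightarrow> connected_in E (C i)" "\<And>i. i \<in> I \<Longrightarrow> C i \<inter> A \<noteq> {}" "\<And>i. i \<in> I \<Longrightarrow> C i \<inter> B \<noteq> {}"
  shows "\<exists>P. linkage E A B P \<and> card P = card I"
proof -
  have "\<forall>i\<in>I. \<exists>p. path_in E (C i) p \<and> set p \<inter> A = {hd p} \<and> set p \<inter> B = {last p}"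
    using C connected_in_link by metis
  then obtain p where p: "\<And>i. i \<in> I \<Longrightarrow> path_in E (C i) (p i) \<and> set (p i) \<inter> A = {hd (p i)} \<and>
      set (p i) \<inter> B = {last (p i)}" by metis
  have sub: "set (p i) \<subseteq> C i" "hd (p i) \<in> C i" if "i \<in> I" for i
    using p[OF that] path_inD(3,5) by blast+
  have "disjoint_family_on (\<lambda>i. set (p i)) I"
    using assms(2) sub(1) unfolding disjoint_family_on_def by blast
  then have "disjoint_family_on set (p ` I)" by (fastforce simp: disjoint_family_on_def)
  moreover have "inj_on (\<lambda>i. hd (p i)) I"
    by (intro disjoint_family_on_inj_representatives[OF assms(2)]) (rule sub(2))
  then have "inj_on p I" unfolding inj_on_def by metis
  moreover have "path_in E UNIV (p i)" if "i \<in> I" for i using p[OF that] path_in_mono by blast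
  ultimately show ?thesis
    using assms(1) p card_image unfolding linkage_def by (intro exI[of _ "p ` I"]) auto
qed

lemma nonseparating_after_insertion:
  assumes sep: "separates (delete_edge x y E) A B Z" and nsep: "\<not> separates E A B Z"
  obtains u v C D where "(u, v) \<in> {(x, y), (y, x)}" "(u, v) \<in> E"
    "connected_in (delete_edge x y E) C" "u \<in> C" "C \<inter> A \<noteq> {}" "C \<inter> Z = {}"
    "connected_in (delete_edge x y E) D" "v \<in> D" "D \<inter> B \<noteq> {}" "D \<inter> Z = {}"
proof -
  interpret deleted: undirected "delete_edge x y E" by (rule undirected_delete_edge)
  obtain F a b where F: "connected_in E F" "a \<in> F" "a \<in> A" "b \<in> F" "b \<in> B" "F \<inter> Z = {}"
    using nsep unfolding separates_def by blast
  obtain C where C: "component_in (delete_edge x y E) F C" "a \<in> C"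
    using deleted.component_in_exists[OF F(2)] .
  obtain D where D: "component_in (delete_edge x y E) F D" "b \<in> D"
    using deleted.component_in_exists[OF F(4)] .
  have sub: "connected_in (delete_edge x y E) C" "C \<subseteq> F" "connected_in (delete_edge x y E) D"
    "D \<subseteq> F"
    using C(1) D(1) by (auto simp: component_in_def)
  then have avoid: "C \<inter> B = {}" "D \<inter> A = {}" using sep C(2) D(2) F unfolding separates_def by blast+
  then have disj: "C \<inter> D = {}" using component_in_eq[OF C(1) D(1)] D(2) F(5) by blast
  have "adjacent E C (F - C)" "adjacent E D (F - D)"
    using F sub avoid C(2) D(2) by (intro connected_in_cut; blast)+
  moreover have "\<not> adjacent (delete_edge x y E) C (F - C)"
    "\<not> adjacent (delete_edge x y E) D (F - D)"
    using C(1) D(1) by (auto simp: component_in_def)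
  ultimately obtain u v u' v' where
    uv: "u \<in> C" "(u, v) \<in> E" "(u, v) \<in> {(x, y), (y, x)}" "u' \<in> D" "(u', v') \<in> {(x, y), (y, x)}"
    using adjacent_delete_edge by metis
  then have "v \<in> D" using disj by auto
  then show thesis using that uv sub C(2) D(2) F by blast
qed

text \<open>A connected set that meets \<^term>\<open>A\<close> and uses the edge must reach it at \<^term>\<open>x\<close>: arriving at
  \<^term>\<open>y\<close>, it could continue along \<^term>\<open>D\<close>.\<close>

lemma separates_insert_edge:
  assumes sep: "separates (delete_edge x y E) A B Z"
    and D: "connected_in (delete_edge x y E) D" "y \<in> D" "D \<inter> B \<noteq> {}" "D \<inter> Z = {}"
    and W: "separates (delete_edge x y E) A (insert x Z) W"
  shows "separates E A B W"
  unfolding separates_def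
proof (intro allI impI notI)
  interpret deleted: undirected "delete_edge x y E" by (rule undirected_delete_edge)
  fix F assume F: "connected_in E F" "F \<inter> A \<noteq> {}" "F \<inter> B \<noteq> {}" "F \<inter> W = {}"
  then obtain a where a: "a \<in> F" "a \<in> A" by blast
  obtain C where C: "component_in (delete_edge x y E) F C" "a \<in> C"
    using deleted.component_in_exists[OF a(1)] .
  then have sub: "connected_in (delete_edge x y E) C" "C \<subseteq> F" by (auto simp: component_in_def)
  then have avoid: "C \<inter> insert x Z = {}" using W F(4) C(2) a(2) unfolding separates_def by blast
  then have "C \<inter> B = {}" using sep sub(1) C(2) a(2) unfolding separates_def by blast
  then have "adjacent E C (F - C)" using F sub(2) C(2) by (intro connected_in_cut) auto
  moreover have "\<not> adjacent (delete_edge x y E) C (F - C)"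
    using C(1) by (simp add: component_in_def)
  ultimately obtain u v where "u \<in> C" "(u, v) \<in> {(x, y), (y, x)}"
    using adjacent_delete_edge by metis
  then have "y \<in> C" using avoid by auto
  then have "connected_in (delete_edge x y E) (C \<union> D)"
    using sub(1) D(1,2) by (intro deleted.connected_in_Un) auto
  then show False using sep C(2) a(2) D(3,4) avoid unfolding separates_def by blast
qed

lemma connected_prefix_avoiding:
  assumes p: "path_in E S p" "set p \<inter> Z \<subseteq> {last p}" and v: "v \<in> set p" "v \<notin> Z"
  obtains C where "connected_in E C" "hd p \<in> C" "v \<in> C" "C \<inter> Z = {}"
proof -
  obtain u w where uw: "p = u @ v # w" using split_list[OF v(1)] by blast
  then have "p = (u @ [v]) @ w" by simp
  then have "connected_in E (set (u @ [v]))"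
    using p(1) path_in_appendD(1)[of E S "u @ [v]" w] connected_in_path_set by blast
  moreover have "last p \<in> set (v # w)" using uw by (metis last_appendR last_in_set list.distinct(1))
  then have "last p \<notin> set u" using path_inD(2)[OF p(1)] uw by auto
  then have "set (u @ [v]) \<inter> Z = {}" using p(2) uw v(2) by auto
  moreover have "hd p \<in> set (u @ [v])" using uw by (cases u) auto
  ultimately show thesis using that by simp
qed

lemma separated_paths_meet:
  assumes sep: "separates E A B Z"
    and p: "path_in E S p" "hd p \<in> A" "set p \<inter> Z \<subseteq> {last p}"
    and q: "path_in E T q" "last q \<in> B" "set q \<inter> Z \<subseteq> {hd q}"
  shows "set p \<inter> set q \<subseteq> Z"
proof (rule subsetI, rule ccontr)
  fix v assume v: "v \<in> set p \<inter> set q" "v \<notin> Z"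
  obtain C where C: "connected_in E C" "hd p \<in> C" "v \<in> C" "C \<inter> Z = {}"
    using connected_prefix_avoiding[OF p(1,3)] v by blast
  have rev: "set (rev q) \<inter> Z \<subseteq> {last (rev q)}" using q(3) by (simp add: last_rev)
  obtain D where D: "connected_in E D" "hd (rev q) \<in> D" "v \<in> D" "D \<inter> Z = {}"
    by (rule connected_prefix_avoiding[OF path_in_rev[OF q(1)] rev, of v]) (use v in auto)
  have "connected_in E (C \<union> D)" using C(1,3) D(1,3) by (intro connected_in_Un) auto
  moreover have "last q \<in> D" using D(2) by (simp add: hd_rev)
  ultimately show False using sep p(2) q(2) C(2,4) D(4) unfolding separates_def by blast
qed

lemma linkage_join:
  assumes Z: "finite Z" "x \<notin> Z" "y \<notin> Z" and "(x, y) \<in> E"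
    and P: "\<And>z. z \<in> insert x Z \<Longrightarrow> connected_in E (P z) \<and> z \<in> P z \<and> P z \<inter> A \<noteq> {}"
      "disjoint_family_on P (insert x Z)"
    and Q: "\<And>z. z \<in> insert y Z \<Longrightarrow> connected_in E (Q z) \<and> z \<in> Q z \<and> Q z \<inter> B \<noteq> {}"
      "disjoint_family_on Q (insert y Z)"
    and meet: "\<And>z z'. z \<in> insert x Z \<Longrightarrow> z' \<in> insert y Z \<Longrightarrow> P z \<inter> Q z' \<subseteq> {z} \<inter> {z'}"
  shows "\<exists>L. linkage E A B L \<and> card L = card (insert x Z)"
proof (rule linkage_of_connected)
  define f where "f z = (if z = x then y else z)" for z
  have f: "f z \<in> insert y Z" if "z \<in> insert x Z" for z using that by (auto simp: f_def)
  show "connected_in E (P z \<union> Q (f z))" if z: "z \<in> insert x Z" for z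
  proof (cases "z = x")
    case True
    then have "adjacent E (P z) (Q (f z))"
      using P(1)[OF z] Q(1)[OF f[OF z]] \<open>(x, y) \<in> E\<close> by (auto simp: adjacent_def f_def)
    then show ?thesis using P(1)[OF z] Q(1)[OF f[OF z]] by (intro connected_in_Un_adjacent) auto
  next
    case False
    then have "z \<in> P z \<inter> Q (f z)" using P(1)[OF z] Q(1)[OF f[OF z]] by (auto simp: f_def)
    then show ?thesis using P(1)[OF z] Q(1)[OF f[OF z]] by (intro connected_in_Un) auto
  qed
  show "disjoint_family_on (\<lambda>z. P z \<union> Q (f z)) (insert x Z)"
    unfolding disjoint_family_on_def
  proof (intro ballI impI)
    fix z z' assume z: "z \<in> insert x Z" "z' \<in> insert x Z" "z \<noteq> z'"
    then have "f z \<noteq> f z'" "z \<noteq> f z'" "z' \<noteq> f z" using Z(2,3) \<open>(x, y) \<in> E\<close> by (auto simp: f_def)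
    then show "(P z \<union> Q (f z)) \<inter> (P z' \<union> Q (f z')) = {}"
      using disjoint_family_onD[OF P(2) z] disjoint_family_onD[OF Q(2) f[OF z(1)] f[OF z(2)]]
        meet[OF z(1) f[OF z(2)]] meet[OF z(2) f[OF z(1)]] by blast
  qed
  show "(P z \<union> Q (f z)) \<inter> A \<noteq> {}" "(P z \<union> Q (f z)) \<inter> B \<noteq> {}" if "z \<in> insert x Z" for z
    using P(1)[OF that] Q(1)[OF f[OF that]] by blast+
qed (use Z(1) in simp)

lemma linkage_through_separator:
  assumes sep: "separates (delete_edge x y E) A B Z"
    and Z: "finite Z" "x \<notin> Z" "y \<notin> Z" and "(x, y) \<in> E"
    and P: "linkage (delete_edge x y E) A (insert x Z) P" "card P = card (insert x Z)"
    and Q: "linkage (delete_edge x y E) (insert y Z) B Q" "card Q = card (insert y Z)"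
  shows "\<exists>L. linkage E A B L \<and> card L = card (insert x Z)"
proof -
  interpret deleted: undirected "delete_edge x y E" by (rule undirected_delete_edge)
  obtain p where p: "\<And>z. z \<in> insert x Z \<Longrightarrow> path_in (delete_edge x y E) UNIV (p z) \<and>
      set (p z) \<inter> A = {hd (p z)} \<and> set (p z) \<inter> insert x Z = {z} \<and> last (p z) = z"
    "disjoint_family_on (\<lambda>z. set (p z)) (insert x Z)"
    using full_linkage_target[OF P] Z(1) by blast
  obtain q where q: "\<And>z. z \<in> insert y Z \<Longrightarrow> path_in (delete_edge x y E) UNIV (q z) \<and>
      set (q z) \<inter> B = {last (q z)} \<and> set (q z) \<inter> insert y Z = {z} \<and> hd (q z) = z"
    "disjoint_family_on (\<lambda>z. set (q z)) (insert y Z)"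
    using deleted.full_linkage_source[OF Q] Z(1) by blast
  note connected = connected_in_mono_edges[OF deleted.connected_in_path_set delete_edge_subset]
  show ?thesis
  proof (rule linkage_join[OF Z \<open>(x, y) \<in> E\<close> _ p(2) _ q(2)])
    fix z assume z: "z \<in> insert x Z"
    show "connected_in E (set (p z)) \<and> z \<in> set (p z) \<and> set (p z) \<inter> A \<noteq> {}"
      using p(1)[OF z] connected path_inD(6) by fastforce
  next
    fix z assume z: "z \<in> insert y Z"
    show "connected_in E (set (q z)) \<and> z \<in> set (q z) \<and> set (q z) \<inter> B \<noteq> {}"
      using q(1)[OF z] connected path_inD(5) by fastforce
  next
    fix z z' assume z: "z \<in> insert x Z" "z' \<in> insert y Z"
    have "set (p z) \<inter> set (q z') \<subseteq> Z"
      by (rule deleted.separated_paths_meet[OF sep]) (use p(1)[OF z(1)] q(1)[OF z(2)] in auto)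
    moreover have "set (p z) \<inter> Z \<subseteq> {z}" "set (q z') \<inter> Z \<subseteq> {z'}"
      using p(1)[OF z(1)] q(1)[OF z(2)] by auto
    ultimately show "set (p z) \<inter> set (q z') \<subseteq> {z} \<inter> {z'}" by blast
  qed
qed

end

lemma menger_no_edges:
  assumes "finite A" "k \<le> card (A \<inter> B)"
  shows "\<exists>P. linkage {} A B P \<and> card P = k"
proof -
  interpret undirected "{}" by unfold_locales (simp add: sym_def)
  obtain I where I: "I \<subseteq> A \<inter> B" "finite I" "card I = k"
    using obtain_subset_with_card_n[OF assms(2)] assms(1) finite_subset by blast
  then have "\<exists>P. linkage {} A B P \<and> card P = card I"
    by (intro linkage_of_connected[of I "\<lambda>v. {v}"]) (auto simp: disjoint_family_on_def)
  then show ?thesis using I(3) by simp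
qed

lemma (in undirected) menger_insert_edge:
  assumes bound: "\<And>W. finite W \<Longrightarrow> separates E A B W \<Longrightarrow> k \<le> card W"
    and Z: "finite Z" "separates (delete_edge x y E) A B Z" "card Z < k"
    and IH: "\<And>A B. finite A \<Longrightarrow> finite B \<Longrightarrow>
      (\<And>W. finite W \<Longrightarrow> separates (delete_edge x y E) A B W \<Longrightarrow> k \<le> card W) \<Longrightarrow>
      \<exists>P. linkage (delete_edge x y E) A B P \<and> card P = k"
    and "finite A" "finite B"
  shows "\<exists>P. linkage E A B P \<and> card P = k"
proof -
  have "\<not> separates E A B Z" using bound Z(1,3) by fastforce
  then obtain u v C D where uv: "(u, v) \<in> {(x, y), (y, x)}" "(u, v) \<in> E"
    and C: "connected_in (delete_edge x y E) C" "u \<in> C" "C \<inter> A \<noteq> {}" "C \<inter> Z = {}"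
    and D: "connected_in (delete_edge x y E) D" "v \<in> D" "D \<inter> B \<noteq> {}" "D \<inter> Z = {}"
    using nonseparating_after_insertion[OF Z(2)] by blast
  have edge: "delete_edge x y E = delete_edge u v E" "delete_edge x y E = delete_edge v u E"
    using uv(1) by (auto simp: delete_edge_def)
  have sep_A: "k \<le> card W" if "finite W" "separates (delete_edge x y E) A (insert u Z) W" for W
    using separates_insert_edge[of u v A B Z D W] Z(2) D that bound unfolding edge(1) by blast
  have sep_B: "k \<le> card W" if "finite W" "separates (delete_edge x y E) (insert v Z) B W" for W
    using separates_insert_edge[of v u B A Z C W] Z(2) C that bound separates_sym
    unfolding edge(2) by metis
  have notin: "u \<notin> Z" "v \<notin> Z" using C(2,4) D(2,4) by blast+
  have "k \<le> card (insert u Z)" "k \<le> card (insert v Z)"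
    using Z(1) by (intro sep_A sep_B; auto simp: separates_def)+
  then have card: "card (insert u Z) = k" "card (insert v Z) = k" using Z(1,3) notin by auto
  obtain P where P: "linkage (delete_edge x y E) A (insert u Z) P" "card P = k"
    using IH[of A "insert u Z"] Z(1) \<open>finite A\<close> sep_A by blast
  obtain Q where Q: "linkage (delete_edge x y E) (insert v Z) B Q" "card Q = k"
    using IH[of "insert v Z" B] Z(1) \<open>finite B\<close> sep_B by blast
  show ?thesis
    using linkage_through_separator[of u v A B Z P Q] Z(1,2) notin uv(2) P Q card
    unfolding edge(1) by simp
qed

theorem menger:
  assumes "finite E" "sym E" "finite A" "finite B"
    and "\<And>Z. finite Z \<Longrightarrow> separates E A B Z \<Longrightarrow> k \<le> card Z"
  shows "\<exists>P. linkage E A B P \<and> card P = k"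
  using assms
proof (induction "card E" arbitrary: E A B rule: less_induct)
  case less
  interpret undirected E using less.prems(2) by unfold_locales
  show ?case
  proof (cases "E = {}")
    case True
    then have "C = {x}" if "connected_in E C" "x \<in> C" for C x
      using that unfolding connected_in_def by auto
    then have "separates E A B (A \<inter> B)" unfolding separates_def by blast
    then have "k \<le> card (A \<inter> B)" using less.prems(3,5) by simp
    then show ?thesis unfolding True by (rule menger_no_edges[OF less.prems(3)])
  next
    case False
    then obtain x y where xy: "(x, y) \<in> E" by auto
    interpret deleted: undirected "delete_edge x y E" by (rule undirected_delete_edge)
    have smaller: "finite (delete_edge x y E)" "card (delete_edge x y E) < card E"
      using less.prems(1) xy by (auto simp: delete_edge_def intro!: psubset_card_mono)
    note IH = less.hyps[OF smaller(2,1) deleted.sym_edges]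
    show ?thesis
    proof (cases "\<forall>Z. finite Z \<longrightarrow> separates (delete_edge x y E) A B Z \<longrightarrow> k \<le> card Z")
      case True
      then obtain P where "linkage (delete_edge x y E) A B P" "card P = k"
        using IH[OF less.prems(3,4)] by blast
      then show ?thesis using linkage_mono_edges[OF _ delete_edge_subset] by metis
    next
      case False
      then obtain Z where Z: "finite Z" "separates (delete_edge x y E) A B Z" "card Z < k"
        by fastforce
      show ?thesis
      proof (rule menger_insert_edge[OF _ Z _ less.prems(3,4)])
        show "k \<le> card W" if "finite W" "separates E A B W" for W using less.prems(5) that .
        show "\<exists>P. linkage (delete_edge x y E) A' B' P \<and> card P = k"
          if "finite A'" "finite B'"
            "\<And>W. finite W \<Longrightarrow> separates (delete_edge x y E) A' B' W \<Longrightarrow> k \<le> card W" for A' B'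
          using that by (rule IH)
      qed
    qed
  qed
qed

lemma (in undirected) biconnected_two_paths:
  assumes "finite S" "biconnected_in E S" "A \<subseteq> S" "B \<subseteq> S" "2 \<le> card A" "2 \<le> card B"
  obtains p q where "path_in E S p" "set p \<inter> A = {hd p}" "set p \<inter> B = {last p}"
    "path_in E S q" "set q \<inter> A = {hd q}" "set q \<inter> B = {last q}" "set p \<inter> set q = {}"
proof -
  have fin: "finite (E \<inter> S \<times> S)" "finite A" "finite B"
    using assms(1,3,4) finite_subset by auto
  have sym: "sym (E \<inter> S \<times> S)" using sym_edges by (auto simp: sym_def)
  have "2 \<le> card Z" if Z: "finite Z" "separates (E \<inter> S \<times> S) A B Z" for Z
  proof (rule ccontr)
    assume "\<not> 2 \<le> card Z"
    then have "card Z = 0 \<or> card Z = 1" by linarith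
    then have "Z = {} \<or> (\<exists>v. Z = {v})" using Z(1) by (auto simp: card_1_singleton_iff)
    then have "connected_in E (S - Z)"
      using assms(2) unfolding biconnected_in_def by (metis Diff_empty)
    then have "connected_in (E \<inter> S \<times> S) (S - Z)"
      using connected_in_restrict_edges by (metis Diff_subset)
    moreover have "\<not> A \<subseteq> Z" "\<not> B \<subseteq> Z"
      using card_mono[OF Z(1), of A] card_mono[OF Z(1), of B] assms(5,6) \<open>\<not> 2 \<le> card Z\<close> by linarith+
    ultimately show False using Z(2) assms(3,4) unfolding separates_def by blast
  qed
  then obtain L where L: "linkage (E \<inter> S \<times> S) A B L" "card L = 2"
    using menger[OF fin(1) sym fin(2,3)] by blast
  then obtain p q where pq: "L = {p, q}" "p \<noteq> q" by (auto simp: card_2_iff)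
  have "path_in E S r" "set r \<inter> A = {hd r}" "set r \<inter> B = {last r}" if "r \<in> L" for r
  proof -
    have r: "path_in (E \<inter> S \<times> S) UNIV r" "set r \<inter> A = {hd r}" "set r \<inter> B = {last r}"
      using L(1) that by (auto simp: linkage_def)
    then show "set r \<inter> A = {hd r}" "set r \<inter> B = {last r}" by auto
    show "path_in E S r" using r(1) by (rule path_in_restrict_edges) (use r(2) assms(3) in blast)
  qed
  moreover have "set p \<inter> set q = {}"
    using L(1) pq by (auto simp: linkage_def disjoint_family_on_def)
  ultimately show thesis using pq(1) by (intro that) auto
qed

section \<open>Minor models\<close>

definition minor_model ::
    "('a \<times> 'a) set \<Rightarrow> 'b set \<Rightarrow> ('b \<times> 'b) set \<Rightarrow> ('b \<Rightarrow> 'a set) \<Rightarrow> 'a set \<Rightarrow> bool" where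
  "minor_model E V A \<phi> S \<longleftrightarrow> (\<forall>v\<in>V. connected_in E (\<phi> v) \<and> \<phi> v \<subseteq> S) \<and> disjoint_family_on \<phi> V \<and>
     (\<forall>u\<in>V. \<forall>v\<in>V. (u, v) \<in> A \<longrightarrow> adjacent E (\<phi> u) (\<phi> v))"

definition rooted_model ::
    "('a \<times> 'a) set \<Rightarrow> 'b set \<Rightarrow> ('b \<times> 'b) set \<Rightarrow> 'b \<Rightarrow> 'b \<Rightarrow> 'a \<Rightarrow> 'a \<Rightarrow> 'a set \<Rightarrow> bool" where
  "rooted_model E V A r s a b S \<longleftrightarrow> (\<exists>\<phi>. minor_model E V A \<phi> S \<and> a \<in> \<phi> r \<and> b \<in> \<phi> s)"

definition fibre_union :: "('b \<Rightarrow> 'a set) \<Rightarrow> 'b set \<Rightarrow> ('b \<Rightarrow> 'c) \<Rightarrow> 'c \<Rightarrow> 'a set" where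
  "fibre_union \<phi> V g x = (\<Union>v\<in>{v \<in> V. g v = x}. \<phi> v)"

lemma minor_modelI:
  assumes "\<And>v. v \<in> V \<Longrightarrow> connected_in E (\<phi> v)" "\<And>v. v \<in> V \<Longrightarrow> \<phi> v \<subseteq> S"
    and "\<And>u v. u \<in> V \<Longrightarrow> v \<in> V \<Longrightarrow> u \<noteq> v \<Longrightarrow> \<phi> u \<inter> \<phi> v = {}"
    and "\<And>u v. u \<in> V \<Longrightarrow> v \<in> V \<Longrightarrow> (u, v) \<in> A \<Longrightarrow> adjacent E (\<phi> u) (\<phi> v)"
  shows "minor_model E V A \<phi> S"
  using assms by (simp add: minor_model_def disjoint_family_on_def)

lemma minor_modelD:
  assumes "minor_model E V A \<phi> S"
  shows "v \<in> V \<Longrightarrow> connected_in E (\<phi> v)" "v \<in> V \<Longrightarrow> \<phi> v \<subseteq> S"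
    "u \<in> V \<Longrightarrow> v \<in> V \<Longrightarrow> u \<noteq> v \<Longrightarrow> \<phi> u \<inter> \<phi> v = {}"
    "u \<in> V \<Longrightarrow> v \<in> V \<Longrightarrow> (u, v) \<in> A \<Longrightarrow> adjacent E (\<phi> u) (\<phi> v)"
  using assms by (auto simp: minor_model_def dest: disjoint_family_onD)

lemma minor_model_mono: "minor_model E V A \<phi> S \<Longrightarrow> S \<subseteq> T \<Longrightarrow> minor_model E V A \<phi> T"
  unfolding minor_model_def by blast

lemma minor_model_subset:
  assumes "minor_model E V A \<phi> S" "W \<subseteq> V"
  shows "minor_model E W A \<phi> S"
  using assms disjoint_family_on_mono[OF assms(2)] unfolding minor_model_def by blast

lemma minor_model_enlarge:
  assumes \<phi>: "minor_model E V A \<phi> S"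
    and "\<And>v. v \<in> V \<Longrightarrow> connected_in E (\<chi> v)" "\<And>v. v \<in> V \<Longrightarrow> \<phi> v \<subseteq> \<chi> v" "\<And>v. v \<in> V \<Longrightarrow> \<chi> v \<subseteq> T"
    and "\<And>u v. u \<in> V \<Longrightarrow> v \<in> V \<Longrightarrow> u \<noteq> v \<Longrightarrow> \<chi> u \<inter> \<chi> v = {}"
  shows "minor_model E V A \<chi> T"
  by (rule minor_modelI) (use assms(2-) minor_modelD(4)[OF \<phi>] adjacent_mono in metis)+

lemma minor_model_reindex:
  assumes \<phi>: "minor_model E V A \<phi> S" and f: "inj_on f W" "f ` W \<subseteq> V"
    and arcs: "\<And>u v. u \<in> W \<Longrightarrow> v \<in> W \<Longrightarrow> (u, v) \<in> B \<Longrightarrow> (f u, f v) \<in> A"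
    and T: "\<And>w. w \<in> W \<Longrightarrow> \<phi> (f w) \<subseteq> T"
  shows "minor_model E W B (\<lambda>w. \<phi> (f w)) T"
proof (rule minor_modelI)
  show "\<phi> (f u) \<inter> \<phi> (f v) = {}" if "u \<in> W" "v \<in> W" "u \<noteq> v" for u v
    using f that by (intro minor_modelD(3)[OF \<phi>]) (auto dest: inj_onD)
  show "connected_in E (\<phi> (f w))" if "w \<in> W" for w
    using f(2) that by (intro minor_modelD(1)[OF \<phi>]) auto
  show "adjacent E (\<phi> (f u)) (\<phi> (f v))" if "u \<in> W" "v \<in> W" "(u, v) \<in> B" for u v
    using f(2) that arcs by (intro minor_modelD(4)[OF \<phi>]) auto
qed (rule T)

lemma subset_fibre_union: "v \<in> V \<Longrightarrow> \<phi> v \<subseteq> fibre_union \<phi> V g (g v)"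
  by (auto simp: fibre_union_def)

lemma fibre_union_model:
  assumes "minor_model E V A \<phi> B"
  shows "fibre_union \<phi> V g x \<subseteq> B" "x \<noteq> y \<Longrightarrow> fibre_union \<phi> V g x \<inter> fibre_union \<phi> V g y = {}"
proof -
  show "fibre_union \<phi> V g x \<subseteq> B" using minor_modelD(2)[OF assms] by (auto simp: fibre_union_def)
  have "\<phi> u \<inter> \<phi> v = {}" if "u \<in> V" "v \<in> V" "g u \<noteq> g v" for u v
    using that by (intro minor_modelD(3)[OF assms]) auto
  then show "fibre_union \<phi> V g x \<inter> fibre_union \<phi> V g y = {}" if "x \<noteq> y"
    using that unfolding fibre_union_def by blast
qed

text \<open>
  Two disjoint models are turned into one by identifying and renaming branch sets along \<^term>\<open>g\<close> and
  \<^term>\<open>h\<close>, and by adding connectors \<^term>\<open>K x\<close>, which may also form branch sets of their own.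
\<close>

lemma minor_model_glue:
  assumes \<phi>: "minor_model E V A \<phi> B1" and \<chi>: "minor_model E W B \<chi> B2"
    and blocks: "B1 \<union> B2 \<subseteq> S" "B1 \<inter> B2 = {}"
    and conn: "\<And>x. x \<in> U \<Longrightarrow> connected_in E (K x \<union> fibre_union \<phi> V g x \<union> fibre_union \<chi> W h x)"
    and K: "\<And>x. x \<in> U \<Longrightarrow> K x \<subseteq> S" "\<And>x. x \<in> U \<Longrightarrow> K x \<inter> B1 \<subseteq> fibre_union \<phi> V g x"
      "\<And>x. x \<in> U \<Longrightarrow> K x \<inter> B2 \<subseteq> fibre_union \<chi> W h x" "disjoint_family_on K U"
    and arcs: "\<And>x y. x \<in> U \<Longrightarrow> y \<in> U \<Longrightarrow> (x, y) \<in> C \<Longrightarrow>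
      (x, y) \<in> map_prod g g ` (A \<inter> V \<times> V) \<union> map_prod h h ` (B \<inter> W \<times> W) \<or>
      adjacent E (K x \<union> fibre_union \<phi> V g x \<union> fibre_union \<chi> W h x)
        (K y \<union> fibre_union \<phi> V g y \<union> fibre_union \<chi> W h y)"
  shows "minor_model E U C (\<lambda>x. K x \<union> fibre_union \<phi> V g x \<union> fibre_union \<chi> W h x) S"
proof (rule minor_modelI)
  note in_blocks = fibre_union_model(1)[OF \<phi>] fibre_union_model(1)[OF \<chi>]
  show "K x \<union> fibre_union \<phi> V g x \<union> fibre_union \<chi> W h x \<subseteq> S" if "x \<in> U" for x
    using K(1)[OF that] in_blocks(1)[of g x] in_blocks(2)[of h x] blocks(1) by blast
  show "(K x \<union> fibre_union \<phi> V g x \<union> fibre_union \<chi> W h x) \<inter>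
      (K y \<union> fibre_union \<phi> V g y \<union> fibre_union \<chi> W h y) = {}" if x: "x \<in> U" "y \<in> U" "x \<noteq> y" for x y
  proof -
    have avoid: "K x \<inter> fibre_union \<phi> V g y = {}" "K x \<inter> fibre_union \<chi> W h y = {}"
      if "x \<in> U" "x \<noteq> y" for x y
    proof -
      show "K x \<inter> fibre_union \<phi> V g y = {}"
        using K(2)[OF that(1)] in_blocks(1)[of g y] fibre_union_model(2)[OF \<phi> that(2), of g]
        by blast
      show "K x \<inter> fibre_union \<chi> W h y = {}"
        using K(3)[OF that(1)] in_blocks(2)[of h y] fibre_union_model(2)[OF \<chi> that(2), of h]
        by blast
    qed
    note disj = fibre_union_model(2)[OF \<phi> x(3), of g] fibre_union_model(2)[OF \<chi> x(3), of h]
      disjoint_family_onD[OF K(4) x] avoid[OF x(1,3)] avoid[OF x(2) x(3)[symmetric]]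
    have "fibre_union \<phi> V g x \<inter> fibre_union \<chi> W h y = {}"
      "fibre_union \<chi> W h x \<inter> fibre_union \<phi> V g y = {}"
      using in_blocks(1)[of g x] in_blocks(1)[of g y] in_blocks(2)[of h x] in_blocks(2)[of h y]
        blocks(2) by blast+
    then show ?thesis using disj by (simp add: Int_Un_distrib Int_Un_distrib2 Int_commute)
  qed
  fix x y assume xy: "x \<in> U" "y \<in> U" "(x, y) \<in> C"
  from arcs[OF xy] consider
      (left) u v where "(u, v) \<in> A" "u \<in> V" "v \<in> V" "x = g u" "y = g v"
    | (right) u v where "(u, v) \<in> B" "u \<in> W" "v \<in> W" "x = h u" "y = h v"
    | (connector) "adjacent E (K x \<union> fibre_union \<phi> V g x \<union> fibre_union \<chi> W h x)
        (K y \<union> fibre_union \<phi> V g y \<union> fibre_union \<chi> W h y)" by auto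
  then show "adjacent E (K x \<union> fibre_union \<phi> V g x \<union> fibre_union \<chi> W h x)
      (K y \<union> fibre_union \<phi> V g y \<union> fibre_union \<chi> W h y)"
  proof cases
    case left
    show ?thesis using minor_modelD(4)[OF \<phi> left(2,3,1)]
      by (rule adjacent_mono)
        (use left subset_fibre_union[of u V \<phi> g] subset_fibre_union[of v V \<phi> g] in auto)
  next
    case right
    show ?thesis using minor_modelD(4)[OF \<chi> right(2,3,1)]
      by (rule adjacent_mono)
        (use right subset_fibre_union[of u W \<chi> h] subset_fibre_union[of v W \<chi> h] in auto)
  qed
qed (rule conn)

context undirected
begin

lemma minor_model_symcl: "minor_model E V A \<phi> S \<Longrightarrow> minor_model E V (symcl A) \<phi> S"
  unfolding minor_model_def using adjacent_sym by (auto simp: symcl_iff)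

lemma minor_model_fatten:
  assumes \<phi>: "minor_model E V A \<phi> Y"
    and L: "\<And>y. y \<in> Y \<Longrightarrow> connected_in E (L y)" "\<And>y. y \<in> Y \<Longrightarrow> y \<in> L y" "\<And>y. y \<in> Y \<Longrightarrow> L y \<subseteq> X"
      "disjoint_family_on L Y"
  shows "minor_model E V A (\<lambda>v. \<Union>y\<in>\<phi> v. L y) X"
proof (rule minor_model_enlarge[OF \<phi>])
  fix v assume v: "v \<in> V"
  note sub = minor_modelD(2)[OF \<phi> v]
  show self: "\<phi> v \<subseteq> (\<Union>y\<in>\<phi> v. L y)" using sub L(2) by blast
  have "connected_in E (\<phi> v \<union> (\<Union>y\<in>\<phi> v. L y))"
    using minor_modelD(1)[OF \<phi> v] sub L(1,2) by (intro connected_in_UN) blast+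
  then show "connected_in E (\<Union>y\<in>\<phi> v. L y)" using self by (simp add: Un_absorb1)
  show "(\<Union>y\<in>\<phi> v. L y) \<subseteq> X" using sub L(3) by blast
next
  fix u v assume uv: "u \<in> V" "v \<in> V" "u \<noteq> v"
  have "L y \<inter> L z = {}" if "y \<in> \<phi> u" "z \<in> \<phi> v" for y z
    using that minor_modelD(2)[OF \<phi> uv(1)] minor_modelD(2)[OF \<phi> uv(2)] minor_modelD(3)[OF \<phi> uv]
    by (intro disjoint_family_onD[OF L(4)]) auto
  then show "(\<Union>y\<in>\<phi> u. L y) \<inter> (\<Union>y\<in>\<phi> v. L y) = {}" by blast
qed

lemma rooted_model_extend:
  assumes N: "rooted_model E V A r s p q B" and rs: "r \<in> V" "s \<in> V" "r \<noteq> s" and "B \<subseteq> S"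
    and P: "connected_in E P" "P \<inter> B = {p}" "P \<subseteq> S" "a \<in> P"
    and Q: "connected_in E Q" "Q \<inter> B = {q}" "Q \<subseteq> S" "b \<in> Q"
    and "P \<inter> Q = {}"
  shows "rooted_model E V A r s a b S"
proof -
  obtain \<phi> where \<phi>: "minor_model E V A \<phi> B" "p \<in> \<phi> r" "q \<in> \<phi> s"
    using N unfolding rooted_model_def by blast
  define K where "K v = (if v = r then P else if v = s then Q else {})" for v
  note model = minor_modelD[OF \<phi>(1)]
  have K_avoid: "K u \<inter> \<phi> v = {}" if "v \<in> V" "u \<noteq> v" for u v
  proof -
    have "P \<inter> \<phi> v = {}" if "v \<noteq> r"
      using model(2)[OF \<open>v \<in> V\<close>] model(3)[OF \<open>v \<in> V\<close> rs(1) that] equalityD1[OF P(2)] \<phi>(2) by blast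
    moreover have "Q \<inter> \<phi> v = {}" if "v \<noteq> s"
      using model(2)[OF \<open>v \<in> V\<close>] model(3)[OF \<open>v \<in> V\<close> rs(2) that] equalityD1[OF Q(2)] \<phi>(3) by blast
    ultimately show ?thesis using \<open>u \<noteq> v\<close> by (auto simp: K_def)
  qed
  have "minor_model E V A (\<lambda>v. K v \<union> \<phi> v) S"
  proof (rule minor_model_enlarge[OF \<phi>(1)])
    fix v assume v: "v \<in> V"
    have "connected_in E (P \<union> \<phi> r)" "connected_in E (Q \<union> \<phi> s)"
      by (rule connected_in_Un, use P Q \<phi>(2,3) rs model(1) in auto)+
    then show "connected_in E (K v \<union> \<phi> v)" using model(1)[OF v] by (simp add: K_def)
    show "K v \<union> \<phi> v \<subseteq> S" using model(2)[OF v] P(3) Q(3) \<open>B \<subseteq> S\<close> by (auto simp: K_def)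
  next
    fix u v assume uv: "u \<in> V" "v \<in> V" "u \<noteq> v"
    have "K u \<inter> K v = {}" using uv(3) \<open>P \<inter> Q = {}\<close> by (auto simp: K_def)
    then show "(K u \<union> \<phi> u) \<inter> (K v \<union> \<phi> v) = {}"
      using K_avoid[OF uv(2,3)] K_avoid[OF uv(1) uv(3)[symmetric]] model(3)[OF uv] by blast
  qed simp
  moreover have "a \<in> K r \<union> \<phi> r" "b \<in> K s \<union> \<phi> s" using P(4) Q(4) rs(3) by (auto simp: K_def)
  ultimately show ?thesis unfolding rooted_model_def by (intro exI[of _ "\<lambda>v. K v \<union> \<phi> v"]) simp
qed

end

section \<open>Minor models yield minors\<close>

definition quotient_arcs :: "('a \<Rightarrow> 'b) \<Rightarrow> ('a \<times> 'a) set \<Rightarrow> ('b \<times> 'b) set" where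
  "quotient_arcs f R = {(f x, f y) | x y. (x, y) \<in> R \<and> f x \<noteq> f y}"

lemma quotient_arcs_quotient_arcs:
  assumes "\<And>x. f (g x) = f x"
  shows "quotient_arcs f (quotient_arcs g R) = quotient_arcs f R"
proof -
  have "g x \<noteq> g y" if "f x \<noteq> f y" for x y using that assms by metis
  then show ?thesis unfolding quotient_arcs_def using assms by (auto; metis)
qed

lemma pverts_contract_edge: "pverts (contract_edge u v G) = pverts G - {v}"
  by (simp add: contract_edge_def Let_def)

lemma parcs_contract_edge: "parcs (contract_edge u v G) = quotient_arcs (id(v := u)) (parcs G)"
  by (simp add: contract_edge_def quotient_arcs_def Let_def)

lemma contracts_to_trans: "contracts_to H K \<Longrightarrow> contracts_to G H \<Longrightarrow> contracts_to G K"
  by (induction rule: contracts_to.induct) (auto intro: contracts_to.step)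

lemma connected_in_contract_edge:
  assumes "u \<in> F \<longleftrightarrow> v \<in> F" "connected_in (parcs G) F"
  shows "connected_in (parcs (contract_edge u v G)) (id(v := u) ` F)"
  using assms(2)
  by (rule connected_in_image) (auto simp: parcs_contract_edge quotient_arcs_def)

lemma contract_fibres:
  fixes f :: "'a \<Rightarrow> 'b"
  assumes "pair_graph S" and "\<And>c. c \<in> f ` pverts S \<Longrightarrow> connected_in (parcs S) {v \<in> pverts S. f v = c}"
  shows "\<exists>K. contracts_to S K \<and> pair_graph K \<and> inj_on f (pverts K) \<and> f ` pverts K = f ` pverts S \<and>
    quotient_arcs f (parcs K) = quotient_arcs f (parcs S)"
  using assms
proof (induction "card (pverts S)" arbitrary: S rule: less_induct)
  case less
  interpret S: pair_graph S by (rule less.prems(1))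
  show ?case
  proof (cases "inj_on f (pverts S)")
    case True
    then show ?thesis using less.prems(1) contracts_to.refl by blast
  next
    case False
    then obtain u w where uw: "u \<in> pverts S" "w \<in> pverts S" "u \<noteq> w" "f u = f w"
      by (auto simp: inj_on_def)
    have "adjacent (parcs S) {u} ({v \<in> pverts S. f v = f u} - {u})"
      using less.prems(2)[of "f u"] uw by (intro connected_in_cut) auto
    then obtain v where uv: "(u, v) \<in> parcs S" "f v = f u" by (auto simp: adjacent_def)
    then have ends: "u \<in> pverts S" "v \<in> pverts S" "u \<noteq> v"
      using S.in_arcsD1 S.in_arcsD2 S.no_loops' by auto
    define T where "T = contract_edge u v S"
    have f: "f ((id(v := u)) z) = f z" for z using uv(2) by simp
    have fibres: "{z \<in> pverts T. f z = c} = id(v := u) ` {z \<in> pverts S. f z = c}" for c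
      using ends uv(2) by (auto simp: T_def pverts_contract_edge image_iff)
    have verts: "f ` pverts T = f ` pverts S"
      using ends uv(2) by (auto simp: T_def pverts_contract_edge image_iff)
    have "connected_in (parcs T) {z \<in> pverts T. f z = c}" if "c \<in> f ` pverts T" for c
      unfolding fibres unfolding T_def using less.prems(2)[of c] that verts ends uv(2)
      by (intro connected_in_contract_edge) auto
    moreover have "card (pverts T) < card (pverts S)"
      unfolding T_def pverts_contract_edge
      using ends(2) S.pair_finite_verts by (intro card_Diff1_less)
    moreover have "pair_graph T"
      unfolding T_def by (rule pair_graph_contract_edge[OF less.prems(1) uv(1)])
    ultimately obtain K where K: "contracts_to T K" "pair_graph K" "inj_on f (pverts K)"
      "f ` pverts K = f ` pverts T" "quotient_arcs f (parcs K) = quotient_arcs f (parcs T)"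
      using less.hyps[of T] by blast
    have "contracts_to S T" unfolding T_def using contracts_to.step[OF contracts_to.refl uv(1)] .
    then have "contracts_to S K" using K(1) contracts_to_trans by blast
    moreover have "quotient_arcs f (parcs T) = quotient_arcs f (parcs S)"
      unfolding T_def parcs_contract_edge using f by (rule quotient_arcs_quotient_arcs)
    ultimately show ?thesis using K(2-5) verts by (intro exI[of _ K]) simp
  qed
qed

lemma digraph_iso_quotient:
  assumes K: "pair_graph K" and f: "inj_on f (pverts K)" "f ` pverts K = pverts H"
    "quotient_arcs f (parcs K) = parcs H"
  shows "digraph_iso (with_proj H) (with_proj K)"
proof -
  interpret K: pair_graph K by (rule K)
  define h where "h = \<lparr> iso_verts = f, iso_arcs = map_prod f f, iso_head = snd, iso_tail = fst \<rparr>"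
  have "inj_on (map_prod f f) (parcs K)"
    using inj_onD[OF f(1)] K.in_arcsD1 K.in_arcsD2 by (auto simp: inj_on_def)
  then have "pre_digraph.digraph_isomorphism (with_proj K) h"
    unfolding pre_digraph.digraph_isomorphism_def
    using f(1) K.wf_digraph_axioms by (auto simp: h_def)
  moreover have "f x \<noteq> f y" if "(x, y) \<in> parcs K" for x y
    using that K.in_arcsD1[OF that] K.in_arcsD2[OF that] K.no_loops'[OF that] inj_onD[OF f(1)]
    by metis
  then have "map_prod f f ` parcs K = parcs H"
    unfolding f(3)[symmetric] quotient_arcs_def by force
  then have "with_proj H = app_iso h (with_proj K)"
    using f(2) by (simp add: app_iso_def h_def with_proj_def)
  ultimately have "digraph_iso (with_proj K) (with_proj H)" unfolding digraph_iso_def by blast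
  then show ?thesis by (rule digraph_iso_swap[OF K.wf_digraph_axioms])
qed

lemma quotient_subgraph_is_minor:
  assumes S: "pair_graph S" "subgraph (with_proj S) (with_proj G)"
    and fibres: "\<And>x. x \<in> pverts H \<Longrightarrow> connected_in (parcs S) {v \<in> pverts S. f v = x}"
    and H: "f ` pverts S = pverts H" "quotient_arcs f (parcs S) = parcs H"
  shows "is_minor H G"
proof -
  obtain K where K: "contracts_to S K" "pair_graph K" "inj_on f (pverts K)"
    "f ` pverts K = pverts H" "quotient_arcs f (parcs K) = parcs H"
    using contract_fibres[OF S(1), of f] fibres H by auto
  then show ?thesis unfolding is_minor_def using S digraph_iso_quotient[OF K(2-5)] by blast
qed

lemma undirected_parcs:
  assumes "pair_graph G"
  shows "undirected (parcs G)"
proof -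
  interpret pair_graph G by fact
  show ?thesis using pair_sym_arcs by unfold_locales (simp add: symmetric_def)
qed

definition labelled_subgraph ::
    "'a pair_pre_digraph \<Rightarrow> 'b pair_pre_digraph \<Rightarrow> ('a \<Rightarrow> 'b) \<Rightarrow> 'a set \<Rightarrow> 'a pair_pre_digraph" where
  "labelled_subgraph G H f V = \<lparr> pverts = V,
     parcs = {(u, v) \<in> parcs G. u \<in> V \<and> v \<in> V \<and> (f u = f v \<or> (f u, f v) \<in> parcs H)} \<rparr>"

lemma labelled_subgraph:
  assumes G: "pair_graph G" and H: "pair_graph H" and "V \<subseteq> pverts G"
  shows "pair_graph (labelled_subgraph G H f V)"
    "subgraph (with_proj (labelled_subgraph G H f V)) (with_proj G)"
proof -
  interpret G: pair_graph G by (rule G)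
  interpret EG: undirected "parcs G" using G by (rule undirected_parcs)
  interpret EH: undirected "parcs H" using H by (rule undirected_parcs)
  show S: "pair_graph (labelled_subgraph G H f V)"
  proof (rule pair_graphI)
    show "finite (pverts (labelled_subgraph G H f V))"
      using finite_subset[OF \<open>V \<subseteq> pverts G\<close> G.pair_finite_verts]
      by (simp add: labelled_subgraph_def)
    show "u \<in> pverts (labelled_subgraph G H f V) \<and> u \<noteq> v \<and>
        (v, u) \<in> parcs (labelled_subgraph G H f V)"
      if "(u, v) \<in> parcs (labelled_subgraph G H f V)" for u v
      using that EH.edge_sym EG.edge_sym G.no_loops' by (auto simp: labelled_subgraph_def)
  qed
  interpret S: pair_graph "labelled_subgraph G H f V" by (rule S)
  show "subgraph (with_proj (labelled_subgraph G H f V)) (with_proj G)"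
    unfolding subgraph_def compatible_def
    using \<open>V \<subseteq> pverts G\<close> S.wf_digraph_axioms G.wf_digraph_axioms
    by (auto simp: labelled_subgraph_def)
qed

lemma quotient_arcs_labelled_subgraph:
  assumes "pair_graph H"
    and "\<And>x y. (x, y) \<in> parcs H \<Longrightarrow> adjacent (parcs G) {u \<in> V. f u = x} {v \<in> V. f v = y}"
  shows "quotient_arcs f (parcs (labelled_subgraph G H f V)) = parcs H"
proof -
  interpret H: pair_graph H by fact
  have "(x, y) \<in> quotient_arcs f (parcs (labelled_subgraph G H f V))" if xy: "(x, y) \<in> parcs H"
    for x y
  proof -
    have "x \<noteq> y" using H.no_loops'[OF xy] .
    then show ?thesis
      using assms(2)[OF xy] xy by (auto simp: adjacent_def quotient_arcs_def labelled_subgraph_def)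
  qed
  then show ?thesis by (auto simp: quotient_arcs_def labelled_subgraph_def)
qed

lemma minor_model_is_minor:
  assumes H: "pair_graph H" and G: "pair_graph G"
    and \<phi>: "minor_model (parcs G) (pverts H) A \<phi> (pverts G)" and "parcs H \<subseteq> symcl A"
  shows "is_minor H G"
proof -
  interpret H: pair_graph H by (rule H)
  interpret undirected "parcs G" using G by (rule undirected_parcs)
  note model = minor_modelD[OF minor_model_symcl[OF \<phi>]]
  define V where "V = (\<Union>x\<in>pverts H. \<phi> x)"
  define f where "f v = (THE x. x \<in> pverts H \<and> v \<in> \<phi> x)" for v
  have f: "f v = x" if "x \<in> pverts H" "v \<in> \<phi> x" for x v
    unfolding f_def using that model(3) by blast
  define S where "S = labelled_subgraph G H f V"
  have fibre: "{v \<in> pverts S. f v = x} = \<phi> x" if "x \<in> pverts H" for x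
    using that f by (auto simp: S_def labelled_subgraph_def V_def)
  have "V \<subseteq> pverts G" using model(2) by (auto simp: V_def)
  note S = labelled_subgraph[OF G H this, of f, folded S_def]
  show ?thesis
  proof (rule quotient_subgraph_is_minor[OF S])
    fix x assume x: "x \<in> pverts H"
    have "parcs S \<inter> \<phi> x \<times> \<phi> x = parcs G \<inter> \<phi> x \<times> \<phi> x"
      using x f by (auto simp: S_def labelled_subgraph_def V_def)
    then show "connected_in (parcs S) {v \<in> pverts S. f v = x}"
      using model(1)[OF x] by (simp add: fibre[OF x] connected_in_def)
  next
    have "x \<in> f ` pverts S" if x: "x \<in> pverts H" for x
    proof -
      obtain v where "v \<in> \<phi> x" using connected_in_nonempty[OF model(1)[OF x]] by blast
      then have "v \<in> pverts S" "f v = x" using fibre[OF x] by blast+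
      then show ?thesis by blast
    qed
    then show "f ` pverts S = pverts H" using f by (auto simp: S_def labelled_subgraph_def V_def)
    show "quotient_arcs f (parcs S) = parcs H"
      unfolding S_def
    proof (rule quotient_arcs_labelled_subgraph[OF H])
      fix x y assume xy: "(x, y) \<in> parcs H"
      have ends: "x \<in> pverts H" "y \<in> pverts H" using H.in_arcsD1[OF xy] H.in_arcsD2[OF xy] by auto
      have "adjacent (parcs G) (\<phi> x) (\<phi> y)"
        using model(4)[OF ends] xy \<open>parcs H \<subseteq> symcl A\<close> by auto
      then show "adjacent (parcs G) {u \<in> V. f u = x} {v \<in> V. f v = y}"
        by (rule adjacent_mono) (use f ends in \<open>auto simp: V_def\<close>)
    qed
  qed
qed

section \<open>Large path-width forces tree models\<close>

abbreviation words :: "nat \<Rightarrow> bool list set" where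
  "words k \<equiv> {w. length w \<le> k}"

definition child_arcs :: "(bool list \<times> bool list) set" where
  "child_arcs = {(w, b # w) | w b. True}"

abbreviation tree_model ::
    "('a \<times> 'a) set \<Rightarrow> bool list set \<Rightarrow> (bool list \<Rightarrow> 'a set) \<Rightarrow> 'a set \<Rightarrow> bool" where
  "tree_model E W \<psi> S \<equiv> minor_model E W child_arcs \<psi> S"

definition tl_closed :: "bool list set \<Rightarrow> bool" where
  "tl_closed W \<longleftrightarrow> (\<forall>b w. b # w \<in> W \<longrightarrow> w \<in> W)"

definition boundary :: "('a \<times> 'a) set \<Rightarrow> 'a set \<Rightarrow> 'a set" where
  "boundary E X = {x \<in> X. \<exists>y. y \<notin> X \<and> (x, y) \<in> E}"

definition path_bags :: "('a \<times> 'a) set \<Rightarrow> 'a set \<Rightarrow> 'a set list \<Rightarrow> bool" where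
  "path_bags E X Bs \<longleftrightarrow> (\<forall>B\<in>set Bs. B \<subseteq> X) \<and> (\<forall>v\<in>X. \<exists>B\<in>set Bs. v \<in> B) \<and>
     (\<forall>x\<in>X. \<forall>y\<in>X. (x, y) \<in> E \<longrightarrow> (\<exists>B\<in>set Bs. x \<in> B \<and> y \<in> B)) \<and>
     (\<forall>i j k. i \<le> j \<longrightarrow> j \<le> k \<longrightarrow> k < length Bs \<longrightarrow> Bs ! i \<inter> Bs ! k \<subseteq> Bs ! j)"

definition boundary_decomposable :: "('a \<times> 'a) set \<Rightarrow> nat \<Rightarrow> 'a set \<Rightarrow> bool" where
  "boundary_decomposable E n X \<longleftrightarrow>
     (\<exists>Bs. path_bags E X Bs \<and> Bs \<noteq> [] \<and> (\<forall>B\<in>set Bs. card B \<le> n) \<and> boundary E X \<subseteq> last Bs)"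

definition boundary_linkage :: "('a \<times> 'a) set \<Rightarrow> 'a set \<Rightarrow> 'a set \<Rightarrow> ('a \<Rightarrow> 'a set) \<Rightarrow> bool" where
  "boundary_linkage E X Y L \<longleftrightarrow>
     (\<forall>y\<in>Y. connected_in E (L y) \<and> L y \<subseteq> X \<and> L y \<inter> Y = {y}) \<and> disjoint_family_on L Y \<and>
     (\<forall>y\<in>boundary E Y. L y \<inter> boundary E X \<noteq> {})"

definition saturated :: "('a \<times> 'a) set \<Rightarrow> 'a set \<Rightarrow> nat \<Rightarrow> nat \<Rightarrow> 'a set \<Rightarrow> bool" where
  "saturated E V n m X \<longleftrightarrow> X \<subseteq> V \<and> boundary_decomposable E n X \<and> card (boundary E X) \<le> m \<and>
     (\<forall>Y. X \<subseteq> Y \<longrightarrow> Y \<subseteq> V \<longrightarrow> boundary_decomposable E n Y \<longrightarrow> card (boundary E Y) \<le> m \<longrightarrow> Y = X)"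

lemma path_bagsD:
  assumes "path_bags E X Bs"
  shows "B \<in> set Bs \<Longrightarrow> B \<subseteq> X" "v \<in> X \<Longrightarrow> \<exists>B\<in>set Bs. v \<in> B"
    "x \<in> X \<Longrightarrow> y \<in> X \<Longrightarrow> (x, y) \<in> E \<Longrightarrow> \<exists>B\<in>set Bs. x \<in> B \<and> y \<in> B"
    "i \<le> j \<Longrightarrow> j \<le> k \<Longrightarrow> k < length Bs \<Longrightarrow> Bs ! i \<inter> Bs ! k \<subseteq> Bs ! j"
  using assms unfolding path_bags_def by simp_all

lemma boundary_decomposableE:
  assumes "boundary_decomposable E n X"
  obtains Bs where "path_bags E X Bs" "Bs \<noteq> []" "\<forall>B\<in>set Bs. card B \<le> n" "boundary E X \<subseteq> last Bs"
  using assms unfolding boundary_decomposable_def by (elim exE conjE) (rule that)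

lemma boundary_subset: "boundary E X \<subseteq> X"
  by (auto simp: boundary_def)

lemma boundary_insert: "boundary E (insert x X) \<subseteq> insert x (boundary E X)"
  by (auto simp: boundary_def)

lemma boundary_decomposable_empty: "boundary_decomposable E n {}"
  unfolding boundary_decomposable_def path_bags_def
  by (intro exI[of _ "[{}]"]) (auto simp: boundary_def)

lemma path_bags_meet_connected:
  assumes Bs: "path_bags E X Bs" and C: "connected_in E C" "C \<subseteq> X"
    and ijk: "i \<le> j" "j \<le> k" "k < length Bs" and "C \<inter> Bs ! i \<noteq> {}" "C \<inter> Bs ! k \<noteq> {}"
  shows "C \<inter> Bs ! j \<noteq> {}"
proof
  assume empty: "C \<inter> Bs ! j = {}"
  define P where "P = {v \<in> C. \<exists>m<j. v \<in> Bs ! m}"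
  have early: "v \<notin> Bs ! m" if v: "v \<in> P" and m: "j \<le> m" "m < length Bs" for v m
  proof
    assume "v \<in> Bs ! m"
    moreover obtain m' where "m' < j" "v \<in> Bs ! m'" "v \<in> C" using v by (auto simp: P_def)
    ultimately show False using path_bagsD(4)[OF Bs, of m' j m] m empty by auto
  qed
  obtain u w where u: "u \<in> C" "u \<in> Bs ! i" and w: "w \<in> C" "w \<in> Bs ! k" using assms(7,8) by blast
  have "i < j" using u empty ijk(1) by (metis disjoint_iff le_neq_implies_less)
  then have "u \<in> P" using u by (auto simp: P_def)
  moreover have "w \<notin> P" using early[of w k] w(2) ijk by blast
  ultimately have "adjacent E P (C - P)"
    using C(1) w(1) by (intro connected_in_cut) (auto simp: P_def)
  then obtain x y where xy: "x \<in> P" "y \<in> C" "y \<notin> P" "(x, y) \<in> E" by (auto simp: adjacent_def)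
  then have "x \<in> X" "y \<in> X" using C(2) by (auto simp: P_def)
  then obtain B where "B \<in> set Bs" "x \<in> B" "y \<in> B" using path_bagsD(3)[OF Bs _ _ xy(4)] by blast
  then obtain m where m: "m < length Bs" "x \<in> Bs ! m" "y \<in> Bs ! m" by (auto simp: in_set_conv_nth)
  then have "m < j" using early[OF xy(1), of m] by force
  then show False using m(3) xy(2,3) by (auto simp: P_def)
qed

lemma path_bags_contract:
  assumes Bs: "path_bags E X Bs" and "Y \<subseteq> X"
    and L: "\<And>y. y \<in> Y \<Longrightarrow> connected_in E (L y)" "\<And>y. y \<in> Y \<Longrightarrow> L y \<subseteq> X" "\<And>y. y \<in> Y \<Longrightarrow> y \<in> L y"
  shows "path_bags E Y (map (\<lambda>B. {y \<in> Y. L y \<inter> B \<noteq> {}}) Bs)"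
  unfolding path_bags_def
proof (intro conjI ballI allI impI)
  fix v assume "v \<in> Y"
  then show "\<exists>B\<in>set (map (\<lambda>B. {y \<in> Y. L y \<inter> B \<noteq> {}}) Bs). v \<in> B"
    using path_bagsD(2)[OF Bs, of v] \<open>Y \<subseteq> X\<close> L(3)[of v] by auto
next
  fix x y assume xy: "x \<in> Y" "y \<in> Y" "(x, y) \<in> E"
  then obtain B where "B \<in> set Bs" "x \<in> B" "y \<in> B" using path_bagsD(3)[OF Bs] \<open>Y \<subseteq> X\<close> by blast
  then show "\<exists>B\<in>set (map (\<lambda>B. {y \<in> Y. L y \<inter> B \<noteq> {}}) Bs). x \<in> B \<and> y \<in> B"
    using xy(1,2) L(3) by auto
next
  fix i j k assume ijk: "i \<le> j" "j \<le> k" "k < length (map (\<lambda>B. {y \<in> Y. L y \<inter> B \<noteq> {}}) Bs)"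
  have "L y \<inter> Bs ! j \<noteq> {}" if "y \<in> Y" "L y \<inter> Bs ! i \<noteq> {}" "L y \<inter> Bs ! k \<noteq> {}" for y
    using path_bags_meet_connected[OF Bs L(1,2)[OF that(1)]] ijk that(2,3) by simp
  then show "map (\<lambda>B. {y \<in> Y. L y \<inter> B \<noteq> {}}) Bs ! i \<inter> map (\<lambda>B. {y \<in> Y. L y \<inter> B \<noteq> {}}) Bs ! k
      \<subseteq> map (\<lambda>B. {y \<in> Y. L y \<inter> B \<noteq> {}}) Bs ! j"
    using ijk by simp blast
qed auto

lemma card_disjoint_family_meeting:
  assumes "disjoint_family_on L Y" "finite B"
  shows "card {y \<in> Y. L y \<inter> B \<noteq> {}} \<le> card B"
proof -
  define r where "r y = (SOME v. v \<in> L y \<inter> B)" for y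
  have r: "r y \<in> L y \<inter> B" if "y \<in> {y \<in> Y. L y \<inter> B \<noteq> {}}" for y
    using that unfolding r_def by (intro some_in_eq[THEN iffD2]) blast
  have "disjoint_family_on L {y \<in> Y. L y \<inter> B \<noteq> {}}"
    using assms(1) by (rule disjoint_family_on_mono[rotated]) auto
  then have "inj_on r {y \<in> Y. L y \<inter> B \<noteq> {}}"
    by (rule disjoint_family_on_inj_representatives) (use r in blast)
  moreover have "r ` {y \<in> Y. L y \<inter> B \<noteq> {}} \<subseteq> B" using r by blast
  ultimately show ?thesis using assms(2) by (rule card_inj_on_le)
qed

lemma boundary_decomposable_contract:
  assumes X: "boundary_decomposable E n X" "finite X" and "Y \<subseteq> X" and L: "boundary_linkage E X Y L"
  shows "boundary_decomposable E n Y"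
proof -
  obtain Bs where Bs: "path_bags E X Bs" "Bs \<noteq> []" "\<forall>B\<in>set Bs. card B \<le> n" "boundary E X \<subseteq> last Bs"
    using X(1) by (rule boundary_decomposableE)
  define Cs where "Cs = map (\<lambda>B. {y \<in> Y. L y \<inter> B \<noteq> {}}) Bs"
  have "card {y \<in> Y. L y \<inter> B \<noteq> {}} \<le> n" if "B \<in> set Bs" for B
  proof -
    have "finite B" using path_bagsD(1)[OF Bs(1) that] X(2) finite_subset by blast
    then have "card {y \<in> Y. L y \<inter> B \<noteq> {}} \<le> card B"
      using L by (intro card_disjoint_family_meeting) (auto simp: boundary_linkage_def)
    then show ?thesis using Bs(3) that by fastforce
  qed
  moreover have "path_bags E Y Cs"
    unfolding Cs_def
    using L by (intro path_bags_contract[OF Bs(1) \<open>Y \<subseteq> X\<close>]) (auto simp: boundary_linkage_def)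
  moreover have "boundary E Y \<subseteq> last Cs"
  proof
    fix y assume y: "y \<in> boundary E Y"
    then have "L y \<inter> last Bs \<noteq> {}" using L Bs(4) unfolding boundary_linkage_def by blast
    then show "y \<in> last Cs" using y Bs(2) boundary_subset[of E Y] by (auto simp: Cs_def last_map)
  qed
  ultimately show ?thesis
    unfolding boundary_decomposable_def using Bs(2) by (intro exI[of _ Cs]) (auto simp: Cs_def)
qed

lemma saturated_exists:
  assumes "finite V" "X \<subseteq> V" "boundary_decomposable E n X" "card (boundary E X) \<le> m"
  obtains Y where "X \<subseteq> Y" "saturated E V n m Y"
proof -
  define F where "F = {Y. Y \<subseteq> V \<and> boundary_decomposable E n Y \<and> card (boundary E Y) \<le> m}"
  have "finite F" "X \<in> F" using assms by (auto simp: F_def)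
  then obtain Y where Y: "Y \<in> F" "X \<subseteq> Y" "\<forall>Z\<in>F. Y \<subseteq> Z \<longrightarrow> Y = Z" using finite_has_maximal2 by metis
  then have "saturated E V n m Y" unfolding saturated_def F_def by blast
  with Y(2) show thesis by (rule that)
qed

lemma tl_closed_remove:
  assumes "finite W" "W \<noteq> {}" "tl_closed W"
  obtains w where "w \<in> W" "tl_closed (W - {w})" "\<And>b. b # w \<notin> W"
proof -
  have "Max (length ` W) \<in> length ` W" using assms(1,2) by (intro Max_in) auto
  then obtain w where "w \<in> W" "length w = Max (length ` W)" by auto
  then have longest: "w \<in> W" "length u \<le> length w" if "u \<in> W" for u using assms(1) that by simp_all
  have leaf: "b # w \<notin> W" for b using longest(2)[of "b # w"] by auto
  then have "tl_closed (W - {w})" using assms(3) unfolding tl_closed_def by blast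
  with \<open>w \<in> W\<close> leaf that show thesis by blast
qed

lemma tree_model_insert:
  assumes \<psi>: "tree_model E (W - {w}) \<psi> X" and x: "x \<notin> X"
    and parent: "\<And>b u. w = b # u \<Longrightarrow> adjacent E (\<psi> u) {x}" and leaf: "\<And>b. b # w \<notin> W"
  shows "tree_model E W (\<psi>(w := {x})) (insert x X)"
proof (rule minor_modelI)
  note model = minor_modelD[OF \<psi>]
  show "connected_in E ((\<psi>(w := {x})) u)" "(\<psi>(w := {x})) u \<subseteq> insert x X" if "u \<in> W" for u
    using model(1,2)[of u] that by auto
  show "(\<psi>(w := {x})) u \<inter> (\<psi>(w := {x})) v = {}" if "u \<in> W" "v \<in> W" "u \<noteq> v" for u v
    using model(2)[of u] model(2)[of v] model(3)[of u v] that x by auto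
  show "adjacent E ((\<psi>(w := {x})) u) ((\<psi>(w := {x})) v)"
    if "u \<in> W" "v \<in> W" "(u, v) \<in> child_arcs" for u v
    using model(4)[of u v] that parent leaf by (auto simp: child_arcs_def)
qed

context undirected
begin

lemma path_bags_snoc:
  assumes Bs: "path_bags E X Bs" "Bs \<noteq> []" "boundary E X \<subseteq> last Bs" and "x \<notin> X"
  shows "path_bags E (insert x X) (Bs @ [insert x (boundary E X)])"
  unfolding path_bags_def
proof (intro conjI ballI allI impI)
  fix B assume "B \<in> set (Bs @ [insert x (boundary E X)])"
  then show "B \<subseteq> insert x X" using path_bagsD(1)[OF Bs(1)] boundary_subset[of E X] by auto
next
  fix v assume "v \<in> insert x X"
  then show "\<exists>B\<in>set (Bs @ [insert x (boundary E X)]). v \<in> B"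
    using path_bagsD(2)[OF Bs(1), of v] by auto
next
  fix u v assume uv: "u \<in> insert x X" "v \<in> insert x X" "(u, v) \<in> E"
  show "\<exists>B\<in>set (Bs @ [insert x (boundary E X)]). u \<in> B \<and> v \<in> B"
  proof (cases "u \<in> X \<and> v \<in> X")
    case True
    then show ?thesis using path_bagsD(3)[OF Bs(1) _ _ uv(3)] by auto
  next
    case False
    then have "u \<in> insert x (boundary E X)" "v \<in> insert x (boundary E X)"
      using uv \<open>x \<notin> X\<close> edge_sym[OF uv(3)] by (auto simp: boundary_def)
    then show ?thesis by auto
  qed
next
  fix i j k assume ijk: "i \<le> j" "j \<le> k" "k < length (Bs @ [insert x (boundary E X)])"
  then consider (inner) "k < length Bs" | (equal) "j = k"
    | (last) "j < length Bs" "k = length Bs" by fastforce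
  then show "(Bs @ [insert x (boundary E X)]) ! i \<inter> (Bs @ [insert x (boundary E X)]) ! k
      \<subseteq> (Bs @ [insert x (boundary E X)]) ! j"
  proof cases
    case inner
    then show ?thesis using path_bagsD(4)[OF Bs(1) ijk(1,2)] ijk by (simp add: nth_append)
  next
    case last
    have "Bs ! i \<subseteq> X" using path_bagsD(1)[OF Bs(1), of "Bs ! i"] ijk(1) last(1) by auto
    then have "Bs ! i \<inter> insert x (boundary E X) \<subseteq> Bs ! i \<inter> Bs ! (length Bs - 1)"
      using Bs(2,3) \<open>x \<notin> X\<close> by (auto simp: last_conv_nth)
    also have "\<dots> \<subseteq> Bs ! j" using last(1) by (intro path_bagsD(4)[OF Bs(1) ijk(1)]) auto
    finally show ?thesis using ijk(1) last by (simp add: nth_append)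
  qed simp
qed

lemma boundary_decomposable_insert:
  assumes X: "boundary_decomposable E n X" "finite X" and "x \<notin> X" and "card (boundary E X) < n"
  shows "boundary_decomposable E n (insert x X)"
proof -
  obtain Bs where Bs: "path_bags E X Bs" "Bs \<noteq> []" "\<forall>B\<in>set Bs. card B \<le> n" "boundary E X \<subseteq> last Bs"
    using X(1) by (rule boundary_decomposableE)
  have "card (insert x (boundary E X)) \<le> n"
    using assms(4) finite_subset[OF boundary_subset X(2)] by (auto simp: card_insert_if)
  moreover have "path_bags E (insert x X) (Bs @ [insert x (boundary E X)])"
    using path_bags_snoc[OF Bs(1,2,4) \<open>x \<notin> X\<close>] .
  ultimately show ?thesis
    unfolding boundary_decomposable_def using Bs(3) boundary_insert[of E x X]
    by (intro exI[of _ "Bs @ [insert x (boundary E X)]"]) auto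
qed

lemma boundary_separator:
  assumes "Y \<subseteq> X" and S: "S = (X - Y) \<union> boundary E Y"
    and sep: "separates (E \<inter> S \<times> S) (boundary E Y) (boundary E X) Z"
  obtains Y' where "Y \<subseteq> Y'" "Y' \<subseteq> X" "boundary E Y' \<subseteq> Z"
proof -
  define D where "D = \<Union> {C. connected_in E C \<and> C \<subseteq> S - Z \<and> C \<inter> boundary E X \<noteq> {}}"
  have "D \<inter> boundary E Y = {}"
  proof (rule ccontr)
    assume "D \<inter> boundary E Y \<noteq> {}"
    then obtain C where C: "connected_in E C" "C \<subseteq> S - Z" "C \<inter> boundary E X \<noteq> {}"
      "C \<inter> boundary E Y \<noteq> {}"
      by (auto simp: D_def)
    then have "connected_in (E \<inter> S \<times> S) C" using connected_in_restrict_edges[of C S E] by blast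
    then show False using sep C(2-4) unfolding separates_def by blast
  qed
  then have D: "D \<subseteq> S - Z" "D \<inter> Y = {}" unfolding S D_def by blast+
  have "v \<in> Z" if v: "v \<in> boundary E (X - D)" for v
  proof (rule ccontr)
    assume "v \<notin> Z"
    obtain u where u: "v \<in> X" "v \<notin> D" "u \<notin> X - D" "(v, u) \<in> E" using v by (auto simp: boundary_def)
    have "v \<in> D"
    proof (cases "u \<in> X")
      case True
      then have "u \<in> D" using u(3) by blast
      then obtain C where C: "connected_in E C" "C \<subseteq> S - Z" "C \<inter> boundary E X \<noteq> {}" "u \<in> C"
        by (auto simp: D_def)
      have "v \<in> S" using u D \<open>u \<in> D\<close> by (auto simp: S boundary_def)
      moreover have "connected_in E (C \<union> {v})"
        using C(1,4) edge_sym[OF u(4)] by (intro connected_in_Un_adjacent) (auto simp: adjacent_def)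
      ultimately show ?thesis using C(2,3) \<open>v \<notin> Z\<close> unfolding D_def by blast
    next
      case False
      then have "v \<in> boundary E X" "v \<in> S" using u(1,4) \<open>Y \<subseteq> X\<close> by (auto simp: boundary_def S)
      then show ?thesis using \<open>v \<notin> Z\<close> unfolding D_def by (intro UnionI[of "{v}"]) auto
    qed
    with u(2) show False ..
  qed
  then show thesis using D(2) \<open>Y \<subseteq> X\<close> by (intro that[of "X - D"]) auto
qed

lemma boundary_paths_exist:
  assumes "finite X" "Y \<subseteq> X"
    and min: "\<And>Y'. Y \<subseteq> Y' \<Longrightarrow> Y' \<subseteq> X \<Longrightarrow> card (boundary E Y) \<le> card (boundary E Y')"
  obtains p where "\<And>y. y \<in> boundary E Y \<Longrightarrow> path_in E X (p y) \<and> set (p y) \<inter> Y = {y} \<and>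
      set (p y) \<inter> boundary E X \<noteq> {}"
    "disjoint_family_on (\<lambda>y. set (p y)) (boundary E Y)"
proof -
  define S where "S = (X - Y) \<union> boundary E Y"
  have S: "S \<subseteq> X" "S \<inter> Y = boundary E Y"
    using \<open>Y \<subseteq> X\<close> boundary_subset[of E Y] by (auto simp: S_def)
  have fin: "finite (E \<inter> S \<times> S)" "finite (boundary E Y)" "finite (boundary E X)"
    using assms(1,2) S(1) boundary_subset finite_subset
    by (metis finite_Int finite_SigmaI, metis, metis)
  have sym: "sym (E \<inter> S \<times> S)" using sym_edges by (auto simp: sym_def)
  interpret restricted: undirected "E \<inter> S \<times> S" using sym by unfold_locales
  have "card (boundary E Y) \<le> card Z"
    if Z: "finite Z" "separates (E \<inter> S \<times> S) (boundary E Y) (boundary E X) Z" for Z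
  proof -
    obtain Y' where Y': "Y \<subseteq> Y'" "Y' \<subseteq> X" "boundary E Y' \<subseteq> Z"
      using boundary_separator[OF \<open>Y \<subseteq> X\<close> S_def Z(2)] .
    then show ?thesis using min[OF Y'(1,2)] card_mono[OF Z(1) Y'(3)] by simp
  qed
  then obtain P where P: "linkage (E \<inter> S \<times> S) (boundary E Y) (boundary E X) P"
    "card P = card (boundary E Y)"
    using menger[OF fin(1) sym fin(2,3)] by blast
  obtain p where p: "\<And>y. y \<in> boundary E Y \<Longrightarrow> path_in (E \<inter> S \<times> S) UNIV (p y) \<and>
      set (p y) \<inter> boundary E X = {last (p y)} \<and> set (p y) \<inter> boundary E Y = {y} \<and> hd (p y) = y"
    "disjoint_family_on (\<lambda>y. set (p y)) (boundary E Y)"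
    using restricted.full_linkage_source[OF P fin(2)] by blast
  have path: "path_in E S (p y)" if "y \<in> boundary E Y" for y
    using p(1)[OF that] that by (intro path_in_restrict_edges) (auto simp: S_def)
  have "path_in E X (p y) \<and> set (p y) \<inter> Y = {y} \<and> set (p y) \<inter> boundary E X \<noteq> {}"
    if "y \<in> boundary E Y" for y
    using p(1)[OF that] path_inD(3)[OF path[OF that]] path_in_mono[OF path[OF that], of X] S
    by blast
  then show thesis using p(2) that by blast
qed

lemma boundary_linkage_exists:
  assumes "finite X" "Y \<subseteq> X"
    and "\<And>Y'. Y \<subseteq> Y' \<Longrightarrow> Y' \<subseteq> X \<Longrightarrow> card (boundary E Y) \<le> card (boundary E Y')"
  obtains L where "boundary_linkage E X Y L"
proof -
  obtain p where p: "\<And>y. y \<in> boundary E Y \<Longrightarrow> path_in E X (p y) \<and> set (p y) \<inter> Y = {y} \<and>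
      set (p y) \<inter> boundary E X \<noteq> {}"
    "disjoint_family_on (\<lambda>y. set (p y)) (boundary E Y)"
    using boundary_paths_exist assms by blast
  define L where "L y = (if y \<in> boundary E Y then set (p y) else {y})" for y
  have "connected_in E (L y) \<and> L y \<subseteq> X \<and> L y \<inter> Y = {y}" if "y \<in> Y" for y
    using p(1)[of y] connected_in_path_set[of X "p y"] path_inD(3)[of E X "p y"] that \<open>Y \<subseteq> X\<close>
    by (auto simp: L_def)
  moreover have "z \<notin> set (p y)" if "y \<in> boundary E Y" "z \<in> Y" "z \<noteq> y" for y z
    using p(1)[OF that(1)] that(2,3) by blast
  then have "disjoint_family_on L Y" using p(2) unfolding disjoint_family_on_def L_def by auto
  moreover have "L y \<inter> boundary E X \<noteq> {}" if "y \<in> boundary E Y" for y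
    using p(1)[OF that] that by (simp add: L_def)
  ultimately show thesis by (intro that[of L]) (simp add: boundary_linkage_def)
qed

lemma boundary_card_lower_bound:
  assumes X: "boundary_decomposable E n X" "finite X"
    and bound: "\<And>Y. Y0 \<subseteq> Y \<Longrightarrow> Y \<subseteq> X \<Longrightarrow> boundary_decomposable E n Y \<Longrightarrow> m \<le> card (boundary E Y)"
    and "Y0 \<subseteq> Y" "Y \<subseteq> X"
  shows "m \<le> card (boundary E Y)"
proof -
  have "\<exists>Z. (Y0 \<subseteq> Z \<and> Z \<subseteq> X) \<and>
      (\<forall>Z'. Y0 \<subseteq> Z' \<and> Z' \<subseteq> X \<longrightarrow> card (boundary E Z) \<le> card (boundary E Z'))"
    by (rule ex_has_least_nat[of _ Y]) (use assms(4,5) in simp)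
  then obtain Z where Z: "Y0 \<subseteq> Z" "Z \<subseteq> X"
    and least: "\<And>Z'. Y0 \<subseteq> Z' \<Longrightarrow> Z' \<subseteq> X \<Longrightarrow> card (boundary E Z) \<le> card (boundary E Z')" by metis
  obtain L where "boundary_linkage E X Z L"
    using boundary_linkage_exists[OF X(2) Z(2)] least Z(1) by (metis subset_trans)
  then have "boundary_decomposable E n Z" using boundary_decomposable_contract X Z(2) by blast
  then show ?thesis using bound[OF Z] least[OF assms(4,5)] by simp
qed

lemma saturated_extend:
  assumes X: "saturated E V n m X" "card (boundary E X) = m" and x: "x \<in> V - X"
    and "m < n" "finite V"
  obtains X' L where "saturated E V n (Suc m) X'" "card (boundary E X') = Suc m"
    "boundary E (insert x X) = insert x (boundary E X)" "boundary_linkage E X' (insert x X) L"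
proof -
  have sat: "X \<subseteq> V" "boundary_decomposable E n X"
    "\<And>Y. X \<subseteq> Y \<Longrightarrow> Y \<subseteq> V \<Longrightarrow> boundary_decomposable E n Y \<Longrightarrow> card (boundary E Y) \<le> m \<Longrightarrow> Y = X"
    using X(1) by (auto simp: saturated_def)
  have finX: "finite X" using sat(1) \<open>finite V\<close> finite_subset by blast
  have large: "Suc m \<le> card (boundary E Y)"
    if "insert x X \<subseteq> Y" "Y \<subseteq> V" "boundary_decomposable E n Y" for Y
    using sat(3)[of Y] that x by fastforce
  have decomposable: "boundary_decomposable E n (insert x X)"
    using boundary_decomposable_insert[OF sat(2) finX] x X(2) \<open>m < n\<close> by simp
  have "x \<notin> boundary E X" using x boundary_subset[of E X] by blast
  then have card: "finite (insert x (boundary E X))" "card (insert x (boundary E X)) = Suc m"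
    using finite_subset[OF boundary_subset finX] X(2) by simp_all
  have boundary: "boundary E (insert x X) = insert x (boundary E X)"
    using large[OF order_refl _ decomposable] sat(1) x card
    by (intro card_seteq[OF card(1) boundary_insert]) auto
  have small: "card (boundary E (insert x X)) \<le> Suc m" "insert x X \<subseteq> V"
    using boundary card(2) sat(1) x by auto
  obtain X' where X': "insert x X \<subseteq> X'" "saturated E V n (Suc m) X'"
    using saturated_exists[OF \<open>finite V\<close> small(2) decomposable small(1)] .
  then have sub: "X' \<subseteq> V" "boundary_decomposable E n X'" "card (boundary E X') \<le> Suc m" "finite X'"
    using \<open>finite V\<close> finite_subset by (auto simp: saturated_def)
  have "Suc m \<le> card (boundary E Y)" if "insert x X \<subseteq> Y" "Y \<subseteq> X'" for Y
  proof (rule boundary_card_lower_bound[OF sub(2,4) _ that])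
    show "Suc m \<le> card (boundary E Z)"
      if "insert x X \<subseteq> Z" "Z \<subseteq> X'" "boundary_decomposable E n Z" for Z
      using large[of Z] that sub(1) by blast
  qed
  then obtain L where "boundary_linkage E X' (insert x X) L"
    using boundary_linkage_exists[OF sub(4) X'(1)] small(1) by (meson order_trans)
  moreover have "card (boundary E X') = Suc m" using large[OF X'(1) sub(1,2)] sub(3) by simp
  ultimately show thesis using that X'(2) boundary by blast
qed

text \<open>
  The invariant of Diestel's proof. As \<^term>\<open>X\<close> is saturated, a new vertex enlarges its boundary, and
  Menger's theorem links the enlarged boundary to that of the next saturated set, so that all branch
  sets can be extended to meet the boundary again.
\<close>

definition boundary_tree_model ::
    "'a set \<Rightarrow> nat \<Rightarrow> bool list set \<Rightarrow> 'a set \<Rightarrow> (bool list \<Rightarrow> 'a set) \<Rightarrow> bool" where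
  "boundary_tree_model V n W X \<psi> \<longleftrightarrow> saturated E V n (card W) X \<and> card (boundary E X) = card W \<and>
     tree_model E W \<psi> X \<and> (\<forall>w\<in>W. \<psi> w \<inter> boundary E X \<noteq> {})"

lemma boundary_tree_model_next_vertex:
  assumes \<psi>: "boundary_tree_model V n (W - {w}) X \<psi>" and W: "tl_closed W" "w \<in> W"
    and V: "E \<subseteq> V \<times> V" "\<not> boundary_decomposable E n V"
  obtains x where "x \<in> V - X" "\<And>b u. w = b # u \<Longrightarrow> adjacent E (\<psi> u) {x}"
proof (cases w)
  case Nil
  have "X \<subseteq> V" "boundary_decomposable E n X"
    using \<psi> by (auto simp: boundary_tree_model_def saturated_def)
  moreover from this have "X \<noteq> V" using V(2) by auto
  ultimately obtain x where "x \<in> V - X" by blast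
  with Nil that show thesis by blast
next
  case (Cons b u)
  then have "u \<in> W - {w}" using W by (auto simp: tl_closed_def)
  then have "\<psi> u \<inter> boundary E X \<noteq> {}" using \<psi> by (simp add: boundary_tree_model_def)
  then obtain v x where "v \<in> \<psi> u" "x \<notin> X" "(v, x) \<in> E" by (auto simp: boundary_def)
  then show thesis using V(1) Cons by (intro that[of x]) (auto simp: adjacent_def)
qed

lemma boundary_tree_model_extend:
  assumes \<psi>: "boundary_tree_model V n (W - {w}) X \<psi>"
    and W: "finite W" "tl_closed W" "w \<in> W" "\<And>b. b # w \<notin> W" "card W \<le> n"
    and V: "finite V" "E \<subseteq> V \<times> V" "\<not> boundary_decomposable E n V"
  obtains X' \<psi>' where "boundary_tree_model V n W X' \<psi>'"
proof -
  have card: "card W = Suc (card (W - {w}))" using card_Suc_Diff1[OF W(1,3)] by simp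
  have X: "saturated E V n (card (W - {w})) X" "card (boundary E X) = card (W - {w})"
    "tree_model E (W - {w}) \<psi> X" "\<And>u. u \<in> W - {w} \<Longrightarrow> \<psi> u \<inter> boundary E X \<noteq> {}"
    using \<psi> by (auto simp: boundary_tree_model_def)
  obtain x where x: "x \<in> V - X" "\<And>b u. w = b # u \<Longrightarrow> adjacent E (\<psi> u) {x}"
    using boundary_tree_model_next_vertex[OF \<psi> W(2,3) V(2,3)] by blast
  have "card (W - {w}) < n" using card W(5) by simp
  then obtain X' L where X': "saturated E V n (card W) X'" "card (boundary E X') = card W"
    and boundary: "boundary E (insert x X) = insert x (boundary E X)"
    and L: "boundary_linkage E X' (insert x X) L"
    using saturated_extend[OF X(1,2) x(1) _ V(1)] unfolding card by metis
  have L': "connected_in E (L y)" "y \<in> L y" "L y \<subseteq> X'" if "y \<in> insert x X" for y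
    using L that by (auto simp: boundary_linkage_def)
  define \<chi> where "\<chi> = (\<lambda>u. \<Union>y\<in>(\<psi>(w := {x})) u. L y)"
  have "tree_model E W (\<psi>(w := {x})) (insert x X)"
    using X(3) x W(4) by (intro tree_model_insert) auto
  then have "tree_model E W \<chi> X'"
    unfolding \<chi>_def
    by (rule minor_model_fatten[OF _ L']) (use L in \<open>auto simp: boundary_linkage_def\<close>)
  moreover have "\<chi> u \<inter> boundary E X' \<noteq> {}" if u: "u \<in> W" for u
  proof -
    obtain y where y: "y \<in> (\<psi>(w := {x})) u" "y \<in> boundary E (insert x X)"
      using X(4)[of u] u boundary by (cases "u = w") auto
    then have "L y \<inter> boundary E X' \<noteq> {}" using L by (auto simp: boundary_linkage_def)
    with y(1) show ?thesis unfolding \<chi>_def by blast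
  qed
  ultimately have "boundary_tree_model V n W X' \<chi>" using X' by (simp add: boundary_tree_model_def)
  then show thesis by (rule that)
qed

lemma boundary_tree_model_exists:
  assumes "finite W" "tl_closed W" "card W \<le> n"
    and V: "finite V" "E \<subseteq> V \<times> V" "\<not> boundary_decomposable E n V"
  shows "\<exists>X \<psi>. boundary_tree_model V n W X \<psi>"
  using assms(1-3)
proof (induction "card W" arbitrary: W)
  case 0
  have "card (boundary E {}) \<le> 0" by (simp add: boundary_def)
  then obtain X where "saturated E V n 0 X"
    using saturated_exists[OF V(1) empty_subsetI boundary_decomposable_empty] by metis
  then have "boundary_tree_model V n W X (\<lambda>_. {})"
    using 0
    by (simp add: boundary_tree_model_def saturated_def minor_model_def disjoint_family_on_def)
  then show ?case by blast
next
  case (Suc m)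
  then have "W \<noteq> {}" by auto
  then obtain w where w: "w \<in> W" "tl_closed (W - {w})" "\<And>b. b # w \<notin> W"
    using tl_closed_remove[OF Suc.prems(1) _ Suc.prems(2)] by blast
  have "card (W - {w}) = m" using Suc.hyps(2) w(1) Suc.prems(1) by simp
  then obtain X \<psi> where "boundary_tree_model V n (W - {w}) X \<psi>"
    using Suc.hyps(1)[of "W - {w}"] w(2) Suc.prems(1,3) Suc.hyps(2) by auto
  then show ?case
    using boundary_tree_model_extend[OF _ Suc.prems(1,2) w(1,3) Suc.prems(3) V] by blast
qed

theorem tree_model_exists:
  assumes W: "finite W" "tl_closed W" "card W = Suc n"
    and V: "finite V" "E \<subseteq> V \<times> V" "\<not> boundary_decomposable E n V"
  obtains \<psi> where "tree_model E W \<psi> V"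
proof -
  have "W \<noteq> {}" using W(3) by auto
  then obtain w where w: "w \<in> W" "tl_closed (W - {w})" "\<And>b. b # w \<notin> W"
    using tl_closed_remove[OF W(1) _ W(2)] by blast
  have "card (W - {w}) \<le> n" using W(3) w(1) W(1) by simp
  then obtain X \<psi> where \<psi>: "boundary_tree_model V n (W - {w}) X \<psi>"
    using boundary_tree_model_exists[of "W - {w}"] W(1) w(2) V by blast
  obtain x where x: "x \<in> V - X" "\<And>b u. w = b # u \<Longrightarrow> adjacent E (\<psi> u) {x}"
    using boundary_tree_model_next_vertex[OF \<psi> W(2) w(1) V(2,3)] by blast
  have "tree_model E (W - {w}) \<psi> X" "X \<subseteq> V"
    using \<psi> by (auto simp: boundary_tree_model_def saturated_def)
  then have "tree_model E W (\<psi>(w := {x})) (insert x X)" "insert x X \<subseteq> V"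
    using x w(3) by (auto intro: tree_model_insert)
  then show thesis by (rule that[OF minor_model_mono])
qed

end

lemma convex_nat_set_interval:
  assumes "finite (I :: nat set)" "I \<noteq> {}" "\<And>i j k. i \<in> I \<Longrightarrow> k \<in> I \<Longrightarrow> i \<le> j \<Longrightarrow> j \<le> k \<Longrightarrow> j \<in> I"
  shows "\<exists>a b. a \<le> b \<and> I = {a..b}"
proof (intro exI conjI)
  show "Min I \<le> Max I" using assms(1,2) by simp
  show "I = {Min I..Max I}"
  proof
    show "{Min I..Max I} \<subseteq> I"
    proof
      fix j assume "j \<in> {Min I..Max I}"
      then show "j \<in> I"
        using assms(3)[of "Min I" "Max I" j] Min_in[OF assms(1,2)] Max_in[OF assms(1,2)] by simp
    qed
  qed (use assms(1) in auto)
qed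

lemma pathwidth_le:
  assumes G: "pair_graph G" and "boundary_decomposable (parcs G) (Suc n) (pverts G)"
  shows "pathwidth G \<le> n"
proof -
  interpret G: pair_graph G by (rule G)
  obtain Bs where Bs: "path_bags (parcs G) (pverts G) Bs" "\<forall>B\<in>set Bs. card B \<le> Suc n"
    using assms(2) by (rule boundary_decomposableE)
  have "path_decomposition G Bs"
    unfolding path_decomposition_def
  proof (intro conjI ballI)
    fix v assume v: "v \<in> pverts G"
    show "\<exists>a b. a \<le> b \<and> {i. i < length Bs \<and> v \<in> Bs ! i} = {a..b}"
    proof (rule convex_nat_set_interval)
      show "{i. i < length Bs \<and> v \<in> Bs ! i} \<noteq> {}"
        using path_bagsD(2)[OF Bs(1) v] by (auto simp: in_set_conv_nth)
      show "j \<in> {i. i < length Bs \<and> v \<in> Bs ! i}" if "i \<in> {i. i < length Bs \<and> v \<in> Bs ! i}"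
        "k \<in> {i. i < length Bs \<and> v \<in> Bs ! i}" "i \<le> j" "j \<le> k" for i j k
        using path_bagsD(4)[OF Bs(1), of i j k] that by auto
    qed simp
  next
    fix e assume "e \<in> parcs G"
    moreover obtain u v where "e = (u, v)" by (cases e)
    ultimately show "case e of (u, v) \<Rightarrow> \<exists>B\<in>set Bs. u \<in> B \<and> v \<in> B"
      using path_bagsD(3)[OF Bs(1), of u v] G.in_arcsD1 G.in_arcsD2 by auto
  qed (use path_bagsD(1)[OF Bs(1)] in blast)
  then show ?thesis unfolding pathwidth_def using Bs(2) by (intro Least_le exI[of _ Bs]) simp
qed

lemma finite_words: "finite (words k)"
  using finite_lists_length_le[of "UNIV :: bool set" k] by simp

lemma card_words: "card (words k) = 2 ^ Suc k - 1"
proof -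
  have "card (words k) = (\<Sum>i\<le>k. 2 ^ i)" using card_lists_length_le[of "UNIV :: bool set" k] by simp
  also have "\<dots> = 2 ^ Suc k - 1" by (induction k) auto
  finally show ?thesis .
qed

lemma complete_tree_model_exists:
  assumes G: "pair_graph G" and "1 \<le> k" and "2 ^ Suc k - 2 \<le> pathwidth G"
  obtains \<psi> where "tree_model (parcs G) (words k) \<psi> (pverts G)"
proof -
  interpret G: pair_graph G by (rule G)
  interpret undirected "parcs G" using G by (rule undirected_parcs)
  define n :: nat where "n = 2 ^ Suc k - 3"
  have "(2::nat) ^ 2 \<le> 2 ^ Suc k" using \<open>1 \<le> k\<close> by (intro power_increasing) auto
  then have n: "Suc n = 2 ^ Suc k - 2" "card (words k) = Suc (Suc n)"
    unfolding card_words by (simp_all add: n_def)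
  then have "\<not> boundary_decomposable (parcs G) (Suc n) (pverts G)"
    using pathwidth_le[OF G, of n] assms(3) by linarith
  moreover have "tl_closed (words k)" by (simp add: tl_closed_def)
  moreover have "parcs G \<subseteq> pverts G \<times> pverts G" using G.in_arcsD1 G.in_arcsD2 by auto
  ultimately show thesis
    using tree_model_exists[OF finite_words _ n(2)] G.pair_finite_verts that by blast
qed

section \<open>Rooted models\<close>

definition Gamma_plus_arcs :: "nat \<Rightarrow> (bool list option \<times> bool list option) set" where
  "Gamma_plus_arcs l = {(Some w, Some (b # w)) | w b. True} \<union> {(Some w, None) | w. length w = l}"

fun nabla_arcs :: "nat \<Rightarrow> (nat \<times> nat) set" where
  "nabla_arcs 0 = {(0, 1)}"
| "nabla_arcs (Suc i) =
     nabla_arcs i \<union> map_prod ((+) (2 ^ i)) ((+) (2 ^ i)) ` nabla_arcs i \<union> {(0, 2 ^ Suc i)}"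

definition Gamma_plus_model :: "('a \<times> 'a) set \<Rightarrow> nat \<Rightarrow> 'a set \<Rightarrow> bool" where
  "Gamma_plus_model E l S \<longleftrightarrow> (\<exists>\<phi>. minor_model E (pverts (Gamma_plus l)) (Gamma_plus_arcs l) \<phi> S)"

abbreviation rooted_Gamma_plus :: "('a \<times> 'a) set \<Rightarrow> nat \<Rightarrow> 'a \<Rightarrow> 'a \<Rightarrow> 'a set \<Rightarrow> bool" where
  "rooted_Gamma_plus E l \<equiv>
     rooted_model E (pverts (Gamma_plus l)) (Gamma_plus_arcs l) (Some []) None"

abbreviation rooted_nabla :: "('a \<times> 'a) set \<Rightarrow> nat \<Rightarrow> 'a \<Rightarrow> 'a \<Rightarrow> 'a set \<Rightarrow> bool" where
  "rooted_nabla E i \<equiv> rooted_model E {..2 ^ i} (nabla_arcs i) 0 (2 ^ i)"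

text \<open>
  The connectors of two blocks \<^term>\<open>B1\<close>, \<^term>\<open>B2\<close>. In series, \<^term>\<open>A\<close> and \<^term>\<open>D\<close> become the ends
  of the root edge of a model of \<open>\<nabla>\<close>. In parallel, \<^term>\<open>R\<close> becomes the root and \<^term>\<open>Q\<close> joins the
  apices of two models of \<open>\<Gamma>\<^sup>+\<close>.
\<close>

definition series_connectors ::
    "('a \<times> 'a) set \<Rightarrow> 'a set \<Rightarrow> 'a set \<Rightarrow> 'a set \<Rightarrow> 'a \<Rightarrow> 'a \<Rightarrow> 'a \<Rightarrow> 'a \<Rightarrow> 'a set \<Rightarrow> 'a set \<Rightarrow> 'a set \<Rightarrow> bool"
  where "series_connectors E S B1 B2 p1 p2 q1 q2 A C D \<longleftrightarrow>
    connected_in E A \<and> connected_in E C \<and> connected_in E D \<and> adjacent E A D \<and>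
    A \<union> C \<union> D \<subseteq> S \<and> A \<inter> C = {} \<and> A \<inter> D = {} \<and> C \<inter> D = {} \<and>
    A \<inter> B1 = {p1} \<and> C \<inter> B1 = {p2} \<and> D \<inter> B1 = {} \<and> A \<inter> B2 = {} \<and> C \<inter> B2 = {q2} \<and> D \<inter> B2 = {q1}"

definition parallel_connectors ::
    "('a \<times> 'a) set \<Rightarrow> 'a set \<Rightarrow> 'a set \<Rightarrow> 'a set \<Rightarrow> 'a \<Rightarrow> 'a \<Rightarrow> 'a \<Rightarrow> 'a \<Rightarrow> 'a set \<Rightarrow> 'a set \<Rightarrow> bool"
  where "parallel_connectors E S B1 B2 p1 p2 q1 q2 R Q \<longleftrightarrow>
    connected_in E R \<and> connected_in E Q \<and> R \<union> Q \<subseteq> S \<and> R \<inter> Q = {} \<and> R \<inter> (B1 \<union> B2) = {} \<and>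
    p1 \<in> B1 - Q \<and> q1 \<in> B2 - Q \<and> adjacent E R {p1} \<and> adjacent E R {q1} \<and>
    Q \<inter> B1 = {p2} \<and> Q \<inter> B2 = {q2}"

lemma pverts_Gamma_plus: "pverts (Gamma_plus l) = insert None (Some ` words l)"
  by (auto simp: Gamma_plus_def Gamma_def)

lemma Gamma_plus_modelI:
  assumes \<psi>: "tree_model E (words l) \<psi> S" and Q: "connected_in E Q" "Q \<subseteq> S"
    and "\<And>w. length w \<le> l \<Longrightarrow> \<psi> w \<inter> Q = {}" "\<And>w. length w = l \<Longrightarrow> adjacent E (\<psi> w) Q"
  shows "Gamma_plus_model E l S"
  unfolding Gamma_plus_model_def
proof (intro exI minor_modelI)
  note model = minor_modelD[OF \<psi>]
  show "connected_in E (case_option Q \<psi> v)" "case_option Q \<psi> v \<subseteq> S" if "v \<in> pverts (Gamma_plus l)"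
    for v
    using that Q model(1,2) by (auto simp: pverts_Gamma_plus split: option.split)
  show "case_option Q \<psi> u \<inter> case_option Q \<psi> v = {}"
    if "u \<in> pverts (Gamma_plus l)" "v \<in> pverts (Gamma_plus l)" "u \<noteq> v" for u v
    using that assms(4) model(3)
    by (cases u; cases v) (simp_all add: pverts_Gamma_plus image_iff Int_commute)
  show "adjacent E (case_option Q \<psi> u) (case_option Q \<psi> v)"
    if "u \<in> pverts (Gamma_plus l)" "v \<in> pverts (Gamma_plus l)" "(u, v) \<in> Gamma_plus_arcs l" for u v
    using that assms(5) model(4)
    by (auto simp: pverts_Gamma_plus Gamma_plus_arcs_def child_arcs_def)
qed

lemma Gamma_plus_model_mono: "Gamma_plus_model E l S \<Longrightarrow> S \<subseteq> T \<Longrightarrow> Gamma_plus_model E l T"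
  unfolding Gamma_plus_model_def by (metis minor_model_mono)

lemma rooted_Gamma_plus_imp_model: "rooted_Gamma_plus E l a b S \<Longrightarrow> Gamma_plus_model E l S"
  unfolding rooted_model_def Gamma_plus_model_def by blast

lemma nabla_arcs_le: "(m, m') \<in> nabla_arcs i \<Longrightarrow> m \<le> 2 ^ i \<and> m' \<le> 2 ^ i"
  by (induction i arbitrary: m m') (fastforce simp: map_prod_def)+

lemma nabla_arcs_Suc_cases:
  assumes "(m, m') \<in> nabla_arcs (Suc i)"
  obtains (left) "(m, m') \<in> nabla_arcs i"
    | (right) k k' where "(k, k') \<in> nabla_arcs i" "m = 2 ^ i + k" "m' = 2 ^ i + k'"
    | (root) "m = 0" "m' = 2 ^ Suc i"
  using assms by auto

lemma nabla_arcs_Suc_subset: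
  assumes "(m, m') \<in> nabla_arcs (Suc i)" "(m, m') \<noteq> (0, 2 ^ Suc i)"
  shows "(m, m') \<in> map_prod id id ` (nabla_arcs i \<inter> {..2 ^ i} \<times> {..2 ^ i}) \<union>
    map_prod ((+) (2 ^ i)) ((+) (2 ^ i)) ` (nabla_arcs i \<inter> {..2 ^ i} \<times> {..2 ^ i})"
  using assms(1)
proof (cases rule: nabla_arcs_Suc_cases)
  case left
  then show ?thesis using nabla_arcs_le[OF left] by (simp add: prod.map_id0)
next
  case (right k k')
  then have "(k, k') \<in> nabla_arcs i \<inter> {..2 ^ i} \<times> {..2 ^ i}"
    "(m, m') = map_prod ((+) (2 ^ i)) ((+) (2 ^ i)) (k, k')"
    using nabla_arcs_le[OF right(1)] by simp_all
  then show ?thesis by blast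
qed (use assms(2) in simp)

lemma fibre_union_nabla:
  "fibre_union \<phi> {..n} id m = (if m \<le> n then \<phi> m else {})"
  "fibre_union \<chi> {..n} ((+) n) m = (if n \<le> m \<and> m \<le> 2 * n then \<chi> (m - n) else {})" for n m :: nat
proof -
  show "fibre_union \<phi> {..n} id m = (if m \<le> n then \<phi> m else {})" by (auto simp: fibre_union_def)
  have "{w \<in> {..n}. n + w = m} = (if n \<le> m \<and> m \<le> 2 * n then {m - n} else {})" by auto
  then show "fibre_union \<chi> {..n} ((+) n) m = (if n \<le> m \<and> m \<le> 2 * n then \<chi> (m - n) else {})"
    by (simp add: fibre_union_def)
qed

definition graft :: "bool \<Rightarrow> bool list option \<Rightarrow> bool list option" where
  "graft c = map_option (\<lambda>w. w @ [c])"

lemma fibre_union_graft: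
  "fibre_union \<phi> (pverts (Gamma_plus j)) (graft c) None = \<phi> None"
  "fibre_union \<phi> (pverts (Gamma_plus j)) (graft c) (Some []) = {}"
  "w \<in> words j \<Longrightarrow> fibre_union \<phi> (pverts (Gamma_plus j)) (graft c) (Some (w @ [d])) =
     (if c = d then \<phi> (Some w) else {})"
  by (auto simp: fibre_union_def graft_def pverts_Gamma_plus)

lemma pverts_Gamma_plus_Suc_cases:
  assumes "x \<in> pverts (Gamma_plus (Suc j))"
  obtains (apex) "x = None" | (root) "x = Some []"
    | (grafted) w c where "x = Some (w @ [c])" "w \<in> words j"
proof (cases x)
  case (Some w)
  then show thesis using that assms by (cases w rule: rev_cases) (auto simp: pverts_Gamma_plus)
qed (use that in simp)

lemma Gamma_plus_arcs_Suc_subset: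
  assumes "(x, y) \<in> Gamma_plus_arcs (Suc j)"
    "x \<in> pverts (Gamma_plus (Suc j))" "y \<in> pverts (Gamma_plus (Suc j))"
  shows "(\<exists>c. (x, y) = (Some [], Some [c])) \<or>
    (x, y) \<in> map_prod (graft False) (graft False) `
        (Gamma_plus_arcs j \<inter> pverts (Gamma_plus j) \<times> pverts (Gamma_plus j)) \<union>
      map_prod (graft True) (graft True) `
        (Gamma_plus_arcs j \<inter> pverts (Gamma_plus j) \<times> pverts (Gamma_plus j))"
    (is "_ \<or> (x, y) \<in> ?grafted")
proof -
  have grafted: "(x, y) \<in> ?grafted"
    if "(u, v) \<in> Gamma_plus_arcs j" "u \<in> pverts (Gamma_plus j)" "v \<in> pverts (Gamma_plus j)"
      "x = graft c u" "y = graft c v" for c u v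
    using that by (cases c) (auto intro: image_eqI[of _ _ "(u, v)"])
  from assms consider (child) w b where "x = Some w" "y = Some (b # w)" "length w \<le> j"
    | (leaf) w where "x = Some w" "y = None" "length w = Suc j"
    by (auto simp: Gamma_plus_arcs_def pverts_Gamma_plus)
  then show ?thesis
  proof cases
    case child
    show ?thesis
    proof (cases w rule: rev_cases)
      case Nil
      then show ?thesis using child by simp
    next
      case (snoc u c)
      then show ?thesis
        using child by (intro disjI2 grafted[of "Some u" "Some (b # u)" c])
          (auto simp: graft_def pverts_Gamma_plus Gamma_plus_arcs_def)
    qed
  next
    case leaf
    then obtain u c where "w = u @ [c]" "length u = j" by (cases w rule: rev_cases) auto
    then show ?thesis
      using leaf by (intro disjI2 grafted[of "Some u" None c])
        (auto simp: graft_def pverts_Gamma_plus Gamma_plus_arcs_def)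
  qed
qed

lemma nabla_arcs_reflect: "(m, m') \<in> nabla_arcs i \<Longrightarrow> (2 ^ i - m', 2 ^ i - m) \<in> nabla_arcs i"
proof (induction i arbitrary: m m')
  case (Suc i)
  have right: "(2 ^ i + k, 2 ^ i + k') \<in> nabla_arcs (Suc i)" if "(k, k') \<in> nabla_arcs i" for k k'
    using that by (auto intro!: image_eqI[of _ _ "(k, k')"])
  from Suc.prems show ?case
  proof (cases rule: nabla_arcs_Suc_cases)
    case left
    then show ?thesis using right[OF Suc.IH[OF left]] nabla_arcs_le[OF left] by (simp add: mult_2)
  next
    case (right k k')
    then show ?thesis using Suc.IH[of k k'] by (simp add: mult_2)
  qed simp
qed simp

context undirected
begin

lemma rooted_nabla_sym:
  assumes "rooted_nabla E i a b S"
  shows "rooted_nabla E i b a S"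
proof -
  obtain \<phi> where \<phi>: "minor_model E {..2 ^ i} (nabla_arcs i) \<phi> S" "a \<in> \<phi> 0" "b \<in> \<phi> (2 ^ i)"
    using assms unfolding rooted_model_def by blast
  have "minor_model E {..2 ^ i} (nabla_arcs i) (\<lambda>m. \<phi> (2 ^ i - m)) S"
  proof (rule minor_model_reindex[OF minor_model_symcl[OF \<phi>(1)]])
    show "inj_on (\<lambda>m. 2 ^ i - m) {..(2::nat) ^ i}" by (auto simp: inj_on_def)
  qed (use nabla_arcs_reflect minor_modelD(2)[OF \<phi>(1)] in \<open>auto simp: symcl_iff\<close>)
  then show ?thesis
    unfolding rooted_model_def using \<phi>(2,3) by (intro exI[of _ "\<lambda>m. \<phi> (2 ^ i - m)"]) simp
qed

lemma connected_in_split_off: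
  assumes "connected_in E S" "a \<in> S" "b \<in> S" "a \<noteq> b"
  obtains Q where "connected_in E Q" "Q \<subseteq> S - {a}" "b \<in> Q" "adjacent E {a} Q"
proof -
  obtain Q where Q: "component_in E (S - {a}) Q" "b \<in> Q"
    using component_in_exists[of b "S - {a}"] assms(3,4) by blast
  then have sub: "connected_in E Q" "Q \<subseteq> S - {a}" "\<not> adjacent E Q (S - {a} - Q)"
    by (auto simp: component_in_def)
  have "adjacent E Q (S - Q)" using assms(1,2) sub(2) Q(2) by (intro connected_in_cut) auto
  then have "adjacent E Q {a}" using sub(3) unfolding adjacent_def by blast
  then show thesis using that sub(1,2) Q(2) adjacent_sym by blast
qed

lemma rooted_models_zero:
  assumes "connected_in E S" "a \<in> S" "b \<in> S" "a \<noteq> b"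
  shows "rooted_nabla E 0 a b S" "rooted_Gamma_plus E 0 a b S"
proof -
  obtain Q where Q: "connected_in E Q" "Q \<subseteq> S - {a}" "b \<in> Q" "adjacent E {a} Q"
    using connected_in_split_off[OF assms] .
  have "minor_model E {..2 ^ 0} (nabla_arcs 0) (\<lambda>m. if m = 0 then {a} else Q) S"
    using Q assms(2) by (intro minor_modelI) auto
  then show "rooted_nabla E 0 a b S"
    unfolding rooted_model_def using Q(3) by (intro exI[of _ "\<lambda>m. if m = 0 then {a} else Q"]) simp
  have "minor_model E (pverts (Gamma_plus 0)) (Gamma_plus_arcs 0) (case_option Q (\<lambda>_. {a})) S"
    using Q assms(2) by (intro minor_modelI) (auto simp: pverts_Gamma_plus Gamma_plus_arcs_def)
  then show "rooted_Gamma_plus E 0 a b S"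
    unfolding rooted_model_def using Q(3) by (intro exI[of _ "case_option Q (\<lambda>_. {a})"]) simp
qed

lemma rooted_nabla_series:
  assumes N: "rooted_nabla E i p1 p2 B1" "rooted_nabla E i q2 q1 B2"
    and B: "B1 \<union> B2 \<subseteq> S" "B1 \<inter> B2 = {}"
    and link: "series_connectors E S B1 B2 p1 p2 q1 q2 A C D" and "a \<in> A" "b \<in> D"
  shows "rooted_nabla E (Suc i) a b S"
proof -
  define n :: nat where "n = 2 ^ i"
  have n: "0 < n" "2 ^ Suc i = 2 * n" by (simp_all add: n_def)
  obtain \<phi> where \<phi>: "minor_model E {..n} (nabla_arcs i) \<phi> B1" "p1 \<in> \<phi> 0" "p2 \<in> \<phi> n"
    using N(1) unfolding rooted_model_def n_def by blast
  obtain \<chi> where \<chi>: "minor_model E {..n} (nabla_arcs i) \<chi> B2" "q2 \<in> \<chi> 0" "q1 \<in> \<chi> n"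
    using N(2) unfolding rooted_model_def n_def by blast
  note connectors = link[unfolded series_connectors_def]
  define K where "K m = (if m = 0 then A else if m = n then C else if m = 2 * n then D else {})"
    for m
  define M where "M m = K m \<union> fibre_union \<phi> {..n} id m \<union> fibre_union \<chi> {..n} ((+) n) m" for m
  note conn = minor_modelD(1)[OF \<phi>(1)] minor_modelD(1)[OF \<chi>(1)]
  have "minor_model E {..2 * n} (nabla_arcs (Suc i)) M S"
    unfolding M_def
  proof (rule minor_model_glue[OF \<phi>(1) \<chi>(1) B], unfold M_def[symmetric])
    fix m assume m: "m \<in> {..2 * n}"
    have "connected_in E (A \<union> \<phi> 0)" "connected_in E (C \<union> \<phi> n)" "connected_in E (D \<union> \<chi> n)"
      using connectors \<phi>(2,3) \<chi>(3) conn by (auto intro!: connected_in_Un)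
    moreover from this(2) have "connected_in E (C \<union> \<phi> n \<union> \<chi> 0)"
      by (rule connected_in_Un) (use connectors \<chi>(2) conn(2)[of 0] in auto)
    ultimately show "connected_in E (M m)"
      using m n(1) conn unfolding M_def fibre_union_nabla K_def by auto
    show "K m \<subseteq> S" using connectors by (auto simp: K_def)
    show "K m \<inter> B1 \<subseteq> fibre_union \<phi> {..n} id m" "K m \<inter> B2 \<subseteq> fibre_union \<chi> {..n} ((+) n) m"
      unfolding fibre_union_nabla K_def using connectors \<phi>(2,3) \<chi>(2,3) n(1) by auto
  next
    show "disjoint_family_on K {..2 * n}"
      using connectors by (auto simp: disjoint_family_on_def K_def)
  next
    fix x y assume arc: "(x, y) \<in> nabla_arcs (Suc i)"
    have "adjacent E A D" using connectors by simp
    then have "adjacent E (M 0) (M (2 * n))"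
      by (rule adjacent_mono) (use n in \<open>auto simp: M_def K_def\<close>)
    then show "(x, y) \<in> map_prod id id ` (nabla_arcs i \<inter> {..n} \<times> {..n}) \<union>
        map_prod ((+) n) ((+) n) ` (nabla_arcs i \<inter> {..n} \<times> {..n}) \<or> adjacent E (M x) (M y)"
      using nabla_arcs_Suc_subset[OF arc] unfolding n(2) by (fold n_def) blast
  qed
  moreover have "a \<in> M 0" "b \<in> M (2 * n)" using \<open>a \<in> A\<close> \<open>b \<in> D\<close> n(1) by (simp_all add: M_def K_def)
  ultimately show ?thesis unfolding rooted_model_def n(2) by blast
qed

lemma rooted_Gamma_plus_parallel:
  assumes N: "rooted_Gamma_plus E j p1 p2 B1" "rooted_Gamma_plus E j q1 q2 B2"
    and B: "B1 \<union> B2 \<subseteq> S" "B1 \<inter> B2 = {}"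
    and link: "parallel_connectors E S B1 B2 p1 p2 q1 q2 R Q" and "a \<in> R" "b \<in> Q"
  shows "rooted_Gamma_plus E (Suc j) a b S"
proof -
  define U where "U = pverts (Gamma_plus j)"
  obtain \<phi> where \<phi>: "minor_model E U (Gamma_plus_arcs j) \<phi> B1" "p1 \<in> \<phi> (Some [])" "p2 \<in> \<phi> None"
    using N(1) unfolding rooted_model_def U_def by blast
  obtain \<chi> where \<chi>: "minor_model E U (Gamma_plus_arcs j) \<chi> B2" "q1 \<in> \<chi> (Some [])" "q2 \<in> \<chi> None"
    using N(2) unfolding rooted_model_def U_def by blast
  note connectors = link[unfolded parallel_connectors_def]
  note connected = minor_modelD(1)[OF \<phi>(1)] minor_modelD(1)[OF \<chi>(1)]
  note fibre = fibre_union_graft[of _ j, folded U_def]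
  define K where "K x = (if x = None then Q else if x = Some [] then R else {})"
    for x :: "bool list option"
  define M where "M x = K x \<union> fibre_union \<phi> U (graft False) x \<union> fibre_union \<chi> U (graft True) x"
    for x
  have M: "M None = Q \<union> \<phi> None \<union> \<chi> None" "M (Some []) = R"
    "w \<in> words j \<Longrightarrow> M (Some (w @ [c])) = (if c then \<chi> (Some w) else \<phi> (Some w))" for w c
    by (simp_all add: M_def K_def fibre)
  have roots: "None \<in> U" "Some [] \<in> U" by (simp_all add: U_def pverts_Gamma_plus)
  have "minor_model E (pverts (Gamma_plus (Suc j))) (Gamma_plus_arcs (Suc j)) M S"
    unfolding M_def
  proof (rule minor_model_glue[OF \<phi>(1) \<chi>(1) B], unfold M_def[symmetric])
    fix x assume x: "x \<in> pverts (Gamma_plus (Suc j))"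
    have "connected_in E (Q \<union> \<phi> None)"
      using connectors \<phi>(3) connected(1)[OF roots(1)] by (intro connected_in_Un) auto
    then have "connected_in E (Q \<union> \<phi> None \<union> \<chi> None)"
      by (rule connected_in_Un) (use connectors \<chi>(3) connected(2)[OF roots(1)] in auto)
    with x show "connected_in E (M x)"
      using connectors connected
      by (cases rule: pverts_Gamma_plus_Suc_cases) (auto simp: M U_def pverts_Gamma_plus)
    show "K x \<subseteq> S" using connectors by (auto simp: K_def)
    show "K x \<inter> B1 \<subseteq> fibre_union \<phi> U (graft False) x" "K x \<inter> B2 \<subseteq> fibre_union \<chi> U (graft True) x"
      using connectors \<phi>(3) \<chi>(3) by (auto simp: K_def fibre)
  next
    show "disjoint_family_on K (pverts (Gamma_plus (Suc j)))"
      using connectors by (auto simp: disjoint_family_on_def K_def)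
  next
    fix x y assume arc: "(x, y) \<in> Gamma_plus_arcs (Suc j)"
      "x \<in> pverts (Gamma_plus (Suc j))" "y \<in> pverts (Gamma_plus (Suc j))"
    have "adjacent E R (\<phi> (Some []))" "adjacent E R (\<chi> (Some []))"
      using connectors \<phi>(2) \<chi>(2)
      by (auto intro: adjacent_mono[of E R "{p1}"] adjacent_mono[of E R "{q1}"])
    then have "adjacent E (M (Some [])) (M (Some [c]))" for c using M(2) M(3)[of "[]" c] by simp
    then show "(x, y) \<in> map_prod (graft False) (graft False) ` (Gamma_plus_arcs j \<inter> U \<times> U) \<union>
        map_prod (graft True) (graft True) ` (Gamma_plus_arcs j \<inter> U \<times> U) \<or> adjacent E (M x) (M y)"
      using Gamma_plus_arcs_Suc_subset[OF arc, folded U_def] by blast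
  qed
  moreover have "a \<in> M (Some [])" "b \<in> M None" using \<open>a \<in> R\<close> \<open>b \<in> Q\<close> by (simp_all add: M)
  ultimately show ?thesis unfolding rooted_model_def by blast
qed

end

lemma Gamma_plus_model_is_minor:
  assumes "pair_graph G" "Gamma_plus_model (parcs G) l (pverts G)"
  shows "is_minor (Gamma_plus l) G"
proof -
  obtain \<phi> where "minor_model (parcs G) (pverts (Gamma_plus l)) (Gamma_plus_arcs l) \<phi> (pverts G)"
    using assms(2) by (auto simp: Gamma_plus_model_def)
  moreover have "parcs (Gamma_plus l) \<subseteq> symcl (Gamma_plus_arcs l)"
    by (auto simp: Gamma_plus_def Gamma_def Gamma_plus_arcs_def symcl_iff)
  ultimately show ?thesis by (rule minor_model_is_minor[OF pair_graph_Gamma_plus assms(1)])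
qed

lemma parcs_nabla: "parcs (nabla (Suc k)) \<subseteq> symcl (nabla_arcs (Suc k))"
proof (induction k)
  case 0
  show ?case by (auto simp: triangle_def symcl_iff)
next
  case (Suc k)
  define n :: nat where "n = 2 ^ Suc k"
  have nabla: "parcs (nabla (Suc (Suc k))) = parcs (nabla (Suc k)) \<union>
      map_prod ((+) n) ((+) n) ` parcs (nabla (Suc k)) \<union> symcl {(0, n), (n, 2 * n), (0, 2 * n)}"
    by (simp only: nabla.simps Let_def n_def triangle_def pair_pre_digraph.simps)
  have arcs: "nabla_arcs (Suc (Suc k)) =
      nabla_arcs (Suc k) \<union> map_prod ((+) n) ((+) n) ` nabla_arcs (Suc k) \<union> {(0, 2 * n)}"
    by (simp only: nabla_arcs.simps n_def power_Suc)
  have "(0, n) \<in> nabla_arcs (Suc k)" by (simp add: n_def)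
  then have root_triangle: "{(0, n), (n, 2 * n), (0, 2 * n)} \<subseteq> nabla_arcs (Suc (Suc k))"
    unfolding arcs by (auto simp del: nabla_arcs.simps intro!: image_eqI[of _ _ "(0, n)"])
  have IH: "(u, v) \<in> nabla_arcs (Suc k) \<or> (v, u) \<in> nabla_arcs (Suc k)"
    if "(u, v) \<in> parcs (nabla (Suc k))" for u v
    using subsetD[OF Suc.IH that] by (simp only: symcl_iff)
  show ?case
  proof (rule subrelI)
    fix x y assume "(x, y) \<in> parcs (nabla (Suc (Suc k)))"
    then consider (left) "(x, y) \<in> parcs (nabla (Suc k))"
      | (right) u v where "(u, v) \<in> parcs (nabla (Suc k))" "x = n + u" "y = n + v"
      | (triangle) "(x, y) \<in> symcl {(0, n), (n, 2 * n), (0, 2 * n)}" unfolding nabla by auto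
    then show "(x, y) \<in> symcl (nabla_arcs (Suc (Suc k)))"
    proof cases
      case left
      then show ?thesis using IH[OF left] unfolding arcs symcl_iff by blast
    next
      case right
      have "(x, y) \<in> map_prod ((+) n) ((+) n) ` nabla_arcs (Suc k) \<or>
          (y, x) \<in> map_prod ((+) n) ((+) n) ` nabla_arcs (Suc k)"
        using IH[OF right(1)] unfolding right(2,3) by (force simp del: nabla_arcs.simps)
      then show ?thesis unfolding arcs symcl_iff by blast
    next
      case triangle
      then show ?thesis using root_triangle unfolding symcl_iff by blast
    qed
  qed
qed

lemma rooted_nabla_is_minor:
  assumes "pair_graph G" "rooted_nabla (parcs G) (Suc k) a b (pverts G)"
  shows "is_minor (nabla (Suc k)) G"
proof -
  obtain \<phi> where "minor_model (parcs G) {..2 ^ Suc k} (nabla_arcs (Suc k)) \<phi> (pverts G)"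
    using assms(2) by (auto simp: rooted_model_def)
  then have "minor_model (parcs G) (pverts (nabla (Suc k))) (nabla_arcs (Suc k)) \<phi> (pverts G)"
    unfolding verts_nabla by (simp only: atLeast0AtMost)
  then show ?thesis by (rule minor_model_is_minor[OF pair_graph_nabla assms(1) _ parcs_nabla])
qed

section \<open>Components below a tree model\<close>

definition subtree :: "(bool list \<Rightarrow> 'a set) \<Rightarrow> nat \<Rightarrow> bool list \<Rightarrow> 'a set" where
  "subtree \<psi> m v = (\<Union>u\<in>words m. \<psi> (u @ v))"

definition tree_rest :: "(bool list \<Rightarrow> 'a set) \<Rightarrow> nat \<Rightarrow> bool list \<Rightarrow> 'a set" where
  "tree_rest \<psi> m v = (\<Union>w\<in>{w \<in> words m. \<nexists>u. w = u @ v}. \<psi> w)"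

lemma subset_subtree: "length u \<le> m \<Longrightarrow> \<psi> (u @ v) \<subseteq> subtree \<psi> m v"
  by (auto simp: subtree_def)

lemma subset_tree_rest: "length w \<le> m \<Longrightarrow> \<nexists>u. w = u @ v \<Longrightarrow> \<psi> w \<subseteq> tree_rest \<psi> m v"
  by (auto simp: tree_rest_def)

lemma subtree_subset:
  assumes "tree_model E (words k) \<psi> S" "m + length v \<le> k"
  shows "subtree \<psi> m v \<subseteq> S"
  unfolding subtree_def
  by (rule UN_least, rule minor_modelD(2)[OF assms(1)]) (use assms(2) in auto)

lemma tree_rest_subset:
  assumes "tree_model E (words k) \<psi> S" "m \<le> k"
  shows "tree_rest \<psi> m v \<subseteq> S"
  unfolding tree_rest_def
  by (rule UN_least, rule minor_modelD(2)[OF assms(1)]) (use assms(2) in auto)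

lemma subtree_disjoint_tree_rest:
  assumes "tree_model E (words k) \<psi> S" "i + length v \<le> k" "m \<le> k"
  shows "subtree \<psi> i v \<inter> tree_rest \<psi> m v = {}"
proof -
  have "\<psi> (u @ v) \<inter> \<psi> w = {}" if "length u \<le> i" "length w \<le> m" "\<nexists>u. w = u @ v" for u w
    using that assms(2,3) by (intro minor_modelD(3)[OF assms(1)]) auto
  then show ?thesis unfolding subtree_def tree_rest_def by blast
qed

lemma subtree_subset_tree_rest:
  assumes "length s = length t" "s \<noteq> t" "m + length s \<le> n"
  shows "subtree \<psi> m s \<subseteq> tree_rest \<psi> n t"
  unfolding subtree_def using assms by (intro UN_least subset_tree_rest) auto

lemma tree_model_subtree:
  assumes "tree_model E (words k) \<psi> S" "m + length v \<le> k" "subtree \<psi> m v \<subseteq> T"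
  shows "tree_model E (words m) (\<lambda>u. \<psi> (u @ v)) T"
proof (rule minor_model_reindex[OF assms(1)])
  show "(\<lambda>u. u @ v) ` words m \<subseteq> words k" using assms(2) by auto
qed (use assms(3) in \<open>auto simp: inj_on_def child_arcs_def subtree_def\<close>)

lemma disjoint_family_two_avoiding:
  assumes "finite I" "disjoint_family_on C I" "finite P" "card P + 2 \<le> card I"
  obtains i j where "i \<in> I" "j \<in> I" "i \<noteq> j" "C i \<inter> P = {}" "C j \<inter> P = {}"
proof -
  define M where "M = {i \<in> I. C i \<inter> P \<noteq> {}}"
  have "card M \<le> card P" unfolding M_def using assms(2,3) by (rule card_disjoint_family_meeting)
  moreover have "card (I - M) = card I - card M"
    using assms(1) by (intro card_Diff_subset) (auto simp: M_def)
  ultimately have "\<not> card (I - M) \<le> Suc 0" using assms(4) by linarith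
  then obtain i j where "i \<in> I - M" "j \<in> I - M" "i \<noteq> j"
    using card_le_Suc0_iff_eq[of "I - M"] assms(1) by blast
  then show thesis using that by (auto simp: M_def)
qed

context undirected
begin

lemma connected_in_tree_model:
  assumes \<psi>: "tree_model E W \<psi> S" and W': "W' \<subseteq> W" "r \<in> W'"
    and parent: "\<And>w. w \<in> W' \<Longrightarrow> w \<noteq> r \<Longrightarrow> \<exists>b u. w = b # u \<and> u \<in> W'"
  shows "connected_in E (\<Union>w\<in>W'. \<psi> w)"
proof -
  define U where "U = (\<Union>w\<in>W'. \<psi> w)"
  have conn: "connected_in E (\<psi> w)" "\<psi> w \<subseteq> U" if "w \<in> W'" for w
    using minor_modelD(1)[OF \<psi>] W'(1) that by (auto simp: U_def)
  obtain x where x: "x \<in> \<psi> r" using connected_in_nonempty[OF conn(1)[OF W'(2)]] by blast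
  then obtain K where K: "component_in E U K" "x \<in> K"
    using component_in_exists[of x U] conn(2)[OF W'(2)] by blast
  have "\<psi> w \<subseteq> K" if "w \<in> W'" for w
    using that
  proof (induction "length w" arbitrary: w rule: less_induct)
    case less
    have "\<psi> w \<inter> K \<noteq> {}"
    proof (cases "w = r")
      case False
      then obtain b u where u: "w = b # u" "u \<in> W'" using parent less.prems by blast
      then have "adjacent E (\<psi> u) (\<psi> w)"
        using W'(1) less.prems by (intro minor_modelD(4)[OF \<psi>]) (auto simp: child_arcs_def)
      then obtain y z where "y \<in> \<psi> u" "z \<in> \<psi> w" "(y, z) \<in> E" by (auto simp: adjacent_def)
      moreover have "\<psi> u \<subseteq> K" using less.hyps u by simp
      ultimately have "z \<in> K"
        using K(1) conn(2)[OF less.prems] unfolding component_in_def adjacent_def by blast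
      then show ?thesis using \<open>z \<in> \<psi> w\<close> by blast
    qed (use x K(2) in blast)
    then show ?case using component_in_absorb[OF K(1)] conn[OF less.prems] by blast
  qed
  then have "K = U" using K(1) by (auto simp: component_in_def U_def)
  then show ?thesis using K(1) by (simp add: component_in_def U_def)
qed

lemma connected_in_subtree:
  assumes "tree_model E (words k) \<psi> S" "m + length v \<le> k"
  shows "connected_in E (subtree \<psi> m v)"
proof -
  have "connected_in E (\<Union>w\<in>(\<lambda>u. u @ v) ` words m. \<psi> w)"
  proof (rule connected_in_tree_model[OF assms(1), of _ v])
    show "v \<in> (\<lambda>u. u @ v) ` words m" by (auto intro: image_eqI[of _ _ "[]"])
    fix w assume "w \<in> (\<lambda>u. u @ v) ` words m" "w \<noteq> v"
    then obtain u where "w = u @ v" "length u \<le> m" "u \<noteq> []" by auto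
    then show "\<exists>b u. w = b # u \<and> u \<in> (\<lambda>u. u @ v) ` words m" by (cases u) auto
  qed (use assms in auto)
  then show ?thesis by (simp add: subtree_def)
qed

lemma connected_in_tree_rest:
  assumes "tree_model E (words k) \<psi> S" "m \<le> k" "v \<noteq> []"
  shows "connected_in E (tree_rest \<psi> m v)"
  unfolding tree_rest_def
proof (rule connected_in_tree_model[OF assms(1), of _ "[]"])
  fix w assume w: "w \<in> {w \<in> words m. \<nexists>u. w = u @ v}" "w \<noteq> []"
  then obtain b u where bu: "w = b # u" by (cases w) auto
  have "u \<noteq> u' @ v" for u'
  proof
    assume "u = u' @ v"
    then have "w = (b # u') @ v" using bu by simp
    with w(1) show False by blast
  qed
  with w(1) bu show "\<exists>b u. w = b # u \<and> u \<in> {w \<in> words m. \<nexists>u. w = u @ v}" by auto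
qed (use assms in auto)

text \<open>The components and the rest of the top levels are contracted to the apex.\<close>

lemma Gamma_plus_model_from_components:
  assumes \<psi>: "tree_model E (words k) \<psi> S" and k: "l + length v \<le> k" and "v \<noteq> []"
    and K: "\<And>u. length u = l \<Longrightarrow> component_in E (S - subtree \<psi> (l + length v) []) (K u)"
      "\<And>u. length u = l \<Longrightarrow> adjacent E (\<psi> (u @ v)) (K u)"
      "\<And>u. length u = l \<Longrightarrow> adjacent E (K u) (tree_rest \<psi> (l + length v) v)"
  shows "Gamma_plus_model E l S"
proof (rule Gamma_plus_modelI)
  define Q where "Q = tree_rest \<psi> (l + length v) v \<union> (\<Union>u\<in>{u. length u = l}. K u)"
  show "tree_model E (words l) (\<lambda>u. \<psi> (u @ v)) S"
    using k by (intro tree_model_subtree[OF \<psi>] subtree_subset[OF \<psi>]) auto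
  show "connected_in E Q"
    unfolding Q_def using K adjacent_sym
    by (intro connected_in_UN connected_in_tree_rest[OF \<psi> k \<open>v \<noteq> []\<close>]) (auto simp: component_in_def)
  show "Q \<subseteq> S" using K(1) tree_rest_subset[OF \<psi> k] by (auto simp: Q_def component_in_def)
  show "\<psi> (w @ v) \<inter> Q = {}" if w: "length w \<le> l" for w
  proof -
    have "\<psi> (w @ v) \<subseteq> subtree \<psi> (l + length v) []"
      using subset_subtree[of "w @ v" "l + length v" \<psi> "[]"] w by simp
    then have "\<psi> (w @ v) \<inter> K u = {}" if "length u = l" for u
      using K(1)[OF that] by (auto simp: component_in_def)
    moreover have "\<psi> (w @ v) \<inter> tree_rest \<psi> (l + length v) v = {}"
      using subtree_disjoint_tree_rest[OF \<psi> k k] subset_subtree[OF w, of \<psi> v] by blast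
    ultimately show ?thesis by (auto simp: Q_def)
  qed
  show "adjacent E (\<psi> (w @ v)) Q" if "length w = l" for w
    using K(2)[OF that] by (rule adjacent_mono) (use that in \<open>auto simp: Q_def\<close>)
qed

lemma component_below_avoiding_rest:
  assumes \<psi>: "tree_model E (words k) \<psi> S" and k: "l + length v < k" and "v \<noteq> []"
    and no_model: "\<not> Gamma_plus_model E l S"
  obtains u K \<chi> where "length u = l" "component_in E (S - subtree \<psi> (l + length v) []) K"
    "adjacent E (\<psi> (u @ v)) K" "\<not> adjacent E K (tree_rest \<psi> (l + length v) v)"
    "tree_model E (words (k - l - length v - 1)) \<chi> K"
proof -
  define m where "m = l + length v"
  define N where "N u = False # u @ v" for u
  define T where "T u = subtree \<psi> (k - m - 1) (N u)" for u
  have len: "k - m - 1 + length (N u) \<le> k" if "length u = l" for u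
    using that k by (simp add: N_def m_def)
  have T: "connected_in E (T u)" "\<psi> (N u) \<subseteq> T u" "T u \<subseteq> S - subtree \<psi> m []" if "length u = l" for u
  proof -
    show "connected_in E (T u)" unfolding T_def by (rule connected_in_subtree[OF \<psi> len[OF that]])
    show "\<psi> (N u) \<subseteq> T u" unfolding T_def using subset_subtree[of "[]"] by simp
    have "\<psi> (w @ N u) \<inter> \<psi> w' = {}" if "length w \<le> k - m - 1" "length w' \<le> m" for w w'
      using that \<open>length u = l\<close> k by (intro minor_modelD(3)[OF \<psi>]) (auto simp: N_def m_def)
    then have "T u \<inter> subtree \<psi> m [] = {}" unfolding T_def subtree_def by auto
    then show "T u \<subseteq> S - subtree \<psi> m []"
      using subtree_subset[OF \<psi> len[OF that]] unfolding T_def by blast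
  qed
  have "\<exists>K. component_in E (S - subtree \<psi> m []) K \<and> T u \<subseteq> K" if u: "length u = l" for u
  proof -
    obtain x where "x \<in> T u" using connected_in_nonempty[OF T(1)[OF u]] by blast
    then obtain K where "component_in E (S - subtree \<psi> m []) K" "x \<in> K"
      using component_in_exists T(3)[OF u] by (metis subsetD)
    then show ?thesis using component_in_absorb T(1,3)[OF u] \<open>x \<in> T u\<close> by blast
  qed
  then obtain K where K: "\<And>u. length u = l \<Longrightarrow> component_in E (S - subtree \<psi> m []) (K u)"
    "\<And>u. length u = l \<Longrightarrow> T u \<subseteq> K u" by metis
  have adj: "adjacent E (\<psi> (u @ v)) (K u)" if "length u = l" for u
  proof -
    have "adjacent E (\<psi> (u @ v)) (\<psi> (N u))"
      using that k by (intro minor_modelD(4)[OF \<psi>]) (auto simp: N_def child_arcs_def)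
    then show ?thesis by (rule adjacent_mono) (use T(2) K(2) that in auto)
  qed
  obtain u where u: "length u = l" "\<not> adjacent E (K u) (tree_rest \<psi> m v)"
    using Gamma_plus_model_from_components[OF \<psi> _ \<open>v \<noteq> []\<close>, of l K] K(1) adj no_model k
    unfolding m_def by fastforce
  have "tree_model E (words (k - m - 1)) (\<lambda>w. \<psi> (w @ N u)) (K u)"
    using K(2)[OF u(1)] len[OF u(1)] unfolding T_def by (intro tree_model_subtree[OF \<psi>]) auto
  then show thesis using that[OF u(1)] K(1)[OF u(1)] adj[OF u(1)] u(2) by (simp add: m_def)
qed

lemma disjoint_components_below:
  assumes K: "\<And>v. length v = d \<Longrightarrow> component_in E T (K v)"
      "\<And>v. length v = d \<Longrightarrow> \<not> adjacent E (K v) (tree_rest \<psi> (l + d) v)"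
    and u: "\<And>v. length v = d \<Longrightarrow> length (u v) = l"
      "\<And>v. length v = d \<Longrightarrow> adjacent E (\<psi> (u v @ v)) (K v)"
  shows "disjoint_family_on K {v. length v = d}"
  unfolding disjoint_family_on_def
proof (intro ballI impI, rule ccontr)
  fix v v' assume v: "v \<in> {v. length v = d}" "v' \<in> {v. length v = d}" "v \<noteq> v'" "K v \<inter> K v' \<noteq> {}"
  then have "K v = K v'" using K(1)[of v] K(1)[of v'] by (intro component_in_eq[of E T]) auto
  then have "adjacent E (K v) (\<psi> (u v' @ v'))" using u(2) v(2) adjacent_sym by auto
  moreover have "\<psi> (u v' @ v') \<subseteq> tree_rest \<psi> (l + d) v"
    using u(1)[of v'] v(1-3) by (intro subset_tree_rest) auto
  ultimately have "adjacent E (K v) (tree_rest \<psi> (l + d) v)" using adjacent_mono by blast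
  then show False using K(2) v(1) by simp
qed

lemma two_components_with_tree_models:
  assumes \<psi>: "tree_model E (words k) \<psi> S" and k: "l + 3 \<le> k"
    and no_model: "\<not> Gamma_plus_model E l S"
  obtains X K1 K2 \<chi>1 \<chi>2 where "connected_in E X" "X \<subseteq> S" "component_in E (S - X) K1"
    "component_in E (S - X) K2" "K1 \<inter> K2 = {}" "{a, b} \<inter> (K1 \<union> K2) = {}"
    "tree_model E (words (k - l - 3)) \<chi>1 K1" "tree_model E (words (k - l - 3)) \<chi>2 K2"
proof -
  define X where "X = subtree \<psi> (l + 2) []"
  define P where "P v u K \<chi> \<longleftrightarrow> length u = l \<and> component_in E (S - X) K \<and> adjacent E (\<psi> (u @ v)) K \<and>
      \<not> adjacent E K (tree_rest \<psi> (l + 2) v) \<and> tree_model E (words (k - l - 3)) \<chi> K" for v u K \<chi>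
  have "\<exists>u K \<chi>. P v u K \<chi>" if v: "length v = 2" for v
  proof -
    have "v \<noteq> []" "l + length v < k" using v k by auto
    then obtain u K \<chi> where "length u = l" "component_in E (S - X) K" "adjacent E (\<psi> (u @ v)) K"
      "\<not> adjacent E K (tree_rest \<psi> (l + 2) v)" "tree_model E (words (k - l - 2 - 1)) \<chi> K"
      using component_below_avoiding_rest[OF \<psi> _ _ no_model, of v] unfolding v X_def by blast
    moreover have "k - l - 2 - 1 = k - l - 3" by simp
    ultimately have "P v u K \<chi>" unfolding P_def by metis
    then show ?thesis by blast
  qed
  then obtain u K \<chi> where "\<And>v. length v = 2 \<Longrightarrow> P v (u v) (K v) (\<chi> v)" by metis
  note K = this[unfolded P_def]
  have disjoint: "disjoint_family_on K {v. length v = 2}"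
    by (rule disjoint_components_below[of 2 "S - X" K \<psi> l u]) (use K in auto)
  have "finite {v :: bool list. length v = 2}" "card {v :: bool list. length v = 2} = 4"
    using finite_lists_length_eq[of "UNIV :: bool set" 2]
      card_lists_length_eq[of "UNIV :: bool set" 2]
    by simp_all
  moreover have "card {a, b} \<le> 2" by (simp add: card_insert_if)
  ultimately obtain v v' where v: "length v = 2" "length v' = 2" "v \<noteq> v'" "K v \<inter> {a, b} = {}"
    "K v' \<inter> {a, b} = {}"
    using disjoint_family_two_avoiding[OF _ disjoint, of "{a, b}"] by auto
  show thesis
  proof (rule that[of X "K v" "K v'" "\<chi> v" "\<chi> v'"])
    show "connected_in E X" unfolding X_def using k by (intro connected_in_subtree[OF \<psi>]) simp
    show "X \<subseteq> S" unfolding X_def using k by (intro subtree_subset[OF \<psi>]) simp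
    show "K v \<inter> K v' = {}" using disjoint_family_onD[OF disjoint] v(1-3) by simp
  qed (use K v in auto)
qed

end

section \<open>Blocks containing large tree models\<close>

context undirected
begin

text \<open>The map that fixes \<^term>\<open>J\<close> and sends everything else to \<^term>\<open>c\<close> preserves connectedness.\<close>

lemma connected_in_insert_component:
  assumes J: "component_in E (K - {c}) J" and "connected_in E (K - D)" "c \<in> K - D"
  shows "connected_in E (insert c J - D)"
proof -
  define g where "g v = (if v \<in> J then v else c)" for v
  have leave: "y = c" if "x \<in> J" "y \<in> K" "y \<notin> J" "(x, y) \<in> E" for x y
    using J that unfolding component_in_def adjacent_def by blast
  have "connected_in E (g ` (K - D))"
  proof (rule connected_in_image[OF assms(2)])
    fix x y assume "x \<in> K - D" "y \<in> K - D" "(x, y) \<in> E"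
    then show "g x = g y \<or> (g x, g y) \<in> E"
      using leave[of x y] leave[of y x] edge_sym[of x y] by (auto simp: g_def)
  qed
  moreover have "J \<subseteq> K - {c}" using J by (simp add: component_in_def)
  then have "g ` (K - D) = insert c J - D" using assms(3) by (auto simp: g_def image_iff)
  ultimately show ?thesis by simp
qed

lemma biconnected_in_superset_exists:
  assumes "finite K" "connected_in E K" "T \<subseteq> K" "connected_in E T"
    and "\<And>c. c \<in> T \<Longrightarrow> connected_in E (K - {c})"
  shows "\<exists>B. T \<subseteq> B \<and> B \<subseteq> K \<and> biconnected_in E B"
  using assms
proof (induction "card K" arbitrary: K rule: less_induct)
  case less
  show ?case
  proof (cases "\<forall>c\<in>K. connected_in E (K - {c})")
    case True
    then have "connected_in E (K - {c})" for c using less.prems(2) by (cases "c \<in> K") auto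
    then show ?thesis using less.prems(2,3) by (auto simp: biconnected_in_def)
  next
    case False
    then obtain c where c: "c \<in> K" "\<not> connected_in E (K - {c})" by blast
    have T: "T \<subseteq> K - {c}" using c(2) less.prems(3,5) by blast
    obtain x where x: "x \<in> T" using connected_in_nonempty[OF less.prems(4)] by blast
    then obtain J where J: "component_in E (K - {c}) J" "x \<in> J" using component_in_exists T by blast
    have "T \<subseteq> J" using component_in_absorb[OF J(1) less.prems(4) T] x J(2) by blast
    have "J \<subseteq> K - {c}" "J \<noteq> K - {c}" using J(1) c(2) by (auto simp: component_in_def)
    then have smaller: "insert c J \<subseteq> K" "insert c J \<noteq> K" using c(1) by auto
    have "\<exists>B. T \<subseteq> B \<and> B \<subseteq> insert c J \<and> biconnected_in E B"
    proof (rule less.hyps)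
      show "card (insert c J) < card K"
        using smaller by (intro psubset_card_mono[OF less.prems(1)]) blast
      show "finite (insert c J)" using smaller(1) less.prems(1) by (rule finite_subset)
      show "connected_in E (insert c J)"
        using connected_in_insert_component[OF J(1), of "{}"] less.prems(2) c(1) by simp
      show "connected_in E (insert c J - {s})" if "s \<in> T" for s
        by (rule connected_in_insert_component[OF J(1) less.prems(5)[OF that]])
          (use c(1) T that in auto)
    qed (use \<open>T \<subseteq> J\<close> less.prems(4) in auto)
    then show ?thesis using smaller(1) by (meson subset_trans)
  qed
qed

lemma cutvertex_component_avoiding:
  assumes "\<not> connected_in E (K - {c})" "connected_in E R" "R \<subseteq> K - {c}"
  obtains J where "component_in E (K - {c}) J" "J \<inter> R = {}"
proof -
  obtain x where x: "x \<in> R" using connected_in_nonempty[OF assms(2)] by blast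
  then obtain L where L: "component_in E (K - {c}) L" "x \<in> L"
    using component_in_exists assms(3) by blast
  have "R \<subseteq> L" using component_in_absorb[OF L(1) assms(2,3)] x L(2) by blast
  have "L \<subseteq> K - {c}" "L \<noteq> K - {c}" using L(1) assms(1) by (auto simp: component_in_def)
  then obtain z where z: "z \<in> K - {c}" "z \<notin> L" by blast
  then obtain J where J: "component_in E (K - {c}) J" "z \<in> J"
    using component_in_exists[OF z(1)] by blast
  then have "J \<inter> L = {}" using component_in_eq[OF J(1) L(1)] z(2) by blast
  then show thesis using that J(1) \<open>R \<subseteq> L\<close> by blast
qed

lemma component_adjacent_cutvertex:
  assumes "connected_in E K" "c \<in> K" "component_in E (K - {c}) J"
  shows "adjacent E J {c}"
proof -
  have J: "J \<subseteq> K - {c}" "\<not> adjacent E J (K - {c} - J)" "J \<noteq> {}"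
    using assms(3) connected_in_nonempty by (auto simp: component_in_def)
  then have "adjacent E J (K - J)" using assms(1,2) by (intro connected_in_cut) auto
  then show ?thesis using J(2) unfolding adjacent_def by blast
qed

lemma cutvertex_components_disjoint:
  assumes K: "connected_in E K" "c \<in> K" "c' \<in> K" "c \<noteq> c'"
    and J: "component_in E (K - {c}) J" "c' \<notin> J" and J': "component_in E (K - {c'}) J'" "c \<notin> J'"
  shows "J \<inter> J' = {}"
proof (rule ccontr)
  assume meet: "J \<inter> J' \<noteq> {}"
  have "connected_in E J" "J \<subseteq> K - {c'}" "connected_in E J'" "J' \<subseteq> K - {c}"
    using J J' by (auto simp: component_in_def)
  then have "J = J'"
    using component_in_absorb[OF J(1), of J'] component_in_absorb[OF J'(1), of J] meet by blast
  moreover have "adjacent E J {c}" by (rule component_adjacent_cutvertex[OF K(1,2) J(1)])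
  ultimately have "adjacent E J' {c}" by simp
  then have "adjacent E J' (K - {c'} - J')" by (rule adjacent_mono) (use K(2,4) J'(2) in auto)
  then show False using J'(1) by (simp add: component_in_def)
qed

lemma cutvertex_component_adjacent:
  assumes S: "biconnected_in E S" "X \<subseteq> S" "X \<noteq> {}" and K: "component_in E (S - X) K"
    and J: "component_in E (K - {c}) J" and "c \<in> K"
  shows "adjacent E J X"
proof -
  have sub: "K \<subseteq> S - X" "J \<subseteq> K - {c}" "J \<noteq> {}"
    using K J connected_in_nonempty by (auto simp: component_in_def)
  have "adjacent E J (S - {c} - J)"
  proof (rule connected_in_cut)
    show "connected_in E (S - {c})" using S(1) by (simp add: biconnected_in_def)
    show "J \<noteq> S - {c}" using sub S(2,3) \<open>c \<in> K\<close> by blast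
  qed (use sub in auto)
  then obtain u v where uv: "u \<in> J" "v \<in> S - {c} - J" "(u, v) \<in> E" by (auto simp: adjacent_def)
  have "v \<in> X"
  proof (rule ccontr)
    assume "v \<notin> X"
    then have "v \<in> K" using K uv sub(2) unfolding component_in_def adjacent_def by blast
    then show False using J uv unfolding component_in_def adjacent_def by blast
  qed
  then show ?thesis using uv by (auto simp: adjacent_def)
qed

lemma cutvertex_components_exist:
  assumes \<psi>: "tree_model E (words n) \<psi> K" and K: "connected_in E K" and l: "1 \<le> l" "l \<le> n"
    and c: "\<And>t. length t = l \<Longrightarrow> c t \<in> subtree \<psi> (n - l) t"
      "\<And>t. length t = l \<Longrightarrow> \<not> connected_in E (K - {c t})"
  obtains J where "\<And>t. length t = l \<Longrightarrow> component_in E (K - {c t}) (J t)"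
    "\<And>t. length t = l \<Longrightarrow> J t \<inter> tree_rest \<psi> n t = {}"
    "\<And>s t. length s = l \<Longrightarrow> length t = l \<Longrightarrow> s \<noteq> t \<Longrightarrow> J s \<inter> J t = {}"
proof -
  have rest: "connected_in E (tree_rest \<psi> n t)" "tree_rest \<psi> n t \<subseteq> K"
    if "length t = l" for t
    using that l by (auto intro!: connected_in_tree_rest[OF \<psi>] tree_rest_subset[OF \<psi>])
  have cK: "c t \<in> K" "c t \<notin> tree_rest \<psi> n t" if t: "length t = l" for t
    using c(1)[OF t] t l subtree_subset[OF \<psi>, of "n - l" t]
      subtree_disjoint_tree_rest[OF \<psi>, of "n - l" t n] by auto
  have "\<exists>J. component_in E (K - {c t}) J \<and> J \<inter> tree_rest \<psi> n t = {}" if t: "length t = l" for t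
    using cutvertex_component_avoiding[OF c(2)[OF t] rest(1)[OF t]] rest(2)[OF t] cK[OF t] by blast
  then obtain J where J: "\<And>t. length t = l \<Longrightarrow> component_in E (K - {c t}) (J t)"
    "\<And>t. length t = l \<Longrightarrow> J t \<inter> tree_rest \<psi> n t = {}" by metis
  have "J s \<inter> J t = {}" if st: "length s = l" "length t = l" "s \<noteq> t" for s t
  proof (rule cutvertex_components_disjoint[OF K cK(1)[OF st(1)] cK(1)[OF st(2)]])
    have "c u \<in> tree_rest \<psi> n v" if "length u = l" "length v = l" "u \<noteq> v" for u v
      using c(1)[OF that(1)] subtree_subset_tree_rest[of u v "n - l" n \<psi>] that l by auto
    from this[of s t] this[of t s] have "c s \<in> tree_rest \<psi> n t" "c t \<in> tree_rest \<psi> n s"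
      using st by simp_all
    then show "c s \<noteq> c t" "c t \<notin> J s" "c s \<notin> J t" using cK(2)[OF st(2)] J(2) st(1,2) by auto
  qed (use J(1) st in auto)
  with J show thesis by (rule that)
qed

lemma tree_model_enlarge_leaves:
  assumes \<psi>: "tree_model E (words n) \<psi> K" and "l \<le> n"
    and F: "\<And>t. length t = l \<Longrightarrow> connected_in E (F t)" "\<And>t. length t = l \<Longrightarrow> \<psi> t \<subseteq> F t"
      "\<And>t. length t = l \<Longrightarrow> F t \<subseteq> K"
    and inner: "\<And>w t. length w < l \<Longrightarrow> length t = l \<Longrightarrow> \<psi> w \<inter> F t = {}"
    and disjoint: "\<And>s t. length s = l \<Longrightarrow> length t = l \<Longrightarrow> s \<noteq> t \<Longrightarrow> F s \<inter> F t = {}"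
  shows "tree_model E (words l) (\<lambda>u. if length u < l then \<psi> u else F u) K"
proof (rule minor_model_enlarge)
  show "tree_model E (words l) \<psi> K" using \<psi> by (rule minor_model_subset) (use \<open>l \<le> n\<close> in auto)
next
  fix u :: "bool list" assume "u \<in> words l"
  then have "length u < l \<or> length u = l" "u \<in> words n" using \<open>l \<le> n\<close> by auto
  then show "connected_in E (if length u < l then \<psi> u else F u)"
    "\<psi> u \<subseteq> (if length u < l then \<psi> u else F u)" "(if length u < l then \<psi> u else F u) \<subseteq> K"
    using F[of u] minor_modelD(1,2)[OF \<psi>, of u] by auto
next
  fix u v :: "bool list" assume uv: "u \<in> words l" "v \<in> words l" "u \<noteq> v"
  then have "\<psi> u \<inter> \<psi> v = {}" using \<open>l \<le> n\<close> by (intro minor_modelD(3)[OF \<psi>]) auto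
  then show "(if length u < l then \<psi> u else F u) \<inter> (if length v < l then \<psi> v else F v) = {}"
    using uv inner[of u v] inner[of v u] disjoint[of u v] by (auto simp: Int_commute)
qed

lemma tree_model_absorb_at_leaves:
  assumes \<psi>: "tree_model E (words n) \<psi> K" and l: "1 \<le> l" "l \<le> n"
    and J: "\<And>t. length t = l \<Longrightarrow> connected_in E (J t)" "\<And>t. length t = l \<Longrightarrow> J t \<subseteq> K"
      "\<And>t. length t = l \<Longrightarrow> adjacent E (subtree \<psi> (n - l) t) (J t)"
      "\<And>t. length t = l \<Longrightarrow> J t \<inter> tree_rest \<psi> n t = {}"
      "\<And>s t. length s = l \<Longrightarrow> length t = l \<Longrightarrow> s \<noteq> t \<Longrightarrow> J s \<inter> J t = {}"
  shows "tree_model E (words l) (\<lambda>u. if length u < l then \<psi> u else subtree \<psi> (n - l) u \<union> J u) K"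
proof (rule tree_model_enlarge_leaves[OF \<psi> l(2)])
  fix t :: "bool list" assume t: "length t = l"
  have subtree: "subtree \<psi> (n - l) t \<subseteq> K" "connected_in E (subtree \<psi> (n - l) t)"
    "subtree \<psi> (n - l) t \<inter> tree_rest \<psi> n t = {}"
    using t l subtree_subset[OF \<psi>] connected_in_subtree[OF \<psi>] subtree_disjoint_tree_rest[OF \<psi>]
    by auto
  show "connected_in E (subtree \<psi> (n - l) t \<union> J t)"
    using subtree(2) J(1,3)[OF t] by (rule connected_in_Un_adjacent)
  show "\<psi> t \<subseteq> subtree \<psi> (n - l) t \<union> J t" using subset_subtree[of "[]" _ \<psi> t] by auto
  show "subtree \<psi> (n - l) t \<union> J t \<subseteq> K" using subtree(1) J(2)[OF t] by blast
  show "\<psi> w \<inter> (subtree \<psi> (n - l) t \<union> J t) = {}" if w: "length w < l" for w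
  proof -
    have "\<psi> w \<subseteq> tree_rest \<psi> n t" using w t l by (intro subset_tree_rest) auto
    then show ?thesis using subtree(3) J(4)[OF t] by blast
  qed
  show "(subtree \<psi> (n - l) s \<union> J s) \<inter> (subtree \<psi> (n - l) t \<union> J t) = {}"
    if s: "length s = l" "s \<noteq> t" for s
  proof -
    have "subtree \<psi> (n - l) s \<subseteq> tree_rest \<psi> n t" "subtree \<psi> (n - l) t \<subseteq> tree_rest \<psi> n s"
      by (rule subtree_subset_tree_rest; use s t l in simp)+
    then show ?thesis using subtree(3) J(4)[OF t] J(4)[OF s(1)] J(5)[OF s(1) t s(2)] by blast
  qed
qed

text \<open>
  A cutvertex of \<^term>\<open>K\<close> below \<^term>\<open>t\<close> cuts off a part of \<^term>\<open>K\<close> that can be added to the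
  branch set of the leaf \<^term>\<open>t\<close> and has a neighbour in \<^term>\<open>X\<close>; contracting \<^term>\<open>X\<close> gives
  the apex.
\<close>

lemma Gamma_plus_model_from_cutvertices:
  assumes S: "biconnected_in E S" and X: "connected_in E X" "X \<subseteq> S"
    and K: "component_in E (S - X) K"
    and \<psi>: "tree_model E (words n) \<psi> K" and l: "1 \<le> l" "l \<le> n"
    and c: "\<And>t. length t = l \<Longrightarrow> c t \<in> subtree \<psi> (n - l) t"
      "\<And>t. length t = l \<Longrightarrow> \<not> connected_in E (K - {c t})"
  shows "Gamma_plus_model E l S"
proof -
  have KS: "connected_in E K" "K \<subseteq> S - X" using K by (auto simp: component_in_def)
  obtain J where J: "\<And>t. length t = l \<Longrightarrow> component_in E (K - {c t}) (J t)"
    "\<And>t. length t = l \<Longrightarrow> J t \<inter> tree_rest \<psi> n t = {}"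
    "\<And>s t. length s = l \<Longrightarrow> length t = l \<Longrightarrow> s \<noteq> t \<Longrightarrow> J s \<inter> J t = {}"
    using cutvertex_components_exist[OF \<psi> KS(1) l c] by blast
  have cK: "c t \<in> K" if "length t = l" for t
    using c(1)[OF that] subtree_subset[OF \<psi>, of "n - l" t] that l by auto
  define \<chi> where "\<chi> u = (if length u < l then \<psi> u else subtree \<psi> (n - l) u \<union> J u)" for u
  have model: "tree_model E (words l) \<chi> K"
    unfolding \<chi>_def
  proof (rule tree_model_absorb_at_leaves[OF \<psi> l _ _ _ J(2,3)])
    fix t :: "bool list" assume t: "length t = l"
    show "connected_in E (J t)" "J t \<subseteq> K" using J(1)[OF t] by (auto simp: component_in_def)
    have "adjacent E {c t} (J t)"
      using component_adjacent_cutvertex[OF KS(1) cK[OF t] J(1)[OF t]] by (rule adjacent_sym)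
    then show "adjacent E (subtree \<psi> (n - l) t) (J t)"
      by (rule adjacent_mono) (use c(1)[OF t] in auto)
  qed
  have "adjacent E (\<chi> t) X" if t: "length t = l" for t
  proof -
    have "adjacent E (J t) X"
      using J(1)[OF t] cK[OF t]
      by (rule cutvertex_component_adjacent[OF S X(2) connected_in_nonempty[OF X(1)] K])
    then show ?thesis by (rule adjacent_mono) (use t in \<open>auto simp: \<chi>_def\<close>)
  qed
  moreover have "\<chi> u \<inter> X = {}" if "length u \<le> l" for u
    using minor_modelD(2)[OF model, of u] that KS(2) by blast
  moreover have "tree_model E (words l) \<chi> S"
    using model by (rule minor_model_mono) (use KS(2) in blast)
  ultimately show ?thesis using X by (intro Gamma_plus_modelI)
qed

lemma block_with_tree_model:
  assumes S: "finite S" "biconnected_in E S" and X: "connected_in E X" "X \<subseteq> S"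
    and K: "component_in E (S - X) K" and \<psi>: "tree_model E (words n) \<psi> K"
    and l: "1 \<le> l" "l \<le> n" and no_model: "\<not> Gamma_plus_model E l S"
  obtains B \<chi> where "B \<subseteq> K" "biconnected_in E B" "tree_model E (words (n - l)) \<chi> B"
proof -
  have KS: "connected_in E K" "K \<subseteq> S - X" using K by (auto simp: component_in_def)
  then have "finite K" using S(1) finite_subset by blast
  obtain t where t: "length t = l" "\<And>c. c \<in> subtree \<psi> (n - l) t \<Longrightarrow> connected_in E (K - {c})"
    using Gamma_plus_model_from_cutvertices[OF S(2) X K \<psi> l] no_model by metis
  have tn: "n - l + length t \<le> n" using t(1) l(2) by simp
  obtain B where B: "subtree \<psi> (n - l) t \<subseteq> B" "B \<subseteq> K" "biconnected_in E B"
    using biconnected_in_superset_exists[OF \<open>finite K\<close> KS(1) subtree_subset[OF \<psi> tn]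
        connected_in_subtree[OF \<psi> tn] t(2)] by blast
  then show thesis using that tree_model_subtree[OF \<psi> tn B(1)] by blast
qed

end

section \<open>Linking two blocks\<close>

definition series_link :: "('a \<times> 'a) set \<Rightarrow> 'a set \<Rightarrow> 'a set \<Rightarrow> 'a set \<Rightarrow> 'a \<Rightarrow> 'a \<Rightarrow> bool" where
  "series_link E S B1 B2 a b \<longleftrightarrow>
     (\<exists>p1 p2 q1 q2 A C D. series_connectors E S B1 B2 p1 p2 q1 q2 A C D \<and> a \<in> A \<and> b \<in> D)"

definition parallel_link :: "('a \<times> 'a) set \<Rightarrow> 'a set \<Rightarrow> 'a set \<Rightarrow> 'a set \<Rightarrow> 'a \<Rightarrow> 'a \<Rightarrow> bool" where
  "parallel_link E S B1 B2 a b \<longleftrightarrow>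
     (\<exists>p1 p2 q1 q2 R Q. parallel_connectors E S B1 B2 p1 p2 q1 q2 R Q \<and> a \<in> R \<and> b \<in> Q)"

definition linked :: "('a \<times> 'a) set \<Rightarrow> 'a set \<Rightarrow> 'a set \<Rightarrow> 'a set \<Rightarrow> 'a \<Rightarrow> 'a \<Rightarrow> bool" where
  "linked E S B1 B2 a b \<longleftrightarrow> series_link E S B1 B2 a b \<or> series_link E S B2 B1 a b \<or>
     parallel_link E S B1 B2 a b \<or> parallel_link E S B1 B2 b a"

definition attached :: "('a \<times> 'a) set \<Rightarrow> 'a set \<Rightarrow> 'a set \<Rightarrow> 'a \<Rightarrow> 'a \<Rightarrow> 'a set \<Rightarrow> bool" where
  "attached E S W a x T \<longleftrightarrow> connected_in E T \<and> T \<subseteq> S \<and> a \<in> T \<and> T \<inter> W = {x}"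

definition tail_attached :: "('a \<times> 'a) set \<Rightarrow> 'a set \<Rightarrow> 'a set \<Rightarrow> 'a \<Rightarrow> 'a \<Rightarrow> 'a set \<Rightarrow> bool" where
  "tail_attached E S W a x T \<longleftrightarrow> attached E S W a x T \<and> (a \<noteq> x \<longrightarrow> connected_in E (T - {x}))"

lemma attachedD:
  assumes "attached E S W a x T"
  shows "connected_in E T" "T \<subseteq> S" "a \<in> T" "x \<in> T" "x \<in> W" "v \<in> T \<Longrightarrow> v \<in> W \<Longrightarrow> v = x"
  using assms by (auto simp: attached_def)

lemma path_in_interior:
  assumes "path_in E S p" "x \<in> set p" "x \<noteq> hd p" "x \<noteq> last p"
  obtains m where "p = hd p # m @ [last p]" "x \<in> set m"
proof -
  obtain h r where p: "p = h # r" using path_inD(1)[OF assms(1)] by (cases p) auto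
  then have "r \<noteq> []" using assms(2,3) by auto
  then have "r = butlast r @ [last r]" "last p = last r" using p by simp_all
  then have "p = hd p # butlast r @ [last p]" using p by simp
  moreover from this have "x \<in> set (butlast r)"
    using assms(2-4) by (metis Un_iff empty_iff insert_iff list.set(1,2) set_append)
  ultimately show thesis by (rule that)
qed

lemma component_in_exit:
  assumes "component_in E (S - X) K" "connected_in E T" "T \<subseteq> S" "T \<inter> K \<noteq> {}" "\<not> T \<subseteq> K"
  shows "T \<inter> X \<noteq> {}"
  using component_in_absorb[OF assms(1,2) _ assms(4)] assms(3,5) by blast

context undirected
begin

lemma path_in_minus_last:
  assumes "path_in E S p" "hd p \<noteq> last p"
  shows "connected_in E (set p - {last p})" "adjacent E (set p - {last p}) {last p}"
proof -
  have p: "p = butlast p @ [last p]" using path_inD(1)[OF assms(1)] by simp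
  then have ne: "butlast p \<noteq> []" using assms(2) by (metis append_Nil list.sel(1))
  have path: "path_in E S (butlast p @ [last p])" using assms(1) p by simp
  have set: "set p - {last p} = set (butlast p)"
    using path_in_appendD(3)[OF path] arg_cong[OF p, of set] by auto
  show "connected_in E (set p - {last p})"
    unfolding set using path_in_appendD(1)[OF path ne] by (rule connected_in_path_set)
  show "adjacent E (set p - {last p}) {last p}"
    unfolding set adjacent_def using path_in_appendD(4)[OF path ne] last_in_set[OF ne] by auto
qed

lemma tail_of_path:
  assumes "path_in E S p" "set p \<inter> W = {last p}"
  shows "tail_attached E S W (hd p) (last p) (set p)"
  using assms path_inD[OF assms(1)] connected_in_path_set path_in_minus_last
  by (simp add: tail_attached_def attached_def)

lemma attached_extend:
  assumes "attached E S W a x T" "path_in E S p" "hd p \<in> T" "hd p \<noteq> last p" "set p \<inter> W \<subseteq> {last p}"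
  shows "attached E S W a x (T \<union> (set p - {last p}))"
  unfolding attached_def
proof (intro conjI)
  note T = attachedD[OF assms(1)]
  have "connected_in E (set p - {last p})" by (rule path_in_minus_last(1)[OF assms(2,4)])
  then show "connected_in E (T \<union> (set p - {last p}))"
    using T(1) path_inD(5)[OF assms(2)] assms(3,4) by (intro connected_in_Un) auto
  show "(T \<union> (set p - {last p})) \<inter> W = {x}" using T(4-6) assms(5) by blast
  show "T \<union> (set p - {last p}) \<subseteq> S" "a \<in> T \<union> (set p - {last p})"
    using T(2,3) path_inD(3)[OF assms(2)] by auto
qed

lemma attached_reroute:
  assumes T: "tail_attached E S W a x T" "a \<noteq> x"
    and p: "path_in E S p" "set p \<inter> T \<noteq> {}" "x \<notin> set p" "set p \<inter> W = {last p}"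
  shows "attached E S W a (last p) ((T - {x}) \<union> set p)"
proof -
  have "connected_in E (T - {x} \<union> set p)"
    using T p connected_in_path_set[OF p(1)]
    by (intro connected_in_Un) (auto simp: tail_attached_def)
  moreover have "(T - {x} \<union> set p) \<inter> W = {last p}"
    using T(1) p(4) by (auto simp: tail_attached_def attached_def)
  ultimately show ?thesis
    using T path_inD(3)[OF p(1)] by (auto simp: tail_attached_def attached_def)
qed

lemma series_link_commute: "series_link E S B1 B2 a b \<Longrightarrow> series_link E S B2 B1 b a"
proof -
  assume "series_link E S B1 B2 a b"
  then obtain p1 p2 q1 q2 A C D where "series_connectors E S B1 B2 p1 p2 q1 q2 A C D" "a \<in> A"
    "b \<in> D"
    unfolding series_link_def by blast
  moreover from this(1) have "series_connectors E S B2 B1 q1 q2 p1 p2 D C A"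
    unfolding series_connectors_def
    using adjacent_sym by (simp add: Int_commute Un_commute Un_left_commute)
  ultimately show ?thesis unfolding series_link_def by blast
qed

lemma parallel_link_commute_blocks: "parallel_link E S B1 B2 a b \<Longrightarrow> parallel_link E S B2 B1 a b"
proof -
  assume "parallel_link E S B1 B2 a b"
  then obtain p1 p2 q1 q2 R Q where "parallel_connectors E S B1 B2 p1 p2 q1 q2 R Q" "a \<in> R" "b \<in> Q"
    unfolding parallel_link_def by blast
  moreover from this(1) have "parallel_connectors E S B2 B1 q1 q2 p1 p2 R Q"
    unfolding parallel_connectors_def by (simp add: Un_commute)
  ultimately show ?thesis unfolding parallel_link_def by blast
qed

lemma linked_commute_ends: "linked E S B1 B2 a b \<Longrightarrow> linked E S B1 B2 b a"
  unfolding linked_def using series_link_commute by blast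

lemma linked_commute_blocks: "linked E S B1 B2 a b \<Longrightarrow> linked E S B2 B1 a b"
  unfolding linked_def using parallel_link_commute_blocks by blast

end

text \<open>A cycle formed by two disjoint paths \<^term>\<open>Z1\<close>, \<^term>\<open>Z2\<close> and connections inside the two blocks.\<close>

locale block_cycle = undirected E for E :: "('a \<times> 'a) set" +
  fixes S X K1 K2 B1 B2 :: "'a set" and Z1 Z2 :: "'a list"
  assumes connected_X: "connected_in E X" "X \<subseteq> S"
    and components: "component_in E (S - X) K1" "component_in E (S - X) K2" "K1 \<inter> K2 = {}"
    and blocks: "B1 \<subseteq> K1" "B2 \<subseteq> K2"
    and paths: "path_in E S Z1" "path_in E S Z2" "set Z1 \<inter> set Z2 = {}"
    and Z1_ends: "set Z1 \<inter> B1 = {hd Z1}" "set Z1 \<inter> B2 = {last Z1}"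
    and Z2_ends: "set Z2 \<inter> B1 = {hd Z2}" "set Z2 \<inter> B2 = {last Z2}"
begin

definition frame :: "'a set" where
  "frame = B1 \<union> B2 \<union> set Z1 \<union> set Z2"

lemma block_cycle_swap: "block_cycle E S X K1 K2 B1 B2 Z2 Z1"
  using connected_X components blocks paths Z1_ends Z2_ends by unfold_locales auto

lemma block_cycle_rev: "block_cycle E S X K2 K1 B2 B1 (rev Z1) (rev Z2)"
  using connected_X components blocks paths(3) Z1_ends Z2_ends path_in_rev[OF paths(1)]
    path_in_rev[OF paths(2)]
  by unfold_locales (auto simp: hd_rev last_rev)

lemma frame_swap: "block_cycle.frame B1 B2 Z2 Z1 = frame"
  by (auto simp: frame_def block_cycle.frame_def[OF block_cycle_swap])

lemma frame_rev: "block_cycle.frame B2 B1 (rev Z1) (rev Z2) = frame"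
  by (auto simp: frame_def block_cycle.frame_def[OF block_cycle_rev])

lemma Z1_in_blocks: "v \<in> set Z1 \<Longrightarrow> v \<in> B1 \<Longrightarrow> v = hd Z1" "v \<in> set Z1 \<Longrightarrow> v \<in> B2 \<Longrightarrow> v = last Z1"
  using Z1_ends by blast+

lemma ends_in_blocks: "hd Z1 \<in> B1" "last Z1 \<in> B2" "hd Z2 \<in> B1" "last Z2 \<in> B2"
  using Z1_ends Z2_ends by blast+

lemma blocks_disjoint: "B1 \<inter> B2 = {}" "X \<inter> B1 = {}" "X \<inter> B2 = {}"
  using components blocks by (auto simp: component_in_def)

lemma X_meets_Z1: "X \<inter> set Z1 \<noteq> {}"
proof -
  have "set Z1 \<inter> K1 \<noteq> {}" "\<not> set Z1 \<subseteq> K1"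
    using ends_in_blocks(1,2) blocks components(3) path_inD(5,6)[OF paths(1)] by blast+
  then show ?thesis
    using connected_in_path_set[OF paths(1)] path_inD(3)[OF paths(1)]
      component_in_exit[OF components(1), of "set Z1"] by blast
qed

lemma series_along_Z1:
  assumes a: "attached E S frame a x Ta" and b: "attached E S frame b y Tb" and "Ta \<inter> Tb = {}"
    and Z1: "Z1 = xs @ ys" "x \<in> set xs" "y \<in> set ys"
  shows "series_link E S B1 B2 a b"
proof -
  note Ta = attachedD[OF a] and Tb = attachedD[OF b]
  have ne: "xs \<noteq> []" "ys \<noteq> []" using Z1 by auto
  note halves = path_in_appendD[OF paths(1)[unfolded Z1(1)]]
  have Z1_set: "set Z1 = set xs \<union> set ys" using Z1(1) by simp
  have ends: "hd Z1 \<in> set xs" "last Z1 \<in> set ys" using ne Z1(1) by simp_all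
  have xs: "v = hd Z1" if "v \<in> set xs" "v \<in> B1 \<union> B2" for v
    using that Z1_in_blocks[of v] ends halves(3) Z1_set by blast
  have ys: "v = last Z1" if "v \<in> set ys" "v \<in> B1 \<union> B2" for v
    using that Z1_in_blocks[of v] ends halves(3) Z1_set by blast
  have Ta_frame: "v \<in> set xs" if "v \<in> Ta" "v \<in> frame" for v using Ta(6)[OF that] Z1(2) by simp
  have Tb_frame: "v \<in> set ys" if "v \<in> Tb" "v \<in> frame" for v using Tb(6)[OF that] Z1(3) by simp
  have "series_connectors E S B1 B2 (hd Z1) (hd Z2) (last Z1) (last Z2)
      (Ta \<union> set xs) (set Z2) (Tb \<union> set ys)"
    unfolding series_connectors_def
  proof (intro conjI)
    show "connected_in E (Ta \<union> set xs)"
      using Ta(1,4) Z1(2) connected_in_path_set[OF halves(1)[OF ne(1)]]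
      by (intro connected_in_Un) auto
    show "connected_in E (Tb \<union> set ys)"
      using Tb(1,4) Z1(3) connected_in_path_set[OF halves(2)[OF ne(2)]]
      by (intro connected_in_Un) auto
    show "connected_in E (set Z2)" by (rule connected_in_path_set[OF paths(2)])
    show "adjacent E (Ta \<union> set xs) (Tb \<union> set ys)"
      unfolding adjacent_def
      using halves(4)[OF ne] last_in_set[OF ne(1)] hd_in_set[OF ne(2)] by blast
    show "Ta \<union> set xs \<union> set Z2 \<union> (Tb \<union> set ys) \<subseteq> S"
      using Ta(2) Tb(2) path_inD(3)[OF paths(1)] path_inD(3)[OF paths(2)] Z1_set by blast
    show "(Ta \<union> set xs) \<inter> set Z2 = {}" "set Z2 \<inter> (Tb \<union> set ys) = {}"
      using Ta_frame Tb_frame paths(3) Z1_set unfolding frame_def by blast+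
    show "(Ta \<union> set xs) \<inter> (Tb \<union> set ys) = {}"
      using \<open>Ta \<inter> Tb = {}\<close> Ta_frame Tb_frame halves(3) Z1_set unfolding frame_def by blast
    show "(Ta \<union> set xs) \<inter> B1 = {hd Z1}" "(Ta \<union> set xs) \<inter> B2 = {}"
      using Ta_frame xs ends ends_in_blocks blocks_disjoint(1) unfolding frame_def by blast+
    show "(Tb \<union> set ys) \<inter> B2 = {last Z1}" "(Tb \<union> set ys) \<inter> B1 = {}"
      using Tb_frame ys ends ends_in_blocks blocks_disjoint(1) unfolding frame_def by blast+
  qed (use Z2_ends in auto)
  then show ?thesis unfolding series_link_def using Ta(3) Tb(3) by blast
qed

lemma linked_along_Z1:
  assumes a: "attached E S frame a x Ta" and b: "attached E S frame b y Tb" and disj: "Ta \<inter> Tb = {}"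
    and "x \<in> set Z1" "y \<in> set Z1"
  shows "linked E S B1 B2 a b"
proof -
  have "x \<noteq> y" using attachedD(4)[OF a] attachedD(4)[OF b] disj by blast
  obtain u v where uv: "Z1 = u @ x # v" using split_list[OF \<open>x \<in> set Z1\<close>] by blast
  then consider (before) "y \<in> set v" | (after) "y \<in> set u" using \<open>y \<in> set Z1\<close> \<open>x \<noteq> y\<close> by auto
  then show ?thesis
  proof cases
    case before
    then show ?thesis
      using series_along_Z1[OF a b disj, of "u @ [x]" v] uv by (simp add: linked_def)
  next
    case after
    then have "series_link E S B1 B2 b a"
      using series_along_Z1[OF b a _ uv] disj by (simp add: Int_commute)
    then show ?thesis using series_link_commute by (simp add: linked_def)
  qed
qed

lemma parallel_interior:
  assumes a: "attached E S frame a x Ta" and b: "attached E S frame b y Tb" and "Ta \<inter> Tb = {}"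
    and x: "x \<in> set Z1 - B1 - B2" and y: "y \<in> set Z2"
  shows "parallel_link E S B1 B2 a b"
proof -
  note Ta = attachedD[OF a] and Tb = attachedD[OF b]
  obtain m where m: "Z1 = hd Z1 # m @ [last Z1]" "x \<in> set m"
    using path_in_interior[OF paths(1), of x] x ends_in_blocks(1,2) by blast
  then have ne: "m \<noteq> []" by auto
  have Z1: "path_in E S ((hd Z1 # m) @ [last Z1])" "path_in E S ([hd Z1] @ (m @ [last Z1]))"
    using paths(1) m(1) by simp_all
  then have path_m: "path_in E S m"
    using path_in_appendD(2)[OF Z1(2)] path_in_appendD(1) ne by blast
  have outside: "hd Z1 \<notin> set m" "last Z1 \<notin> set m" "set m \<subseteq> set Z1"
    using path_in_appendD(3)[OF Z1(1)] path_in_appendD(3)[OF Z1(2)] arg_cong[OF m(1), of set]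
    by auto
  then have mB: "v \<notin> B1 \<union> B2" if "v \<in> set m" for v using that Z1_in_blocks[of v] by blast
  have edges: "(hd Z1, hd m) \<in> E" "(last m, last Z1) \<in> E"
    using path_in_appendD(4)[OF Z1(1)] path_in_appendD(4)[OF Z1(2)] ne by simp_all
  have Ta_frame: "v \<in> set m" if "v \<in> Ta" "v \<in> frame" for v using Ta(6)[OF that] m(2) by simp
  have Tb_frame: "v \<in> set Z2" if "v \<in> Tb" "v \<in> frame" for v using Tb(6)[OF that] y by simp
  have "parallel_connectors E S B1 B2 (hd Z1) (hd Z2) (last Z1) (last Z2)
      (Ta \<union> set m) (Tb \<union> set Z2)"
    unfolding parallel_connectors_def
  proof (intro conjI)
    show "connected_in E (Ta \<union> set m)"
      using Ta(1,4) m(2) connected_in_path_set[OF path_m] by (intro connected_in_Un) auto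
    show "connected_in E (Tb \<union> set Z2)"
      using Tb(1,4) y connected_in_path_set[OF paths(2)] by (intro connected_in_Un) auto
    show "Ta \<union> set m \<union> (Tb \<union> set Z2) \<subseteq> S"
      using Ta(2) Tb(2) path_inD(3)[OF path_m] path_inD(3)[OF paths(2)] by blast
    show "(Ta \<union> set m) \<inter> (Tb \<union> set Z2) = {}"
      using \<open>Ta \<inter> Tb = {}\<close> Ta_frame Tb_frame outside(3) paths(3) unfolding frame_def by blast
    show "(Ta \<union> set m) \<inter> (B1 \<union> B2) = {}" using Ta_frame mB unfolding frame_def by blast
    show "hd Z1 \<in> B1 - (Tb \<union> set Z2)" "last Z1 \<in> B2 - (Tb \<union> set Z2)"
      using ends_in_blocks Tb_frame path_inD(5,6)[OF paths(1)] paths(3)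
      unfolding frame_def by blast+
    show "adjacent E (Ta \<union> set m) {hd Z1}" "adjacent E (Ta \<union> set m) {last Z1}"
      using edges edge_sym hd_in_set[OF ne] last_in_set[OF ne] unfolding adjacent_def by blast+
    show "(Tb \<union> set Z2) \<inter> B1 = {hd Z2}" "(Tb \<union> set Z2) \<inter> B2 = {last Z2}"
      using Tb_frame Z2_ends unfolding frame_def by blast+
  qed
  then show ?thesis unfolding parallel_link_def using Ta(3) Tb(3) by blast
qed

lemma linked_interior:
  assumes a: "attached E S frame a x Ta" and b: "attached E S frame b y Tb" and disj: "Ta \<inter> Tb = {}"
    and x: "x \<in> set Z1 \<union> set Z2 - B1 - B2" and y: "y \<in> set Z1 \<union> set Z2"
  shows "linked E S B1 B2 a b"
proof -
  interpret swap: block_cycle E S X K1 K2 B1 B2 Z2 Z1 by (rule block_cycle_swap)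
  consider (Z1) "x \<in> set Z1" "y \<in> set Z1" | (Z1_Z2) "x \<in> set Z1" "y \<in> set Z2"
    | (Z2_Z1) "x \<in> set Z2" "y \<in> set Z1" | (Z2) "x \<in> set Z2" "y \<in> set Z2" using x y by blast
  then show ?thesis
  proof cases
    case Z1
    then show ?thesis by (rule linked_along_Z1[OF a b disj])
  next
    case Z1_Z2
    then have "parallel_link E S B1 B2 a b" using parallel_interior[OF a b disj] x by blast
    then show ?thesis by (simp add: linked_def)
  next
    case Z2_Z1
    then have "parallel_link E S B1 B2 a b"
      using swap.parallel_interior[unfolded frame_swap, OF a b disj] x by blast
    then show ?thesis by (simp add: linked_def)
  next
    case Z2
    then show ?thesis by (rule swap.linked_along_Z1[unfolded frame_swap, OF a b disj])
  qed
qed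

lemma series_from_block:
  assumes a: "attached E S frame a x Ta" and b: "attached E S frame b y Tb" and "Ta \<inter> Tb = {}"
    and "adjacent E Ta Tb" and x: "x \<in> B1 - set Z2" and y: "y \<in> set Z1 - B1"
  shows "series_link E S B1 B2 a b"
proof -
  note Ta = attachedD[OF a] and Tb = attachedD[OF b]
  obtain u v where uv: "Z1 = u @ y # v" using split_list[of y Z1] y by blast
  have "u \<noteq> []" using uv y ends_in_blocks(1) by (metis DiffD2 append_Nil list.sel(1))
  note halves = path_in_appendD[OF paths(1)[unfolded uv]]
  define ys where "ys = y # v"
  have path_ys: "path_in E S ys" using halves(2) by (simp add: ys_def)
  have "last Z1 = last ys" using uv by (simp add: ys_def)
  then have last: "last Z1 \<in> set ys" using path_inD(6)[OF path_ys] by simp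
  have "hd Z1 \<in> set u" using uv \<open>u \<noteq> []\<close> by simp
  then have "hd Z1 \<notin> set ys" using halves(3) unfolding ys_def by blast
  moreover have ys_Z1: "set ys \<subseteq> set Z1" using uv by (auto simp: ys_def)
  ultimately have ys: "v \<notin> B1" "v \<in> B2 \<Longrightarrow> v = last Z1" if "v \<in> set ys" for v
    using that Z1_in_blocks[of v] by blast+
  have Tb_frame: "v \<in> set ys" if "v \<in> Tb" "v \<in> frame" for v
    using Tb(6)[OF that] by (simp add: ys_def)
  have "series_connectors E S B1 B2 x (hd Z2) (last Z1) (last Z2) Ta (set Z2) (Tb \<union> set ys)"
    unfolding series_connectors_def
  proof (intro conjI)
    show "connected_in E Ta" by (rule Ta(1))
    show "connected_in E (Tb \<union> set ys)"
      using Tb(1,4) connected_in_path_set[OF path_ys] by (intro connected_in_Un) (auto simp: ys_def)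
    show "connected_in E (set Z2)" by (rule connected_in_path_set[OF paths(2)])
    show "adjacent E Ta (Tb \<union> set ys)" using \<open>adjacent E Ta Tb\<close> by (rule adjacent_mono) auto
    show "Ta \<union> set Z2 \<union> (Tb \<union> set ys) \<subseteq> S"
      using Ta(2) Tb(2) path_inD(3)[OF path_ys] path_inD(3)[OF paths(2)] by blast
    show "Ta \<inter> set Z2 = {}" using Ta(6) x unfolding frame_def by blast
    show "set Z2 \<inter> (Tb \<union> set ys) = {}" using Tb_frame paths(3) ys_Z1 unfolding frame_def by blast
    show "Ta \<inter> (Tb \<union> set ys) = {}"
      using \<open>Ta \<inter> Tb = {}\<close> Ta(6) x ys(1) ys_Z1 unfolding frame_def by blast
    show "Ta \<inter> B1 = {x}" "Ta \<inter> B2 = {}"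
      using Ta(4,6) x blocks_disjoint(1) unfolding frame_def by blast+
    show "(Tb \<union> set ys) \<inter> B2 = {last Z1}" "(Tb \<union> set ys) \<inter> B1 = {}"
      using Tb_frame ys last ends_in_blocks(2) unfolding frame_def by blast+
  qed (use Z2_ends in auto)
  then show ?thesis unfolding series_link_def using Ta(3) Tb(3) by blast
qed

lemma linked_adjacent_attachments:
  assumes a: "attached E S frame a x Ta" and b: "attached E S frame b y Tb"
    and "Ta \<inter> Tb = {}" "adjacent E Ta Tb"
    and "x \<in> B1 - set Z1 - set Z2" "y \<in> set Z1 \<union> set Z2 - B1 - B2"
  shows "linked E S B1 B2 a b"
proof -
  interpret swap: block_cycle E S X K1 K2 B1 B2 Z2 Z1 by (rule block_cycle_swap)
  have "series_link E S B1 B2 a b"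
    using series_from_block[OF a b] swap.series_from_block[unfolded frame_swap, OF a b] assms(3-6)
    by blast
  then show ?thesis by (simp add: linked_def)
qed

lemma exit_path_through_X:
  assumes "attached E S frame a x Ta" "a \<notin> K1" "x \<in> B1"
  obtains p where "path_in E X p" "set p \<inter> Ta = {hd p}"
    "set p \<inter> (set Z1 \<union> set Z2 \<union> Tb) = {last p}"
proof -
  note Ta = attachedD[OF assms(1)]
  have "Ta \<inter> X \<noteq> {}"
    using component_in_exit[OF components(1) Ta(1,2)] Ta(3,4) assms(2,3) blocks(1) by blast
  then show thesis
    using connected_in_link[OF connected_X(1), of Ta "set Z1 \<union> set Z2 \<union> Tb"] X_meets_Z1 that
    by blast
qed

lemma linked_from_B1:
  assumes a: "tail_attached E S frame a x Ta" and b: "attached E S frame b y Tb"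
    and disj: "Ta \<inter> Tb = {}"
    and "a \<notin> K1" and x: "x \<in> B1" and y: "y \<in> set Z1 \<union> set Z2 - B1 - B2"
  shows "linked E S B1 B2 a b"
proof (cases "x \<in> set Z1 \<union> set Z2")
  case True
  have "attached E S frame a x Ta" using a by (simp add: tail_attached_def)
  then have "linked E S B1 B2 b a" using linked_interior[OF b _ _ y True] disj by blast
  then show ?thesis by (rule linked_commute_ends)
next
  case False
  have a': "attached E S frame a x Ta" using a by (simp add: tail_attached_def)
  have "a \<noteq> x" "x \<notin> X" using \<open>a \<notin> K1\<close> x blocks(1) blocks_disjoint(2) by blast+
  obtain p where p: "path_in E X p" "set p \<inter> Ta = {hd p}"
    "set p \<inter> (set Z1 \<union> set Z2 \<union> Tb) = {last p}"
    using exit_path_through_X[OF a' \<open>a \<notin> K1\<close> x] .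
  have pX: "set p \<subseteq> X" using path_inD(3)[OF p(1)] .
  have pS: "path_in E S p" using p(1) by (rule path_in_mono) (use pX connected_X(2) in blast)
  have p_last: "v = last p" if "v \<in> set p" "v \<in> frame \<union> Tb" for v
    using that p(3) pX blocks_disjoint(2,3) unfolding frame_def by blast
  have ends: "hd p \<in> Ta" "last p \<in> set p" using p(2) path_inD(6)[OF p(1)] by blast+
  show ?thesis
  proof (cases "last p \<in> Tb")
    case True
    then have ne: "hd p \<noteq> last p" using ends(1) disj by (metis disjoint_iff)
    show ?thesis
    proof (rule linked_adjacent_attachments[OF attached_extend[OF a' pS ends(1) ne] b])
      show "set p \<inter> frame \<subseteq> {last p}" "(Ta \<union> (set p - {last p})) \<inter> Tb = {}"
        using disj p_last by blast+
      show "adjacent E (Ta \<union> (set p - {last p})) Tb"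
        using path_in_minus_last(2)[OF pS ne] by (rule adjacent_mono) (use True in auto)
    qed (use x y False in auto)
  next
    case False
    then have "set p \<inter> Tb = {}" using p_last by blast
    moreover have "last p \<in> set Z1 \<union> set Z2 - B1 - B2"
      using p(3) False ends(2) pX blocks_disjoint(2,3) by blast
    moreover from this have "set p \<inter> frame = {last p}"
      using ends(2) p_last unfolding frame_def by blast
    then have "attached E S frame a (last p) (Ta - {x} \<union> set p)"
      using attached_reroute[OF a \<open>a \<noteq> x\<close> pS] p(2) \<open>x \<notin> X\<close> pX by blast
    moreover have "(Ta - {x} \<union> set p) \<inter> Tb = {}" using disj calculation(1) by blast
    ultimately show ?thesis using linked_interior[OF _ b] y by blast
  qed
qed

lemma linked_to_interior:
  assumes a: "tail_attached E S frame a x Ta" and b: "attached E S frame b y Tb"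
    and disj: "Ta \<inter> Tb = {}"
    and "a \<notin> K1 \<union> K2" and y: "y \<in> set Z1 \<union> set Z2 - B1 - B2"
  shows "linked E S B1 B2 a b"
proof -
  interpret reverse: block_cycle E S X K2 K1 B2 B1 "rev Z1" "rev Z2" by (rule block_cycle_rev)
  have a': "attached E S frame a x Ta" using a by (simp add: tail_attached_def)
  consider (B1) "x \<in> B1" | (B2) "x \<in> B2" | (interior) "x \<in> set Z1 \<union> set Z2 - B1 - B2"
    using attachedD(5)[OF a'] by (auto simp: frame_def)
  then show ?thesis
  proof cases
    case B1
    then show ?thesis using linked_from_B1[OF a b disj] y \<open>a \<notin> K1 \<union> K2\<close> by blast
  next
    case B2
    then have "linked E S B2 B1 a b"
      using reverse.linked_from_B1[unfolded frame_rev, OF a b disj] y \<open>a \<notin> K1 \<union> K2\<close> by auto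
    then show ?thesis by (rule linked_commute_blocks)
  next
    case interior
    then show ?thesis using linked_interior[OF a' b disj] y by blast
  qed
qed

lemma linked_by_reroute:
  assumes a: "tail_attached E S frame a x Ta" and b: "tail_attached E S frame b y Tb"
    and disj: "Ta \<inter> Tb = {}"
    and "b \<notin> K1 \<union> K2" "a \<noteq> x" "x \<notin> X"
    and p: "path_in E X p" "set p \<inter> Ta \<noteq> {}" "set p \<inter> Tb = {}"
      "set p \<inter> (set Z1 \<union> set Z2) = {last p}"
  shows "linked E S B1 B2 a b"
proof -
  have pX: "set p \<subseteq> X" using path_inD(3)[OF p(1)] .
  have pS: "path_in E S p" using p(1) by (rule path_in_mono) (use pX connected_X(2) in blast)
  have "set p \<inter> (B1 \<union> B2) = {}" using pX blocks_disjoint(2,3) by blast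
  then have "set p \<inter> frame = {last p}" "last p \<in> set Z1 \<union> set Z2 - B1 - B2"
    using p(4) path_inD(6)[OF p(1)] unfolding frame_def by blast+
  moreover from this(1) have "attached E S frame a (last p) (Ta - {x} \<union> set p)"
    using attached_reroute[OF a \<open>a \<noteq> x\<close> pS p(2)] pX \<open>x \<notin> X\<close> by blast
  moreover have "Tb \<inter> (Ta - {x} \<union> set p) = {}" using disj p(3) by blast
  ultimately have "linked E S B1 B2 b a" using linked_to_interior[OF b] \<open>b \<notin> K1 \<union> K2\<close> by blast
  then show ?thesis by (rule linked_commute_ends)
qed

lemma linked_tails:
  assumes a: "tail_attached E S frame a x Ta" and b: "tail_attached E S frame b y Tb"
    and disj: "Ta \<inter> Tb = {}"
    and aK: "a \<notin> K1 \<union> K2" and bK: "b \<notin> K1 \<union> K2"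
  shows "linked E S B1 B2 a b"
proof -
  have a': "attached E S frame a x Ta" and b': "attached E S frame b y Tb"
    using a b by (auto simp: tail_attached_def)
  note Ta = attachedD[OF a'] and Tb = attachedD[OF b']
  have disj': "Tb \<inter> Ta = {}" using disj by blast
  consider (b_interior) "y \<in> set Z1 \<union> set Z2 - B1 - B2"
    | (a_interior) "x \<in> set Z1 \<union> set Z2 - B1 - B2"
    | (both) "x \<in> B1 \<union> B2" "y \<in> B1 \<union> B2" using Ta(5) Tb(5) by (auto simp: frame_def)
  then show ?thesis
  proof cases
    case b_interior
    then show ?thesis by (rule linked_to_interior[OF a b' disj aK])
  next
    case a_interior
    then show ?thesis using linked_to_interior[OF b a' disj' bK] linked_commute_ends by blast
  next
    case both
    then have ends: "a \<noteq> x" "b \<noteq> y" "x \<notin> X" "y \<notin> X"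
      using aK bK blocks blocks_disjoint(2,3) by blast+
    have "Ta \<inter> X \<noteq> {}"
      using component_in_exit[OF components(1) Ta(1,2)] component_in_exit[OF components(2) Ta(1,2)]
        Ta(3,4) aK both(1) blocks by blast
    then obtain p where p: "path_in E X p" "set p \<inter> (Ta \<union> Tb) = {hd p}"
      "set p \<inter> (set Z1 \<union> set Z2) = {last p}"
      using connected_in_link[OF connected_X(1), of "Ta \<union> Tb" "set Z1 \<union> set Z2"] X_meets_Z1 by blast
    have only: "v = hd p" if "v \<in> set p" "v \<in> Ta \<union> Tb" for v
      using p(2) that by (metis IntI singletonD)
    have "hd p \<in> set p" "hd p \<in> Ta \<union> Tb" using p(2) by blast+
    then consider (from_Ta) "set p \<inter> Ta \<noteq> {}" "set p \<inter> Tb = {}"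
      | (from_Tb) "set p \<inter> Tb \<noteq> {}" "set p \<inter> Ta = {}" using only disj by (metis Un_iff disjoint_iff)
    then show ?thesis
    proof cases
      case from_Ta
      then show ?thesis using linked_by_reroute[OF a b disj bK ends(1,3) p(1)] p(3) by blast
    next
      case from_Tb
      then have "linked E S B1 B2 b a"
        using linked_by_reroute[OF b a disj' aK ends(2,4) p(1)] p(3) by blast
      then show ?thesis by (rule linked_commute_ends)
    qed
  qed
qed

end

lemma (in undirected) linked_blocks:
  assumes S: "finite S" "biconnected_in E S" and X: "connected_in E X" "X \<subseteq> S"
    and K: "component_in E (S - X) K1" "component_in E (S - X) K2" "K1 \<inter> K2 = {}"
    and B: "B1 \<subseteq> K1" "B2 \<subseteq> K2" "biconnected_in E B1" "biconnected_in E B2"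
    and ab: "a \<in> S" "b \<in> S" "a \<noteq> b" "a \<notin> K1 \<union> K2" "b \<notin> K1 \<union> K2"
  shows "linked E S B1 B2 a b"
proof -
  have BS: "B1 \<subseteq> S" "B2 \<subseteq> S" using B(1,2) K(1,2) by (auto simp: component_in_def)
  then have "finite B1" "finite B2" using S(1) finite_subset by auto
  then have card: "2 \<le> card B1" "2 \<le> card B2" using B(3,4) biconnected_in_card by auto
  obtain Z1 Z2 where Z: "path_in E S Z1" "set Z1 \<inter> B1 = {hd Z1}" "set Z1 \<inter> B2 = {last Z1}"
    "path_in E S Z2" "set Z2 \<inter> B1 = {hd Z2}" "set Z2 \<inter> B2 = {last Z2}" "set Z1 \<inter> set Z2 = {}"
    using biconnected_two_paths[OF S BS card] .
  interpret block_cycle E S X K1 K2 B1 B2 Z1 Z2 using X K B(1,2) Z by unfold_locales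
  have frame: "frame \<subseteq> S" "B1 \<subseteq> frame"
    using BS path_inD(3)[OF Z(1)] path_inD(3)[OF Z(4)] by (auto simp: frame_def)
  then have "2 \<le> card frame"
    using card(1) card_mono[OF finite_subset[OF frame(1) S(1)] frame(2)] by simp
  moreover have "{a, b} \<subseteq> S" "2 \<le> card {a, b}" using ab(1-3) by auto
  ultimately obtain p q where p: "path_in E S p" "set p \<inter> {a, b} = {hd p}"
    "set p \<inter> frame = {last p}"
    and q: "path_in E S q" "set q \<inter> {a, b} = {hd q}" "set q \<inter> frame = {last q}"
    and pq: "set p \<inter> set q = {}"
    using biconnected_two_paths[OF S _ frame(1), of "{a, b}"] by blast
  note tails = tail_of_path[OF p(1,3)] tail_of_path[OF q(1,3)]
  have "hd p \<in> {a, b}" "hd q \<in> {a, b}" "hd p \<noteq> hd q"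
    using p(2) q(2) pq path_inD(5)[OF p(1)] path_inD(5)[OF q(1)] by blast+
  then consider (straight) "hd p = a" "hd q = b" | (crossed) "hd p = b" "hd q = a" by auto
  then show ?thesis
  proof cases
    case straight
    then show ?thesis using linked_tails[OF tails pq] ab(4,5) by simp
  next
    case crossed
    then have "linked E S B1 B2 b a" using linked_tails[OF tails pq] ab(4,5) by simp
    then show ?thesis by (rule linked_commute_ends)
  qed
qed

section \<open>The recursion\<close>

definition rooted_alternative ::
    "('a \<times> 'a) set \<Rightarrow> nat \<Rightarrow> nat \<Rightarrow> nat \<Rightarrow> 'a \<Rightarrow> 'a \<Rightarrow> 'a set \<Rightarrow> bool" where
  "rooted_alternative E i j j' a b S \<longleftrightarrow>
     rooted_nabla E i a b S \<or> rooted_Gamma_plus E j a b S \<or> rooted_Gamma_plus E j' b a S"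

context undirected
begin

lemma rooted_alternative_commute:
  "rooted_alternative E i j j' a b S \<longleftrightarrow> rooted_alternative E i j' j b a S"
  using rooted_nabla_sym unfolding rooted_alternative_def by blast

lemma rooted_alternative_zero:
  assumes "connected_in E S" "a \<in> S" "b \<in> S" "a \<noteq> b" and "i = 0 \<or> j = 0 \<or> j' = 0"
  shows "rooted_alternative E i j j' a b S"
  using rooted_models_zero[OF assms(1-4)] rooted_models_zero[OF assms(1,3,2)] assms(4,5)
  unfolding rooted_alternative_def by auto

lemma rooted_Gamma_plus_extend:
  assumes "B \<subseteq> S" and P: "connected_in E P" "P \<inter> B = {p}" "P \<subseteq> S" "a \<in> P"
    and Q: "connected_in E Q" "Q \<inter> B = {q}" "Q \<subseteq> S" "b \<in> Q" and "P \<inter> Q = {}"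
  shows "rooted_Gamma_plus E m p q B \<Longrightarrow> rooted_Gamma_plus E m a b S"
    "rooted_Gamma_plus E m q p B \<Longrightarrow> rooted_Gamma_plus E m b a S"
proof -
  note roots = pverts_Gamma_plus[of m]
  show "rooted_Gamma_plus E m a b S" if "rooted_Gamma_plus E m p q B"
    by (rule rooted_model_extend[OF that _ _ _ \<open>B \<subseteq> S\<close> P Q \<open>P \<inter> Q = {}\<close>]) (simp_all add: roots)
  have "Q \<inter> P = {}" using \<open>P \<inter> Q = {}\<close> by blast
  show "rooted_Gamma_plus E m b a S" if "rooted_Gamma_plus E m q p B"
    by (rule rooted_model_extend[OF that _ _ _ \<open>B \<subseteq> S\<close> Q P \<open>Q \<inter> P = {}\<close>]) (simp_all add: roots)
qed

lemma rooted_alternative_series: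
  assumes link: "series_link E S B1 B2 a b" and B: "B1 \<union> B2 \<subseteq> S" "B1 \<inter> B2 = {}"
    and conn: "connected_in E B1" "connected_in E B2"
    and B1: "\<And>p q. p \<in> B1 \<Longrightarrow> q \<in> B1 \<Longrightarrow> p \<noteq> q \<Longrightarrow> rooted_alternative E i j j' p q B1"
    and B2: "\<And>p q. p \<in> B2 \<Longrightarrow> q \<in> B2 \<Longrightarrow> p \<noteq> q \<Longrightarrow> rooted_alternative E i j j' p q B2"
  shows "rooted_alternative E (Suc i) j j' a b S"
proof -
  obtain p1 p2 q1 q2 A C D where connectors: "series_connectors E S B1 B2 p1 p2 q1 q2 A C D"
    and ab: "a \<in> A" "b \<in> D" using link unfolding series_link_def by blast
  note parts = connectors[unfolded series_connectors_def]
  have mem: "p1 \<in> A \<inter> B1" "p2 \<in> C \<inter> B1" "q2 \<in> C \<inter> B2" "q1 \<in> D \<inter> B2" using parts by simp_all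
  moreover have "A \<inter> C = {}" "C \<inter> D = {}" using parts by simp_all
  ultimately have ends: "p1 \<in> B1" "p2 \<in> B1" "p1 \<noteq> p2" "q2 \<in> B2" "q1 \<in> B2" "q2 \<noteq> q1" by auto
  have A: "connected_in E A" "A \<inter> B1 = {p1}" "A \<subseteq> S"
    and D: "connected_in E D" "D \<inter> B2 = {q1}" "D \<subseteq> S"
    using parts by simp_all
  have "A \<inter> B1 \<noteq> {}" "B2 \<inter> D \<noteq> {}" "(A \<union> B1) \<inter> C \<noteq> {}" "C \<inter> (B2 \<union> D) \<noteq> {}" using mem ends by blast+
  then have connected: "connected_in E (A \<union> B1 \<union> C)" "connected_in E (C \<union> (B2 \<union> D))"
    using parts conn connected_in_Un by simp_all
  have meet: "(A \<union> B1 \<union> C) \<inter> B2 = {q2}" "(C \<union> (B2 \<union> D)) \<inter> B1 = {p2}"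
    using parts B(2) by (simp_all add: Int_Un_distrib2 Int_commute[of B2 B1])
  have disjoint: "(A \<union> B1 \<union> C) \<inter> D = {}" "A \<inter> (C \<union> (B2 \<union> D)) = {}"
    using parts by (simp_all add: Int_Un_distrib Int_Un_distrib2 Int_commute)
  have sub: "A \<union> B1 \<union> C \<subseteq> S" "C \<union> (B2 \<union> D) \<subseteq> S" "B1 \<subseteq> S" "B2 \<subseteq> S" using parts B(1) by simp_all
  have ab': "a \<in> A \<union> B1 \<union> C" "b \<in> C \<union> (B2 \<union> D)" using ab by simp_all
  note extend =
    rooted_Gamma_plus_extend[OF sub(3) A ab(1) connected(2) meet(2) sub(2) ab'(2) disjoint(2)]
    rooted_Gamma_plus_extend[OF sub(4) connected(1) meet(1) sub(1) ab'(1) D ab(2) disjoint(1)]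
  show ?thesis
    using B1[OF ends(1-3)] B2[OF ends(4-6)] extend rooted_nabla_series[OF _ _ B connectors ab]
    unfolding rooted_alternative_def by blast
qed

lemma rooted_alternative_parallel:
  assumes link: "parallel_link E S B1 B2 a b" and B: "B1 \<union> B2 \<subseteq> S" "B1 \<inter> B2 = {}"
    and B1: "\<And>p q. p \<in> B1 \<Longrightarrow> q \<in> B1 \<Longrightarrow> p \<noteq> q \<Longrightarrow> rooted_alternative E i j j' p q B1"
    and B2: "\<And>p q. p \<in> B2 \<Longrightarrow> q \<in> B2 \<Longrightarrow> p \<noteq> q \<Longrightarrow> rooted_alternative E i j j' p q B2"
  shows "rooted_alternative E i (Suc j) j' a b S"
proof -
  obtain p1 p2 q1 q2 R Q where connectors: "parallel_connectors E S B1 B2 p1 p2 q1 q2 R Q"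
    and ab: "a \<in> R" "b \<in> Q" using link unfolding parallel_link_def by blast
  note parts = connectors[unfolded parallel_connectors_def]
  have extend: "rooted_nabla E i p q B \<Longrightarrow> rooted_nabla E i a b S"
    "rooted_Gamma_plus E m q p B \<Longrightarrow> rooted_Gamma_plus E m b a S"
    if "B \<subseteq> S" "p \<in> B - Q" "adjacent E R {p}" "Q \<inter> B = {q}" "R \<inter> B = {}" for B p q m
  proof -
    have P: "connected_in E (R \<union> {p})"
      using parts that(3) by (intro connected_in_Un_adjacent) simp_all
    have P': "(R \<union> {p}) \<inter> B = {p}" "R \<union> {p} \<subseteq> S" "a \<in> R \<union> {p}"
      using that(1,2,5) parts ab(1) by (auto simp: Int_Un_distrib2)
    have Q: "connected_in E Q" "Q \<subseteq> S" "(R \<union> {p}) \<inter> Q = {}" using parts that(2) by simp_all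
    show "rooted_nabla E i a b S" if "rooted_nabla E i p q B"
      by (rule rooted_model_extend[OF that _ _ _ \<open>B \<subseteq> S\<close> P P' Q(1) \<open>Q \<inter> B = {q}\<close> Q(2) ab(2) Q(3)])
        simp_all
    show "rooted_Gamma_plus E m b a S" if "rooted_Gamma_plus E m q p B"
      by (rule rooted_Gamma_plus_extend(2)[OF \<open>B \<subseteq> S\<close> P P' Q(1) \<open>Q \<inter> B = {q}\<close> Q(2) ab(2) Q(3) that])
  qed
  have "p2 \<in> Q \<inter> B1" "q2 \<in> Q \<inter> B2" "p1 \<in> B1 - Q" "q1 \<in> B2 - Q" using parts by simp_all
  then have ends: "p1 \<in> B1" "p2 \<in> B1" "p1 \<noteq> p2" "q1 \<in> B2" "q2 \<in> B2" "q1 \<noteq> q2" by auto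
  have "R \<inter> (B1 \<union> B2) = {}" using parts by simp
  then have R: "R \<inter> B1 = {}" "R \<inter> B2 = {}" and sub: "B1 \<subseteq> S" "B2 \<subseteq> S" using B(1) by blast+
  show ?thesis
    using B1[OF ends(1-3)] B2[OF ends(4-6)] extend[OF sub(1) _ _ _ R(1), of p1 p2]
      extend[OF sub(2) _ _ _ R(2), of q1 q2] parts
      rooted_Gamma_plus_parallel[OF _ _ B connectors ab]
    unfolding rooted_alternative_def by simp metis
qed

lemma two_linked_blocks:
  assumes S: "finite S" "biconnected_in E S" and \<psi>: "tree_model E (words k) \<psi> S"
    and l: "1 \<le> l" "2 * l + 3 \<le> k" and no_model: "\<not> Gamma_plus_model E l S"
    and ab: "a \<in> S" "b \<in> S" "a \<noteq> b"
  obtains B1 B2 \<chi>1 \<chi>2 where "B1 \<union> B2 \<subseteq> S" "B1 \<inter> B2 = {}" "biconnected_in E B1" "biconnected_in E B2"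
    "tree_model E (words (k - (2 * l + 3))) \<chi>1 B1" "tree_model E (words (k - (2 * l + 3))) \<chi>2 B2"
    "linked E S B1 B2 a b"
proof -
  have "l + 3 \<le> k" "l \<le> k - l - 3" using l(2) by simp_all
  obtain X K1 K2 \<psi>1 \<psi>2 where X: "connected_in E X" "X \<subseteq> S"
    and K: "component_in E (S - X) K1" "component_in E (S - X) K2" "K1 \<inter> K2 = {}"
      "{a, b} \<inter> (K1 \<union> K2) = {}"
    and trees: "tree_model E (words (k - l - 3)) \<psi>1 K1" "tree_model E (words (k - l - 3)) \<psi>2 K2"
    using two_components_with_tree_models[OF \<psi> \<open>l + 3 \<le> k\<close> no_model] .
  obtain B1 \<chi>1 where B1: "B1 \<subseteq> K1" "biconnected_in E B1"
    "tree_model E (words (k - l - 3 - l)) \<chi>1 B1"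
    using block_with_tree_model[OF S X K(1) trees(1) l(1) \<open>l \<le> k - l - 3\<close> no_model] .
  obtain B2 \<chi>2 where B2: "B2 \<subseteq> K2" "biconnected_in E B2"
    "tree_model E (words (k - l - 3 - l)) \<chi>2 B2"
    using block_with_tree_model[OF S X K(2) trees(2) l(1) \<open>l \<le> k - l - 3\<close> no_model] .
  have "K1 \<subseteq> S" "K2 \<subseteq> S" using K(1,2) by (auto simp: component_in_def)
  moreover have "linked E S B1 B2 a b"
    using linked_blocks[OF S X K(1-3) B1(1) B2(1) B1(2) B2(2) ab] K(4) by blast
  moreover have "k - l - 3 - l = k - (2 * l + 3)" by simp
  moreover have "B1 \<inter> B2 = {}" using B1(1) B2(1) K(3) by blast
  moreover have "B1 \<union> B2 \<subseteq> S" using B1(1) B2(1) calculation(1,2) by blast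
  ultimately show thesis using that[of B1 B2 \<chi>1 \<chi>2] B1 B2 by auto
qed

lemma rooted_alternative_step:
  assumes link: "linked E S B1 B2 a b" and B: "B1 \<union> B2 \<subseteq> S" "B1 \<inter> B2 = {}"
    and conn: "connected_in E B1" "connected_in E B2"
    and IH: "\<And>x y z p q B. x + y + z = i + j + j' + 2 \<Longrightarrow> B = B1 \<or> B = B2 \<Longrightarrow> p \<in> B \<Longrightarrow> q \<in> B \<Longrightarrow> p \<noteq> q \<Longrightarrow>
      rooted_alternative E x y z p q B"
  shows "rooted_alternative E (Suc i) (Suc j) (Suc j') a b S"
proof -
  have swap: "B2 \<union> B1 \<subseteq> S" "B2 \<inter> B1 = {}" using B by auto
  consider (series) "series_link E S B1 B2 a b" | (series_swap) "series_link E S B2 B1 a b"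
    | (parallel) "parallel_link E S B1 B2 a b" | (parallel_swap) "parallel_link E S B1 B2 b a"
    using link unfolding linked_def by blast
  then show ?thesis
  proof cases
    case series
    then show ?thesis by (rule rooted_alternative_series[OF _ B conn]) (auto intro: IH)
  next
    case series_swap
    then show ?thesis by (rule rooted_alternative_series[OF _ swap conn(2,1)]) (auto intro: IH)
  next
    case parallel
    then show ?thesis by (rule rooted_alternative_parallel[OF _ B]) (auto intro: IH)
  next
    case parallel_swap
    then have "rooted_alternative E (Suc i) (Suc j') (Suc j) b a S"
      by (rule rooted_alternative_parallel[OF _ B]) (auto intro: IH)
    then show ?thesis by (rule rooted_alternative_commute[THEN iffD2])
  qed
qed

lemma rooted_alternative_exists:
  assumes "finite S" "biconnected_in E S" "tree_model E (words k) \<psi> S" "1 \<le> l"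
    "\<not> Gamma_plus_model E l S"
    and "(2 * l + 3) * (i + j + j' - 2) \<le> k" and "a \<in> S" "b \<in> S" "a \<noteq> b"
  shows "rooted_alternative E i j j' a b S"
  using assms
proof (induction "i + j + j'" arbitrary: i j j' S k \<psi> a b rule: less_induct)
  case less
  show ?case
  proof (cases "i = 0 \<or> j = 0 \<or> j' = 0")
    case True
    then show ?thesis
      using less.prems(2,7-9) by (intro rooted_alternative_zero) (auto simp: biconnected_in_def)
  next
    case False
    then obtain i0 j0 j0' where Suc: "i = Suc i0" "j = Suc j0" "j' = Suc j0'"
      by (metis not0_implies_Suc)
    define k' where "k' = k - (2 * l + 3)"
    have k: "2 * l + 3 \<le> k" "(2 * l + 3) * (i0 + j0 + j0') \<le> k'"
      using less.prems(6) by (simp_all add: Suc k'_def algebra_simps)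
    obtain B1 B2 \<chi>1 \<chi>2 where B: "B1 \<union> B2 \<subseteq> S" "B1 \<inter> B2 = {}"
      and blocks: "biconnected_in E B1" "biconnected_in E B2"
      and trees: "tree_model E (words k') \<chi>1 B1" "tree_model E (words k') \<chi>2 B2"
      and link: "linked E S B1 B2 a b"
      unfolding k'_def by (rule two_linked_blocks[OF less.prems(1-4) k(1) less.prems(5,7-9)])
    show ?thesis
      unfolding Suc
    proof (rule rooted_alternative_step[OF link B])
      fix x y z p q B
      assume sum: "x + y + z = i0 + j0 + j0' + 2" and choice: "B = B1 \<or> B = B2"
        and ends: "p \<in> B" "q \<in> B" "p \<noteq> q"
      obtain \<chi> where \<chi>: "tree_model E (words k') \<chi> B" using choice trees by blast
      have block: "biconnected_in E B" "B \<subseteq> S" using choice blocks B(1) by blast+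
      have no_model: "\<not> Gamma_plus_model E l B"
        using less.prems(5) Gamma_plus_model_mono block(2) by blast
      have "x + y + z < i + j + j'" "(2 * l + 3) * (x + y + z - 2) \<le> k'"
        using sum Suc k(2) by simp_all
      then show "rooted_alternative E x y z p q B"
        using finite_subset[OF block(2) less.prems(1)]
          less.hyps[OF _ _ block(1) \<chi> less.prems(4) no_model] ends by blast
    qed (use blocks in \<open>simp_all add: biconnected_in_def\<close>)
  qed
qed

end

lemma connected_in_of_connected:
  assumes G: "pair_graph G" and "S \<subseteq> pverts G" and conn: "connected (with_proj G \<restriction> S)"
  shows "connected_in (parcs G) S"
proof -
  interpret undirected "parcs G" using G by (rule undirected_parcs)
  define R where "R = parcs (mk_symmetric (with_proj G \<restriction> S))"
  have R: "R \<subseteq> parcs G \<inter> S \<times> S"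
    using edge_sym by (auto simp: R_def parcs_mk_symmetric)
  have reach: "S \<noteq> {}" "\<And>u v. u \<in> S \<Longrightarrow> v \<in> S \<Longrightarrow> (u, v) \<in> rtrancl_on S R"
    using conn unfolding connected_def strongly_connected_def reachable_def R_def by auto
  have "(u, v) \<in> (parcs G \<inter> S \<times> S)\<^sup>*" if "(u, v) \<in> rtrancl_on S R" for u v
    using that
  proof (induction rule: rtrancl_on_induct)
    case (step y z)
    with R show ?case by (meson rtrancl_into_rtrancl subsetD)
  qed simp
  then show ?thesis using reach by (simp add: connected_in_def)
qed

lemma biconnected_in_of_k_connected:
  assumes G: "pair_graph G" and two: "k_connected 2 G"
  shows "biconnected_in (parcs G) (pverts G)"
proof -
  have minus: "connected_in (parcs G) (pverts G - X)" if "X \<subseteq> pverts G" "card X < 2" for X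
    using two that by (intro connected_in_of_connected[OF G]) (auto simp: k_connected_def)
  have "connected_in (parcs G) (pverts G)" using minus[of "{}"] by simp
  moreover from this have "connected_in (parcs G) (pverts G - {v})" for v
    using minus[of "{v}"] by (cases "v \<in> pverts G") auto
  ultimately show ?thesis by (simp add: biconnected_in_def)
qed

lemma tree_height_suffices:
  assumes "1 \<le> (l::nat)"
  shows "(2 * l + 3) * (l + l + l - 2) \<le> 9 * l\<^sup>2 - 3 * l + 1"
proof -
  obtain m where m: "l = Suc m" using assms by (cases l) auto
  have "(2 * l + 3) * (l + l + l - 2) = 6 * m * m + 17 * m + 5"
    unfolding m by (simp add: algebra_simps)
  moreover have "9 * l\<^sup>2 - 3 * l + 1 = 9 * m * m + 15 * m + 7"
    unfolding m by (simp add: power2_eq_square algebra_simps)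
  moreover have "2 * m \<le> 3 * m * m + 2" by (cases m) auto
  ultimately show ?thesis by linarith
qed

theorem theorem6p2:
  fixes l :: nat and G :: "'a pair_pre_digraph"
  assumes "l \<ge> 1"
    and "pair_graph G"
    and "k_connected 2 G"
    and "pathwidth G \<ge> 2 ^ (9 * l\<^sup>2 - 3 * l + 2) - 2"
  shows "is_minor (Gamma_plus l) G \<or> is_minor (nabla l) G"
proof (rule disjCI)
  assume no_nabla: "\<not> is_minor (nabla l) G"
  interpret G: pair_graph G by (rule assms(2))
  interpret undirected "parcs G" using assms(2) by (rule undirected_parcs)
  have bic: "biconnected_in (parcs G) (pverts G)"
    by (rule biconnected_in_of_k_connected[OF assms(2,3)])
  obtain a b where ab: "a \<in> pverts G" "b \<in> pverts G" "a \<noteq> b" using biconnected_in_distinct[OF bic] .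
  have "9 * l\<^sup>2 - 3 * l + 2 = Suc (9 * l\<^sup>2 - 3 * l + 1)" by simp
  with assms(4) have "2 ^ Suc (9 * l\<^sup>2 - 3 * l + 1) - 2 \<le> pathwidth G" by (simp only:)
  then obtain \<psi> where \<psi>: "tree_model (parcs G) (words (9 * l\<^sup>2 - 3 * l + 1)) \<psi> (pverts G)"
    by (rule complete_tree_model_exists[OF assms(2) le_add2])
  have "Gamma_plus_model (parcs G) l (pverts G)"
  proof (rule ccontr)
    assume no_model: "\<not> Gamma_plus_model (parcs G) l (pverts G)"
    have "rooted_alternative (parcs G) l l l a b (pverts G)"
      using rooted_alternative_exists[OF G.pair_finite_verts bic \<psi> assms(1) no_model
          tree_height_suffices[OF assms(1)] ab] .
    moreover have "\<not> rooted_Gamma_plus (parcs G) l x y (pverts G)" for x y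
      using no_model rooted_Gamma_plus_imp_model by metis
    ultimately have "rooted_nabla (parcs G) l a b (pverts G)" by (simp add: rooted_alternative_def)
    then show False using no_nabla rooted_nabla_is_minor[OF assms(2)] assms(1) by (cases l) auto
  qed
  then show "is_minor (Gamma_plus l) G" by (rule Gamma_plus_model_is_minor[OF assms(2)])
qed

end
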